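(* Let $G$ be a unimodular locally compact second countable group, with a fixed left-invariant proper continuous metric $d$ and Haar measure $\mu$. Then for every $n\ge 0$ there are isomorphisms of abelian groups \[H^n(G,L^2(G))\cong HX^n_{(2)}(G),\qquad \underline{H}^n(G,L^2(G))\cong \underline{H}X^n_{(2)}(G).\]
   Context: Continuous cohomology: $H^n(G,L^2(G))$ is the cohomology of the complex $C(G^{n+1},L^2(G))^G$ of $G$-invariant continuous maps $G^{n+1}\to L^2(G)$ (topology of compact convergence; $G$ acts by $(g\cdot f)(x)=gf(g^{-1}x)$ with diagonal action on $G^{n+1}$ and left regular representation on $L^2(G)$), with homogeneous differential $d^{n-1}f(g_0,\dots,g_n)=\sum_{i=0}^n(-1)^i f(g_0,\dots,\widehat{g_i},\dots,g_n)$; the reduced version $\underline{H}^n(G,L^2(G))$ is obtained by quotienting cocycles by the closure of the image of the differential. Coarse $\ell^2$-cohomology: for $R>0$ let $G^{n+1}_R=\{(g_0,\dots,g_n)\in G^{n+1}: d(g_i,g_j)\le R \text{ for all } i,j\}$, and for measurable $\alpha\colon G^{n+1}\to\mathbb{C}$ let $\|\alpha\|_R^2=\int_{G^{n+1}_R}|\alpha|^2\,d\mu_{n+1}$, where $\mu_{n+1}$ is the product Haar measure. $CX^n_{(2)}(G)$ is the Fréchet space of classes (modulo $\mu_{n+1}$-null sets) of measurable $\alpha\colon G^{n+1}\to\mathbb{C}$ with $\|\alpha\|_R<\infty$ for all $R>0$, topologized by the seminorms $\|\cdot\|_R$. The homogeneous differential above makes $CX^*_{(2)}(G)$ a cochain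 complex of Fréchet spaces; $HX^n_{(2)}(G)$ is its cohomology and $\underline{H}X^n_{(2)}(G)$ its reduced cohomology (cocycles modulo the closure of the image of the differential). *)

theory Defs
  imports "HOL-Analysis.Analysis" "HOL-Algebra.Coset" "HOL-Library.Function_Algebras"
begin

definition tup :: "nat \<Rightarrow> (nat \<Rightarrow> 'g) set" where
  "tup n = PiE {..n} (\<lambda>_. UNIV)"

definition act :: "nat \<Rightarrow> 'g::group_add \<Rightarrow> (nat \<Rightarrow> 'g) \<Rightarrow> (nat \<Rightarrow> 'g)" where
  "act n g x = restrict (\<lambda>i. g + x i) {..n}"

definition face :: "nat \<Rightarrow> nat \<Rightarrow> (nat \<Rightarrow> 'g) \<Rightarrow> (nat \<Rightarrow> 'g)" where
  "face n i x = restrict (\<lambda>j. if j < i then x j else x (Suc j)) {..n - 1}"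

definition add_monoid :: "'a::ab_group_add set \<Rightarrow> 'a monoid" where
  "add_monoid S = \<lparr>carrier = S, mult = (+), one = 0\<rparr>"

definition sqint :: "'g measure \<Rightarrow> ('g \<Rightarrow> complex) \<Rightarrow> bool" where
  "sqint M \<phi> \<longleftrightarrow> \<phi> \<in> borel_measurable M \<and> integrable M (\<lambda>y. (cmod (\<phi> y))^2)"

definition l2dist :: "'g measure \<Rightarrow> ('g \<Rightarrow> complex) \<Rightarrow> ('g \<Rightarrow> complex) \<Rightarrow> real" where
  "l2dist M \<phi> \<psi> = sqrt (\<integral>y. (cmod (\<phi> y - \<psi> y))^2 \<partial>M)"

text \<open>G-invariant continuous maps G^(n+1) -> L^2(G); representatives vanish off G^(n+1).
  Continuity w.r.t. the product topology on G^(n+1) (Function_Topology) and the L^2 metric.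
  Invariance: f(g x) = lambda_g (f x) in L^2, i.e. f (g x) y = f x (g^-1 y) for a.e. y.\<close>
definition ccochains :: "'g::{group_add,topological_space} measure \<Rightarrow> nat \<Rightarrow> ((nat \<Rightarrow> 'g) \<Rightarrow> 'g \<Rightarrow> complex) set" where
  "ccochains M n = {f.
      (\<forall>x. x \<notin> tup n \<longrightarrow> f x = 0) \<and>
      (\<forall>x\<in>tup n. sqint M (f x)) \<and>
      (\<forall>x\<in>tup n. \<forall>e>0. \<exists>U. open U \<and> x \<in> U \<and> (\<forall>y\<in>U \<inter> tup n. l2dist M (f y) (f x) < e)) \<and>
      (\<forall>g. \<forall>x\<in>tup n. AE y in M. f (act n g x) y = f x (- g + y))}"

definition cd :: "nat \<Rightarrow> ((nat \<Rightarrow> 'g) \<Rightarrow> 'g \<Rightarrow> complex) \<Rightarrow> ((nat \<Rightarrow> 'g) \<Rightarrow> 'g \<Rightarrow> complex)" where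
  "cd n f = (\<lambda>x. if x \<in> tup (Suc n)
      then (\<lambda>y. \<Sum>i\<le>Suc n. (-1)^i * f (face (Suc n) i x) y) else (\<lambda>_. 0))"

definition cZ :: "'g::{group_add,topological_space} measure \<Rightarrow> nat \<Rightarrow> ((nat \<Rightarrow> 'g) \<Rightarrow> 'g \<Rightarrow> complex) set" where
  "cZ M n = {f \<in> ccochains M n. \<forall>x\<in>tup (Suc n). AE y in M. cd n f x y = 0}"

definition cB :: "'g::{group_add,topological_space} measure \<Rightarrow> nat \<Rightarrow> ((nat \<Rightarrow> 'g) \<Rightarrow> 'g \<Rightarrow> complex) set" where
  "cB M n = {f \<in> ccochains M n.
     (if n = 0 then (\<forall>x\<in>tup 0. AE y in M. f x y = 0)
      else (\<exists>h\<in>ccochains M (n - 1). \<forall>x\<in>tup n. AE y in M. f x y = cd (n - 1) h x y))}"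

definition cBcl :: "'g::{group_add,topological_space} measure \<Rightarrow> nat \<Rightarrow> ((nat \<Rightarrow> 'g) \<Rightarrow> 'g \<Rightarrow> complex) set" where
  "cBcl M n = {f \<in> ccochains M n. \<forall>K. compact K \<and> K \<subseteq> tup n \<longrightarrow>
      (\<forall>e>0. \<exists>b\<in>cB M n. \<forall>x\<in>K. l2dist M (f x) (b x) < e)}"

definition prodM :: "'g measure \<Rightarrow> nat \<Rightarrow> (nat \<Rightarrow> 'g) measure" where
  "prodM M n = PiM {..n} (\<lambda>_. M)"

definition GR :: "nat \<Rightarrow> real \<Rightarrow> (nat \<Rightarrow> 'g::metric_space) set" where
  "GR n R = {x \<in> tup n. \<forall>i\<le>n. \<forall>j\<le>n. dist (x i) (x j) \<le> R}"

definition xnorm2 :: "'g::metric_space measure \<Rightarrow> nat \<Rightarrow> real \<Rightarrow> ((nat \<Rightarrow> 'g) \<Rightarrow> complex) \<Rightarrow> ennreal" where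
  "xnorm2 M n R \<alpha> = (\<integral>\<^sup>+ x. indicator (GR n R) x * ennreal ((cmod (\<alpha> x))^2) \<partial>prodM M n)"

definition xcochains :: "'g::metric_space measure \<Rightarrow> nat \<Rightarrow> ((nat \<Rightarrow> 'g) \<Rightarrow> complex) set" where
  "xcochains M n = {\<alpha>. (\<forall>x. x \<notin> tup n \<longrightarrow> \<alpha> x = 0) \<and>
      \<alpha> \<in> borel_measurable (prodM M n) \<and> (\<forall>R>0. xnorm2 M n R \<alpha> < \<infinity>)}"

definition xd :: "nat \<Rightarrow> ((nat \<Rightarrow> 'g) \<Rightarrow> complex) \<Rightarrow> ((nat \<Rightarrow> 'g) \<Rightarrow> complex)" where
  "xd n \<alpha> = (\<lambda>x. if x \<in> tup (Suc n) then (\<Sum>i\<le>Suc n. (-1)^i * \<alpha> (face (Suc n) i x)) else 0)"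

definition xZ :: "'g::metric_space measure \<Rightarrow> nat \<Rightarrow> ((nat \<Rightarrow> 'g) \<Rightarrow> complex) set" where
  "xZ M n = {\<alpha> \<in> xcochains M n. AE x in prodM M (Suc n). xd n \<alpha> x = 0}"

definition xB :: "'g::metric_space measure \<Rightarrow> nat \<Rightarrow> ((nat \<Rightarrow> 'g) \<Rightarrow> complex) set" where
  "xB M n = {\<alpha> \<in> xcochains M n.
     (if n = 0 then (AE x in prodM M 0. \<alpha> x = 0)
      else (\<exists>\<beta>\<in>xcochains M (n - 1). AE x in prodM M n. \<alpha> x = xd (n - 1) \<beta> x))}"

definition xBcl :: "'g::metric_space measure \<Rightarrow> nat \<Rightarrow> ((nat \<Rightarrow> 'g) \<Rightarrow> complex) set" where
  "xBcl M n = {\<alpha> \<in> xcochains M n. \<forall>R>0. \<forall>e>0. \<exists>\<beta>\<in>xB M n. xnorm2 M n R (\<alpha> - \<beta>) < ennreal e}"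

end

theory Submission
  imports Defs "HOL-Probability.Infinite_Product_Measure"
begin

text \<open>
  An invariant map \<open>f\<close> is determined by the function \<open>\<alpha> x = f x 1\<close>, since \<open>f x y = \<alpha> (y\<^sup>-\<^sup>1 x)\<close> for
  almost every \<open>y\<close>; the function \<open>\<alpha>\<close> exists because a continuous map into \<open>L\<^sup>2\<close> has a jointly
  measurable version. Unfolding the integral over tuples of bounded diameter along the diagonal
  action (this uses right invariance) shows that \<open>\<alpha>\<close> is a coarse cochain. Conversely, averaging a
  coarse cochain over each variable with a left invariant compactly supported kernel yields a
  function whose associated map is continuous into \<open>L\<^sup>2\<close>. Averaging is a chain map that is
  homotopic to the identity, by the prism operator averaged against the same kernel, on coarse
  and on continuous cochains alike. Hence it induces an isomorphism in cohomology, and the norm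
  estimates relating \<open>f\<close> and \<open>\<alpha>\<close> show that it matches the closures of the coboundaries.
\<close>

text \<open>Cochains are functions here, and their equalities hold only almost everywhere. Passing
  from \<open>f\<close> to \<open>\<alpha>\<close> involves a choice and gives no additive map of
  functions, so the comparison map runs the other way: \<open>Psi\<close> is additive on the nose
  and ignores null sets, because the averaging measures have densities. The way back is only a
  relation, \<open>ver\<close>, which serves to prove that \<open>Psi\<close> is bijective on
  cohomology. A second obstacle is that faces and prisms change the number of variables, while Haar
  measure may be infinite, so a variable cannot simply be integrated out. Integrals over
  \<open>GR n R\<close> are unfolded along orbits to a bounded slice, compared with a product of
  balls, where a forgotten variable has finite mass, and folded back. Each round trip enlarges the
  radius, which is harmless because every radius is allowed. The kernel is bounded with bounded
  support, which controls norms and radii; it is Lipschitz, which gives continuity into L^2; and it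
  is left invariant, which makes averaging commute with the diagonal action.\<close>

lemma add_monoid_simps [simp]:
  "carrier (add_monoid S) = S" "x \<otimes>\<^bsub>add_monoid S\<^esub> y = x + y" "\<one>\<^bsub>add_monoid S\<^esub> = 0"
  by (simp_all add: add_monoid_def)

section \<open>Quotients of additive groups of functions\<close>

definition add_closed :: "'a::ab_group_add set \<Rightarrow> bool" where
  "add_closed S \<longleftrightarrow> 0 \<in> S \<and> (\<forall>x\<in>S. \<forall>y\<in>S. x + y \<in> S) \<and> (\<forall>x\<in>S. - x \<in> S)"

lemma add_closedI:
  assumes "0 \<in> S" "\<And>x y. x \<in> S \<Longrightarrow> y \<in> S \<Longrightarrow> x - y \<in> S"
  shows "add_closed S"
proof -
  have "- x \<in> S" if "x \<in> S" for x using assms(2)[OF assms(1) that] by simp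
  then have "x + y \<in> S" if "x \<in> S" "y \<in> S" for x y using assms(2)[of x "- y"] that by simp
  then show ?thesis using assms(1) \<open>\<And>x. x \<in> S \<Longrightarrow> - x \<in> S\<close> by (auto simp: add_closed_def)
qed

lemma add_closedD:
  assumes "add_closed S"
  shows "0 \<in> S" "\<And>x y. x \<in> S \<Longrightarrow> y \<in> S \<Longrightarrow> x + y \<in> S" "\<And>x. x \<in> S \<Longrightarrow> - x \<in> S"
    "\<And>x y. x \<in> S \<Longrightarrow> y \<in> S \<Longrightarrow> x - y \<in> S"
proof -
  show "\<And>x y. x \<in> S \<Longrightarrow> y \<in> S \<Longrightarrow> x - y \<in> S"
    using assms unfolding add_closed_def by (metis diff_conv_add_uminus)
qed (use assms in \<open>auto simp: add_closed_def\<close>)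

lemma comm_group_add_monoid:
  fixes S :: "'a::ab_group_add set"
  assumes S: "add_closed S"
  shows "comm_group (add_monoid S)"
proof (rule comm_groupI)
  fix x assume "x \<in> carrier (add_monoid S)"
  then show "\<exists>y\<in>carrier (add_monoid S). y \<otimes>\<^bsub>add_monoid S\<^esub> x = \<one>\<^bsub>add_monoid S\<^esub>"
    using add_closedD(3)[OF S] by (auto intro!: bexI[of _ "- x"])
qed (use add_closedD[OF S] in \<open>auto simp: add_ac\<close>)

lemma normal_add_monoid:
  fixes S N :: "'a::ab_group_add set"
  assumes S: "add_closed S" and N: "add_closed N" and sub: "N \<subseteq> S"
  shows "N \<lhd> add_monoid S"
proof -
  interpret comm_group "add_monoid S" by (rule comm_group_add_monoid[OF S])
  have inv: "inv\<^bsub>add_monoid S\<^esub> x = - x" if "x \<in> S" for x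
    using that add_closedD[OF S] by (intro inv_equality) auto
  have "subgroup N (add_monoid S)"
    using add_closedD[OF N] sub inv by (auto intro!: subgroup.intro)
  then show ?thesis by (rule normal_iff_subgroup[THEN iffD2])
qed

text \<open>First isomorphism theorem for \<open>\<phi>\<close> followed by the projection modulo
  \<open>L\<close>: \<open>ker\<close> identifies the kernel, and \<open>surj\<close> asks for
  surjectivity only up to \<open>L\<close>. The target stands on the left of the conclusion because
  \<open>\<phi>\<close> will run from coarse to continuous cocycles, against the order of the final
  statement.\<close>

lemma FactGroup_iso_add_monoid:
  fixes A N :: "'a::ab_group_add set" and B L :: "'b::ab_group_add set"
  assumes A: "add_closed A" and N: "add_closed N" "N \<subseteq> A"
    and B: "add_closed B" and L: "add_closed L" "L \<subseteq> B"
    and into: "\<And>a. a \<in> A \<Longrightarrow> \<phi> a \<in> B"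
    and additive: "\<And>a b. a \<in> A \<Longrightarrow> b \<in> A \<Longrightarrow> \<phi> (a + b) = \<phi> a + \<phi> b"
    and ker: "\<And>a. a \<in> A \<Longrightarrow> \<phi> a \<in> L \<longleftrightarrow> a \<in> N"
    and surj: "\<And>b. b \<in> B \<Longrightarrow> \<exists>a\<in>A. b - \<phi> a \<in> L"
  shows "(add_monoid B Mod L) \<cong> (add_monoid A Mod N)"
proof -
  interpret GA: comm_group "add_monoid A" by (rule comm_group_add_monoid[OF A])
  interpret GB: comm_group "add_monoid B" by (rule comm_group_add_monoid[OF B])
  interpret NN: normal N "add_monoid A" by (rule normal_add_monoid[OF A N])
  interpret NL: normal L "add_monoid B" by (rule normal_add_monoid[OF B L])
  define \<psi> where "\<psi> a = L #>\<^bsub>add_monoid B\<^esub> \<phi> a" for a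
  have coset: "L #>\<^bsub>add_monoid B\<^esub> b = {l + b |l. l \<in> L}" for b
    by (auto simp: r_coset_def)
  have coset_eq: "L #>\<^bsub>add_monoid B\<^esub> b = L #>\<^bsub>add_monoid B\<^esub> c" if "b - c \<in> L" for b c
  proof -
    have "l + b \<in> {l + c |l. l \<in> L}" if "l \<in> L" for l
      using that add_closedD(2)[OF L(1) that \<open>b - c \<in> L\<close>] by (auto intro!: exI[of _ "l + (b - c)"])
    moreover have "l + c \<in> {l + b |l. l \<in> L}" if "l \<in> L" for l
      using that add_closedD(4)[OF L(1) that \<open>b - c \<in> L\<close>] by (auto intro!: exI[of _ "l - (b - c)"])
    ultimately show ?thesis unfolding coset by blast
  qed
  have hom: "\<psi> \<in> hom (add_monoid A) (add_monoid B Mod L)"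
  proof (rule homI)
    fix x assume "x \<in> carrier (add_monoid A)"
    then show "\<psi> x \<in> carrier (add_monoid B Mod L)"
      using into by (auto simp: \<psi>_def FactGroup_def RCOSETS_def)
  next
    fix x y assume xy: "x \<in> carrier (add_monoid A)" "y \<in> carrier (add_monoid A)"
    then show "\<psi> (x \<otimes>\<^bsub>add_monoid A\<^esub> y) = \<psi> x \<otimes>\<^bsub>add_monoid B Mod L\<^esub> \<psi> y"
      using NL.rcos_sum[of "\<phi> x" "\<phi> y"] into by (simp add: \<psi>_def FactGroup_def additive)
  qed
  have gB: "group (add_monoid B Mod L)" by (rule NL.factorgroup_is_group)
  interpret h: group_hom "add_monoid A" "add_monoid B Mod L" \<psi>
    using hom gB by (simp add: group_hom_def group_hom_axioms_def)
  have "kernel (add_monoid A) (add_monoid B Mod L) \<psi> = N"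
  proof -
    have "\<psi> a = L \<longleftrightarrow> a \<in> N" if "a \<in> A" for a
    proof
      assume "\<psi> a = L"
      moreover have "\<phi> a \<in> \<psi> a"
        using add_closedD(1)[OF L(1)] unfolding \<psi>_def coset by force
      ultimately show "a \<in> N" using ker that by simp
    next
      assume "a \<in> N"
      then have "\<phi> a - 0 \<in> L" using ker that by simp
      from coset_eq[OF this] show "\<psi> a = L" by (simp add: \<psi>_def coset)
    qed
    then show ?thesis using N by (auto simp: kernel_def FactGroup_def)
  qed
  moreover have "\<psi> ` carrier (add_monoid A) = carrier (add_monoid B Mod L)"
  proof
    show "carrier (add_monoid B Mod L) \<subseteq> \<psi> ` carrier (add_monoid A)"
    proof
      fix c assume "c \<in> carrier (add_monoid B Mod L)"
      then obtain b where b: "b \<in> B" "c = L #>\<^bsub>add_monoid B\<^esub> b"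
        by (auto simp: FactGroup_def RCOSETS_def)
      obtain a where "a \<in> A" "b - \<phi> a \<in> L" using surj[OF b(1)] by blast
      then show "c \<in> \<psi> ` carrier (add_monoid A)"
        using coset_eq b by (auto simp: \<psi>_def)
    qed
  qed (use hom in \<open>auto simp: hom_def\<close>)
  ultimately have "(add_monoid A Mod N) \<cong> (add_monoid B Mod L)"
    using h.FactGroup_iso by simp
  then show ?thesis
    by (rule group.iso_sym[OF NN.factorgroup_is_group])
qed

subsection \<open>Simplicial identities\<close>

text \<open>In the usual notation (x_0, ..., x_i, z_i, ..., z_n): the shift \<open>j - 1\<close>
  makes index \<open>i\<close> occur once for \<open>x\<close> and once for
  \<open>z\<close>.\<close>

definition mix :: "nat \<Rightarrow> nat \<Rightarrow> (nat \<Rightarrow> 'g) \<Rightarrow> (nat \<Rightarrow> 'g) \<Rightarrow> (nat \<Rightarrow> 'g)" where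
  "mix n i x z = restrict (\<lambda>j. if j \<le> i then x j else z (j - 1)) {..Suc n}"

lemma tupI: "(\<And>i. i > n \<Longrightarrow> x i = undefined) \<Longrightarrow> x \<in> tup n"
  by (auto simp: tup_def PiE_iff extensional_def)

lemma restrict_tup [simp, intro]: "restrict f {..n} \<in> tup n"
  by (rule tupI) auto

lemma tup_undefined: "x \<in> tup n \<Longrightarrow> n < i \<Longrightarrow> x i = undefined"
  by (auto simp: tup_def PiE_iff extensional_def)

lemma tup_eqI: "x \<in> tup n \<Longrightarrow> y \<in> tup n \<Longrightarrow> (\<And>i. i \<le> n \<Longrightarrow> x i = y i) \<Longrightarrow> x = y"
  by (rule ext) (metis not_le tup_undefined)

lemma face_tup [simp, intro]: "face (Suc n) i x \<in> tup n"
  by (simp add: face_def)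

lemma act_tup [simp, intro]: "act n g x \<in> tup n"
  by (simp add: act_def)

lemma mix_tup [simp, intro]: "mix n i x z \<in> tup (Suc n)"
  by (simp add: mix_def)

lemma face_apply: "j \<le> n \<Longrightarrow> face (Suc n) i x j = (if j < i then x j else x (Suc j))"
  by (simp add: face_def)

lemma act_apply: "j \<le> n \<Longrightarrow> act n g x j = g + x j"
  by (simp add: act_def)

lemma act_act [simp]: "act n g (act n h x) = act n (g + h) x"
  by (rule tup_eqI[of _ n]) (auto simp: act_apply add.assoc)

lemma act_zero [simp]: "x \<in> tup n \<Longrightarrow> act n 0 x = x"
  by (rule tup_eqI[of _ n]) (auto simp: act_apply)

lemma face_act [simp]: "face (Suc n) i (act (Suc n) g x) = act n g (face (Suc n) i x)"
  by (rule tup_eqI[of _ n]) (auto simp: act_apply face_apply)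

lemma mix_act: "mix n i (act n g x) (act n g z) = act (Suc n) g (mix n i x z)" if "i \<le> n"
  by (rule tup_eqI[of _ "Suc n"]) (use that in \<open>auto simp: act_def mix_def\<close>)

text \<open>Reduces the simplicial identities for both complexes to scalar functions, with
  \<open>y\<close> as a parameter.\<close>

lemma cd_eq_xd: "cd n f x y = xd n (\<lambda>w. f w y) x"
  by (simp add: cd_def xd_def)

lemma face_face:
  assumes "j \<le> i"
  shows "face (Suc n) i (face (Suc (Suc n)) j x) = face (Suc n) j (face (Suc (Suc n)) (Suc i) x)"
  by (rule tup_eqI[of _ n]) (use assms in \<open>auto simp: face_apply\<close>)

lemma xd_xd: "xd (Suc n) (xd n \<alpha>) x = 0"
proof (cases "x \<in> tup (Suc (Suc n))")
  case True
  define a where "a j i = (-1::complex) ^ (i + j) * \<alpha> (face (Suc n) i (face (Suc (Suc n)) j x))" for j i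
  have "xd (Suc n) (xd n \<alpha>) x = (\<Sum>j\<le>Suc (Suc n). \<Sum>i\<le>Suc n. a j i)"
    using True by (simp add: xd_def a_def sum_distrib_left power_add mult_ac del: sum.atMost_Suc)
  also have "\<dots> = (\<Sum>(j,i)\<in>{..Suc (Suc n)} \<times> {..Suc n}. a j i)"
    by (simp add: sum.cartesian_product del: sum.atMost_Suc)
  \<comment> \<open>The two halves cancel: \<open>face_face\<close> matches the pair (j, i) with
    (\<open>Suc i\<close>, j), whose sign exponent is larger by one.\<close>
  also have "\<dots> = (\<Sum>(j,i)\<in>{(j,i). j \<le> i \<and> i \<le> Suc n}. a j i) + (\<Sum>(j,i)\<in>{(j,i). i < j \<and> j \<le> Suc (Suc n)}. a j i)"
  proof (subst sum.union_disjoint[symmetric])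
    show "finite {(j,i). j \<le> i \<and> i \<le> Suc n}" "finite {(j,i). i < j \<and> j \<le> Suc (Suc n)}"
      by (rule finite_subset[of _ "{..Suc (Suc n)} \<times> {..Suc n}"]; force)+
  qed (auto intro!: sum.cong)
  also have "(\<Sum>(j,i)\<in>{(j,i). i < j \<and> j \<le> Suc (Suc n)}. a j i) = (\<Sum>(j,i)\<in>{(j,i). j \<le> i \<and> i \<le> Suc n}. a (Suc i) j)"
    by (rule sum.reindex_bij_witness[of _ "\<lambda>(j,i). (Suc i, j)" "\<lambda>(j,i). (i, j - 1)"]) auto
  also have "\<dots> = (\<Sum>(j,i)\<in>{(j,i). j \<le> i \<and> i \<le> Suc n}. - a j i)"
    by (intro sum.cong) (auto simp: a_def face_face add.commute)
  finally show ?thesis by (simp add: sum_negf case_prod_unfold)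
qed (simp add: xd_def)

text \<open>The tuples \<open>mix n i x z\<close> are the simplices of the prism spanned by \<open>x\<close> and \<open>z\<close>.\<close>
lemma prism_identity:
  assumes x: "x \<in> tup n" and z: "z \<in> tup n"
  shows "\<alpha> z - \<alpha> x = (\<Sum>i\<le>n. (-1) ^ i * xd n \<alpha> (mix n i x z))
     + (\<Sum>j\<le>n. (-1) ^ j * (\<Sum>i<n. (-1) ^ i * \<alpha> (mix (n - 1) i (face n j x) (face n j z))))"
proof -
  \<comment> \<open>\<open>c i\<close> is the value at (x_0, ..., x_(i-1), z_i, ..., z_n), which
    moves from \<open>z\<close> at 0 to \<open>x\<close> at \<open>Suc n\<close>. Deleting vertex
    \<open>i\<close> or \<open>Suc i\<close> of \<open>mix n i x z\<close> gives \<open>c i\<close>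
    or \<open>c (Suc i)\<close> with opposite signs, so these terms telescope.\<close>
  define c where "c i = \<alpha> (restrict (\<lambda>j. if j < i then x j else z j) {..n})" for i
  define m where "m i j = \<alpha> (mix (n - 1) i (face n j x) (face n j z))" for i j
  define t where "t i j = (-1::complex) ^ (i + j) * \<alpha> (face (Suc n) j (mix n i x z))" for i j
  \<comment> \<open>Every other face drops the same index from both \<open>x\<close> and
    \<open>z\<close> and leaves a prism simplex over the faces; the position of the jump moves down
    only if the lost vertex belongs to \<open>x\<close>. In both cases \<open>n\<close> is positive,
    so \<open>n - 1\<close> is a true predecessor.\<close>
  have f1: "face (Suc n) j (mix n i x z) = mix (n - 1) (i - 1) (face n j x) (face n j z)"
    if "j < i" "i \<le> n" for i j
  proof -
    have "n = Suc (n - 1)" using that by simp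
    then have "mix (n - 1) (i - 1) (face n j x) (face n j z) \<in> tup n" by (metis mix_tup)
    then show ?thesis
      by (rule tup_eqI[of _ n, OF face_tup]) (use that in \<open>auto simp: face_def mix_def\<close>)
  qed
  have f2: "face (Suc n) (Suc j) (mix n i x z) = mix (n - 1) i (face n j x) (face n j z)"
    if "i < j" "j \<le> n" for i j
  proof -
    have "n = Suc (n - 1)" using that by simp
    then have "mix (n - 1) i (face n j x) (face n j z) \<in> tup n" by (metis mix_tup)
    then show ?thesis
      by (rule tup_eqI[of _ n, OF face_tup]) (use that in \<open>auto simp: face_def mix_def\<close>)
  qed
  have f3: "\<alpha> (face (Suc n) i (mix n i x z)) = c i" "\<alpha> (face (Suc n) (Suc i) (mix n i x z)) = c (Suc i)"
    if "i \<le> n" for i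
    unfolding c_def using that
    by (auto intro!: arg_cong[of _ _ \<alpha>] tup_eqI[of _ n] simp: face_def mix_def)
  have "(\<Sum>i\<le>n. (-1) ^ i * xd n \<alpha> (mix n i x z)) = (\<Sum>i\<le>n. \<Sum>j\<le>Suc n. t i j)"
    by (simp add: xd_def t_def sum_distrib_left power_add mult_ac del: sum.atMost_Suc)
  also have "\<dots> = (\<Sum>i\<le>n. (c i - c (Suc i)) + (\<Sum>j<i. t i j) + (\<Sum>j\<in>{Suc i<..Suc n}. t i j))"
  proof (rule sum.cong[OF refl])
    fix i assume "i \<in> {..n}"
    then have "{..Suc n} = {i, Suc i} \<union> {..<i} \<union> {Suc i<..Suc n}" and "i \<le> n" by auto
    then have "(\<Sum>j\<le>Suc n. t i j) = t i i + t i (Suc i) + (\<Sum>j<i. t i j) + (\<Sum>j\<in>{Suc i<..Suc n}. t i j)"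
      using sum.union_disjoint[of "{..<i}" "{Suc i<..Suc n}" "t i"] by (simp add: disjoint_iff)
    then show "(\<Sum>j\<le>Suc n. t i j) = (c i - c (Suc i)) + (\<Sum>j<i. t i j) + (\<Sum>j\<in>{Suc i<..Suc n}. t i j)"
      using \<open>i \<le> n\<close> by (simp add: t_def f3)
  qed
  also have "\<dots> = (c 0 - c (Suc n)) + (\<Sum>(i,j)\<in>(SIGMA i:{..n}. {..<i}). t i j)
      + (\<Sum>(i,j)\<in>(SIGMA i:{..n}. {Suc i<..Suc n}). t i j)"
    by (simp add: sum.distrib sum.Sigma sum_telescope)
  also have "(\<Sum>(i,j)\<in>(SIGMA i:{..n}. {..<i}). t i j) = (\<Sum>(i,j)\<in>{(i,j). j \<le> i \<and> i < n}. - ((-1) ^ (i + j) * m i j))"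
    by (rule sum.reindex_bij_witness[of _ "\<lambda>(i,j). (Suc i, j)" "\<lambda>(i,j). (i - 1, j)"])
      (auto simp: t_def m_def f1 minus_one_power_iff)
  also have "(\<Sum>(i,j)\<in>(SIGMA i:{..n}. {Suc i<..Suc n}). t i j) = (\<Sum>(i,j)\<in>{(i,j). i < j \<and> j \<le> n}. - ((-1) ^ (i + j) * m i j))"
  proof (rule sum.reindex_bij_witness[of _ "\<lambda>(i,j). (i, Suc j)" "\<lambda>(i,j). (i, j - 1)"])
    fix p assume "p \<in> (SIGMA i:{..n}. {Suc i<..Suc n})"
    then obtain i j where "p = (i, Suc j)" "i < j" "j \<le> n"
      by (cases p, case_tac "snd p") auto
    then show "(case case p of (i, j) \<Rightarrow> (i, j - 1) of (i, j) \<Rightarrow> - ((- 1) ^ (i + j) * m i j)) = (case p of (i, j) \<Rightarrow> t i j)"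
      by (simp add: t_def m_def f2)
  qed auto
  \<comment> \<open>The two triangular index ranges fill the rectangle over which the prism operator
    of the faces is summed.\<close>
  also have "(c 0 - c (Suc n)) + (\<Sum>(i,j)\<in>{(i,j). j \<le> i \<and> i < n}. - ((-1) ^ (i + j) * m i j))
      + (\<Sum>(i,j)\<in>{(i,j). i < j \<and> j \<le> n}. - ((-1) ^ (i + j) * m i j))
      = (c 0 - c (Suc n)) + (\<Sum>(i,j)\<in>{..<n} \<times> {..n}. - ((-1) ^ (i + j) * m i j))"
    unfolding add.assoc
  proof (subst sum.union_disjoint[symmetric])
    show "finite {(i,j). j \<le> i \<and> i < n}" "finite {(i,j). i < j \<and> j \<le> n}"
      by (rule finite_subset[of _ "{..<n} \<times> {..n}"]; force)+
  qed (auto intro!: sum.cong)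
  also have "(\<Sum>(i,j)\<in>{..<n} \<times> {..n}. - ((-1) ^ (i + j) * m i j)) = - (\<Sum>j\<le>n. (-1) ^ j * (\<Sum>i<n. (-1) ^ i * m i j))"
  proof -
    have "(\<Sum>j\<le>n. (-1) ^ j * (\<Sum>i<n. (-1) ^ i * m i j)) = (\<Sum>j\<le>n. \<Sum>i<n. (-1) ^ (i + j) * m i j)"
      by (simp add: sum_distrib_left power_add mult_ac)
    also have "\<dots> = (\<Sum>i<n. \<Sum>j\<le>n. (-1) ^ (i + j) * m i j)"
      by (rule sum.swap)
    finally show ?thesis by (simp add: sum.cartesian_product sum_negf case_prod_unfold)
  qed
  also have "c 0 = \<alpha> z"
    using z unfolding c_def by (auto intro!: arg_cong[of _ _ \<alpha>] tup_eqI[of _ n])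
  also have "c (Suc n) = \<alpha> x"
    using x unfolding c_def by (auto intro!: arg_cong[of _ _ \<alpha>] tup_eqI[of _ n])
  finally show ?thesis by (simp add: m_def)
qed

subsection \<open>Product measures\<close>

text \<open>Source and target factors may differ because a translation carries the averaging measure
  at one centre to that at another.\<close>

lemma distr_PiM_coordinatewise:
  assumes I: "finite I" and M: "product_sigma_finite M" and N: "product_sigma_finite N"
    and T [measurable]: "\<And>i. i \<in> I \<Longrightarrow> T i \<in> measurable (M i) (N i)"
    and d: "\<And>i. i \<in> I \<Longrightarrow> distr (M i) (N i) (T i) = N i"
  shows "distr (PiM I M) (PiM I N) (\<lambda>x. \<lambda>i\<in>I. T i (x i)) = PiM I N"
proof -
  interpret M: product_sigma_finite M by fact
  interpret N: product_sigma_finite N by fact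
  have m: "(\<lambda>x. \<lambda>i\<in>I. T i (x i)) \<in> measurable (PiM I M) (PiM I N)"
    by (intro measurable_restrict measurable_compose[OF _ T] measurable_component_singleton)
  show ?thesis
  proof (rule N.PiM_eqI[OF I])
    fix A assume A: "\<And>i. i \<in> I \<Longrightarrow> A i \<in> sets (N i)"
    have "emeasure (distr (PiM I M) (PiM I N) (\<lambda>x. \<lambda>i\<in>I. T i (x i))) (Pi\<^sub>E I A)
        = emeasure (PiM I M) ((\<lambda>x. \<lambda>i\<in>I. T i (x i)) -` Pi\<^sub>E I A \<inter> space (PiM I M))"
      using A I by (intro emeasure_distr m) auto
    also have "(\<lambda>x. \<lambda>i\<in>I. T i (x i)) -` Pi\<^sub>E I A \<inter> space (PiM I M) = (\<Pi>\<^sub>E i\<in>I. T i -` A i \<inter> space (M i))"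
      by (auto simp: space_PiM PiE_iff)
    also have "emeasure (PiM I M) \<dots> = (\<Prod>i\<in>I. emeasure (M i) (T i -` A i \<inter> space (M i)))"
      using A I by (intro M.emeasure_PiM) (auto intro: measurable_sets[OF T])
    also have "\<dots> = (\<Prod>i\<in>I. emeasure (N i) (A i))"
      using A by (intro prod.cong refl) (subst d[symmetric], simp_all add: emeasure_distr[OF T])
    finally show "emeasure (distr (PiM I M) (PiM I N) (\<lambda>x. \<lambda>i\<in>I. T i (x i))) (Pi\<^sub>E I A) = (\<Prod>i\<in>I. emeasure (N i) (A i))" .
  qed simp
qed

text \<open>Used for the averaging measures and for uniform measures on boxes: both are products of
  densities and have to be compared with the power of Haar measure.\<close>

lemma PiM_density:
  assumes I: "finite I" and M: "product_sigma_finite M"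
    and D: "product_sigma_finite (\<lambda>i. density (M i) (\<phi> i))"
    and [measurable]: "\<And>i. i \<in> I \<Longrightarrow> \<phi> i \<in> borel_measurable (M i)"
  shows "PiM I (\<lambda>i. density (M i) (\<phi> i)) = density (PiM I M) (\<lambda>z. \<Prod>i\<in>I. \<phi> i (z i))"
proof -
  interpret M: product_sigma_finite M by fact
  interpret D: product_sigma_finite "\<lambda>i. density (M i) (\<phi> i)" by fact
  have [measurable]: "(\<lambda>z. \<Prod>i\<in>I. \<phi> i (z i)) \<in> borel_measurable (PiM I M)"
    by (intro borel_measurable_prod_ennreal measurable_compose[OF measurable_component_singleton]) auto
  show ?thesis
  proof (rule D.PiM_eqI[OF I, symmetric])
    show "sets (density (PiM I M) (\<lambda>z. \<Prod>i\<in>I. \<phi> i (z i))) = sets (PiM I (\<lambda>i. density (M i) (\<phi> i)))"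
      by (simp cong: sets_PiM_cong)
    fix A assume "\<And>i. i \<in> I \<Longrightarrow> A i \<in> sets (density (M i) (\<phi> i))"
    then have A [measurable]: "\<And>i. i \<in> I \<Longrightarrow> A i \<in> sets (M i)" by simp
    have "Pi\<^sub>E I A \<in> sets (PiM I M)" using I A by auto
    then have "emeasure (density (PiM I M) (\<lambda>z. \<Prod>i\<in>I. \<phi> i (z i))) (Pi\<^sub>E I A)
       = (\<integral>\<^sup>+z. (\<Prod>i\<in>I. \<phi> i (z i)) * indicator (Pi\<^sub>E I A) z \<partial>PiM I M)"
      by (simp add: emeasure_density)
    also have "\<dots> = (\<integral>\<^sup>+z. (\<Prod>i\<in>I. \<phi> i (z i) * indicator (A i) (z i)) \<partial>PiM I M)"
      using I by (intro nn_integral_cong) (auto simp: space_PiM prod.distrib[symmetric] PiE_iff indicator_def intro!: prod_zero)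
    also have "\<dots> = (\<Prod>i\<in>I. \<integral>\<^sup>+a. \<phi> i a * indicator (A i) a \<partial>M i)"
      by (intro M.product_nn_integral_prod I) auto
    also have "\<dots> = (\<Prod>i\<in>I. emeasure (density (M i) (\<phi> i)) (A i))"
      by (intro prod.cong refl) (simp add: emeasure_density)
    finally show "emeasure (density (PiM I M) (\<lambda>z. \<Prod>i\<in>I. \<phi> i (z i))) (Pi\<^sub>E I A) = (\<Prod>i\<in>I. emeasure (density (M i) (\<phi> i)) (A i))" .
  qed
qed

text \<open>The entries of \<open>x\<close> after \<open>i\<close> and of \<open>z\<close> before
  \<open>i\<close> are forgotten, and each forgotten entry contributes total mass one. For Haar
  measure these factors could be infinite, hence the restriction to probability measures.\<close>

lemma distr_mix:
  assumes P: "prob_space P" and i: "i \<le> n" and sp: "space P = UNIV"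
  shows "distr (PiM {..n} (\<lambda>_. P) \<Otimes>\<^sub>M PiM {..n} (\<lambda>_. P)) (PiM {..Suc n} (\<lambda>_. P)) (\<lambda>(x,z). mix n i x z)
     = PiM {..Suc n} (\<lambda>_. P)"
proof -
  interpret P: prob_space P by fact
  interpret PP: product_sigma_finite "\<lambda>_::nat. P" by unfold_locales
  interpret PS: prob_space "PiM {..n} (\<lambda>_. P)" by (intro prob_space_PiM P)
  have m: "(\<lambda>(x,z). mix n i x z) \<in> measurable (PiM {..n} (\<lambda>_. P) \<Otimes>\<^sub>M PiM {..n} (\<lambda>_. P)) (PiM {..Suc n} (\<lambda>_. P))"
    unfolding mix_def case_prod_unfold using i
  proof (intro measurable_restrict)
    fix j assume "j \<in> {..Suc n}"
    then show "(\<lambda>p. if j \<le> i then fst p j else snd p (j - 1)) \<in> measurable (PiM {..n} (\<lambda>_. P) \<Otimes>\<^sub>M PiM {..n} (\<lambda>_. P)) P"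
      using i by (cases "j \<le> i") simp_all
  qed
  show ?thesis
  proof (rule PP.PiM_eqI)
    fix A assume A: "\<And>j. j \<in> {..Suc n} \<Longrightarrow> A j \<in> sets P"
    \<comment> \<open>The whole space is prescribed at forgotten entries; a kept entry
      \<open>z j\<close> sits at position \<open>Suc j\<close>.\<close>
    define B where "B j = (if j \<le> i then A j else UNIV)" for j
    define C where "C j = (if j < i then UNIV else A (Suc j))" for j
    have BC: "B j \<in> sets P" "C j \<in> sets P" if "j \<le> n" for j
      using A sets.top[of P] that i unfolding B_def C_def sp by auto
    have "(\<lambda>(x,z). mix n i x z) -` Pi\<^sub>E {..Suc n} A \<inter> space (PiM {..n} (\<lambda>_. P) \<Otimes>\<^sub>M PiM {..n} (\<lambda>_. P)) = Pi\<^sub>E {..n} B \<times> Pi\<^sub>E {..n} C"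
    proof -
      have "mix n i x z \<in> Pi\<^sub>E {..Suc n} A \<longleftrightarrow> (\<forall>j\<le>n. x j \<in> B j) \<and> (\<forall>j\<le>n. z j \<in> C j)" for x z
      proof -
        have "mix n i x z \<in> Pi\<^sub>E {..Suc n} A \<longleftrightarrow> (\<forall>j\<le>Suc n. (if j \<le> i then x j else z (j - 1)) \<in> A j)"
          by (auto simp: mix_def PiE_iff split: if_splits)
        also have "\<dots> \<longleftrightarrow> (\<forall>j\<le>n. x j \<in> B j) \<and> (\<forall>j\<le>n. z j \<in> C j)"
        proof safe
          fix j assume *: "\<forall>j\<le>Suc n. (if j \<le> i then x j else z (j - 1)) \<in> A j" and j: "j \<le> n"
          show "x j \<in> B j" using *[rule_format, of j] j by (auto simp: B_def)
          show "z j \<in> C j" using *[rule_format, of "Suc j"] j by (auto simp: C_def split: if_splits)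
        next
          fix j assume *: "\<forall>j\<le>n. x j \<in> B j" "\<forall>j\<le>n. z j \<in> C j" and j: "j \<le> Suc n"
          show "(if j \<le> i then x j else z (j - 1)) \<in> A j"
          proof (cases "j \<le> i")
            case True
            then show ?thesis using *(1)[rule_format, of j] i by (auto simp: B_def)
          next
            case False
            then obtain k where "j = Suc k" "i \<le> k" "k \<le> n" using j by (cases j) auto
            then show ?thesis using *(2)[rule_format, of k] by (auto simp: C_def split: if_splits)
          qed
        qed
        finally show ?thesis .
      qed
      then show ?thesis by (auto simp: space_pair_measure space_PiM sp PiE_iff)
    qed
    moreover have "Pi\<^sub>E {..Suc n} A \<in> sets (PiM {..Suc n} (\<lambda>_. P))" using A by auto
    ultimately have "emeasure (distr (PiM {..n} (\<lambda>_. P) \<Otimes>\<^sub>M PiM {..n} (\<lambda>_. P)) (PiM {..Suc n} (\<lambda>_. P)) (\<lambda>(x,z). mix n i x z)) (Pi\<^sub>E {..Suc n} A)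
        = emeasure (PiM {..n} (\<lambda>_. P) \<Otimes>\<^sub>M PiM {..n} (\<lambda>_. P)) (Pi\<^sub>E {..n} B \<times> Pi\<^sub>E {..n} C)"
      by (simp add: emeasure_distr[OF m])
    also have "\<dots> = emeasure (PiM {..n} (\<lambda>_. P)) (Pi\<^sub>E {..n} B) * emeasure (PiM {..n} (\<lambda>_. P)) (Pi\<^sub>E {..n} C)"
      using BC by (intro PS.emeasure_pair_measure_Times sets_PiM_I_finite) auto
    also have "\<dots> = (\<Prod>j\<le>n. emeasure P (B j)) * (\<Prod>j\<le>n. emeasure P (C j))"
      using BC by (subst (1 2) PP.emeasure_PiM) auto
    also have "(\<Prod>j\<le>n. emeasure P (B j)) = (\<Prod>j\<in>{..i}. emeasure P (A j))"
      using i P.emeasure_space_1 sp by (intro prod.mono_neutral_cong_right) (auto simp: B_def)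
    also have "(\<Prod>j\<le>n. emeasure P (C j)) = (\<Prod>j\<in>{i..n}. emeasure P (A (Suc j)))"
      using i P.emeasure_space_1 sp by (intro prod.mono_neutral_cong_right) (auto simp: C_def)
    also have "\<dots> = (\<Prod>j\<in>{Suc i..Suc n}. emeasure P (A j))"
      by (rule prod.reindex_bij_witness[of _ "\<lambda>j. j - 1" Suc]) auto
    also have "(\<Prod>j\<in>{..i}. emeasure P (A j)) * (\<Prod>j\<in>{Suc i..Suc n}. emeasure P (A j)) = (\<Prod>j\<in>{..Suc n}. emeasure P (A j))"
      using i by (subst prod.union_disjoint[symmetric]) (auto intro!: prod.cong simp del: prod.atMost_Suc)
    finally show "emeasure (distr (PiM {..n} (\<lambda>_. P) \<Otimes>\<^sub>M PiM {..n} (\<lambda>_. P)) (PiM {..Suc n} (\<lambda>_. P)) (\<lambda>(x,z). mix n i x z)) (Pi\<^sub>E {..Suc n} A)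
       = (\<Prod>j\<in>{..Suc n}. emeasure P (A j))" .
  qed auto
qed

lemma distr_face:
  fixes P :: "nat \<Rightarrow> 'g measure"
  assumes P: "\<And>j. j \<le> Suc n \<Longrightarrow> prob_space (P j)"
  shows "distr (PiM {..Suc n} P) (PiM {..n} (\<lambda>j. P (if j < i then j else Suc j))) (face (Suc n) i)
     = PiM {..n} (\<lambda>j. P (if j < i then j else Suc j))"
proof -
  have "face (Suc n) i = (\<lambda>\<omega> :: nat \<Rightarrow> 'g. \<lambda>j\<in>{..n}. \<omega> (if j < i then j else Suc j))"
    by (auto simp: face_def restrict_def fun_eq_iff)
  moreover have "inj_on (\<lambda>j. if j < i then j else Suc j) {..n}"
    by (auto simp: inj_on_def split: if_splits)
  ultimately show ?thesis
    using distr_PiM_reindex[of "{..Suc n}" P "\<lambda>j. if j < i then j else Suc j" "{..n}"] P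
    by simp
qed

text \<open>Cauchy-Schwarz against the constant 1. Integrability can be left open because the
  Bochner integral of a non-integrable function is 0.\<close>

lemma norm_integral_square_le:
  fixes u :: "'a \<Rightarrow> complex"
  assumes P: "prob_space P" and [measurable]: "u \<in> borel_measurable P"
  shows "ennreal ((cmod (\<integral>x. u x \<partial>P))\<^sup>2) \<le> (\<integral>\<^sup>+x. ennreal ((cmod (u x))\<^sup>2) \<partial>P)"
proof (cases "integrable P u")
  case True
  interpret prob_space P by fact
  have "ennreal (cmod (\<integral>x. u x \<partial>P)) \<le> (\<integral>\<^sup>+x. ennreal (cmod (u x)) \<partial>P)"
    by (rule integral_norm_bound_ennreal[OF True])
  then have "(ennreal (cmod (\<integral>x. u x \<partial>P)))\<^sup>2 \<le> (\<integral>\<^sup>+x. ennreal (cmod (u x)) * 1 \<partial>P)\<^sup>2"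
    by (simp add: power_mono)
  also have "\<dots> \<le> (\<integral>\<^sup>+x. (ennreal (cmod (u x)))\<^sup>2 \<partial>P) * (\<integral>\<^sup>+x. 1\<^sup>2 \<partial>P)"
    by (rule Cauchy_Schwarz_nn_integral) auto
  finally show ?thesis by (simp add: ennreal_power emeasure_space_1)
qed (simp add: not_integrable_integral_eq)

lemma cmod_add_square_le: "(cmod (a + b))\<^sup>2 \<le> 2 * (cmod a)\<^sup>2 + 2 * (cmod b)\<^sup>2"
proof -
  have "(cmod (a + b))\<^sup>2 \<le> (cmod a + cmod b)\<^sup>2"
    by (intro power_mono norm_triangle_ineq) auto
  also have "\<dots> \<le> 2 * (cmod a)\<^sup>2 + 2 * (cmod b)\<^sup>2"
    using sum_squares_bound[of "cmod a" "cmod b"] by (simp add: power2_sum)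
  finally show ?thesis .
qed

subsection \<open>The averaging kernel\<close>

locale unimodular_group =
  fixes M :: "'g::{group_add, metric_space, second_countable_topology} measure"
  assumes mult_cont: "continuous_on UNIV (\<lambda>p::'g \<times> 'g. fst p + snd p)"
    and inv_cont: "continuous_on UNIV (uminus :: 'g \<Rightarrow> 'g)"
    and left_inv_metric: "\<forall>g x y :: 'g. dist (g + x) (g + y) = dist x y"
    and proper_metric: "\<forall>(x::'g) r. compact (cball x r)"
    and borel_M: "sets M = sets borel"
    and haar_left: "\<forall>(g::'g). \<forall>A\<in>sets borel. emeasure M ((\<lambda>x. g + x) ` A) = emeasure M A"
    and haar_compact: "\<forall>K::'g set. compact K \<longrightarrow> emeasure M K < \<infinity>"
    and haar_open: "\<forall>U::'g set. open U \<and> U \<noteq> {} \<longrightarrow> emeasure M U > 0"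
    and unimodular: "\<forall>(g::'g). \<forall>A\<in>sets borel. emeasure M ((\<lambda>x. x + g) ` A) = emeasure M A"
begin

lemma dist_add_left [simp]: "dist (g + x) (g + y) = dist x (y :: 'g)"
  using left_inv_metric by blast

lemmas borel_M' [measurable_cong, simp] = borel_M

lemma space_M [simp]: "space M = UNIV"
  using sets_eq_imp_space_eq[OF borel_M] by simp

lemma measurable_M_iff: "measurable N M = measurable N borel" "measurable M N = measurable borel N"
  by (rule measurable_cong_sets; simp)+

lemma group_add_measurable [measurable (raw)]:
  fixes f g :: "'a \<Rightarrow> 'g"
  assumes [measurable]: "f \<in> measurable N borel" "g \<in> measurable N borel"
  shows "(\<lambda>x. f x + g x) \<in> measurable N borel"
proof -
  have "(\<lambda>p::'g \<times> 'g. fst p + snd p) \<in> measurable (borel \<Otimes>\<^sub>M borel) borel"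
    unfolding borel_prod using mult_cont by (rule borel_measurable_continuous_onI)
  from measurable_compose[OF measurable_Pair[OF assms] this] show ?thesis by simp
qed

lemma group_uminus_measurable [measurable (raw)]:
  fixes f :: "'a \<Rightarrow> 'g"
  assumes "f \<in> measurable N borel"
  shows "(\<lambda>x. - f x) \<in> measurable N borel"
  using measurable_compose[OF assms borel_measurable_continuous_onI[OF inv_cont]] .

sublocale sigma_finite_measure M
proof
  have "(\<Union>n::nat. cball (0::'g) (real n)) = UNIV"
    by (auto intro: real_arch_simple)
  then show "\<exists>A. countable A \<and> A \<subseteq> sets M \<and> \<Union>A = space M \<and> (\<forall>a\<in>A. emeasure M a \<noteq> \<infinity>)"
    using proper_metric haar_compact
    by (intro exI[of _ "range (\<lambda>n::nat. cball (0::'g) (real n))"]) (auto simp: less_top)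
qed

sublocale PM: product_sigma_finite "\<lambda>_::nat. M" ..

lemma distr_left: "distr M M (\<lambda>x. g + x) = M"
proof (rule measure_eqI)
  fix A assume "A \<in> sets (distr M M (\<lambda>x. g + x))"
  then have A [measurable]: "A \<in> sets borel" by simp
  have "(\<lambda>x. g + x) -` A = (\<lambda>x. - g + x) ` A"
    by (auto simp: image_iff add.assoc[symmetric] intro!: bexI[of _ "g + _"])
  then show "emeasure (distr M M (\<lambda>x. g + x)) A = emeasure M A"
    using haar_left by (simp add: emeasure_distr)
qed simp

lemma distr_right: "distr M M (\<lambda>x. x + g) = M"
proof (rule measure_eqI)
  fix A assume "A \<in> sets (distr M M (\<lambda>x. x + g))"
  then have A [measurable]: "A \<in> sets borel" by simp
  have "(\<lambda>x. x + g) -` A = (\<lambda>x. x + - g) ` A"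
    by (auto simp: image_iff add.assoc intro!: bexI[of _ "_ + g"])
  then show "emeasure (distr M M (\<lambda>x. x + g)) A = emeasure M A"
    using unimodular[rule_format, OF A, of "- g"] by (simp add: emeasure_distr)
qed simp

lemma nn_integral_left:
  assumes "f \<in> borel_measurable borel"
  shows "(\<integral>\<^sup>+x. f (g + x) \<partial>M) = (\<integral>\<^sup>+x. f x \<partial>M)"
  using assms by (subst (2) distr_left[symmetric, of g]) (simp add: nn_integral_distr)

lemma nn_integral_right:
  assumes "f \<in> borel_measurable borel"
  shows "(\<integral>\<^sup>+x. f (x + g) \<partial>M) = (\<integral>\<^sup>+x. f x \<partial>M)"
  using assms by (subst (2) distr_right[symmetric, of g]) (simp add: nn_integral_distr)

lemma AE_left:
  assumes "AE y in M. P y"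
  shows "AE y in M. P (g + y)"
proof -
  have "AE y in distr M M (\<lambda>x. g + x). P y" by (subst distr_left) (rule assms)
  then show ?thesis by (rule AE_distrD[rotated]) simp
qed

lemma emeasure_cball_finite: "emeasure M (cball a r) < \<infinity>"
  using proper_metric haar_compact by simp

lemma emeasure_cball_pos: "r > 0 \<Longrightarrow> emeasure M (cball a r) > 0"
  using haar_open[rule_format, of "ball a r"] emeasure_mono[of "ball a r" "cball a r" M]
  by (auto intro: less_le_trans)

subsubsection \<open>Powers of the group\<close>

lemma space_prodM [simp]: "space (prodM M n) = tup n"
  by (simp add: prodM_def space_PiM tup_def)

sublocale prodM: sigma_finite_measure "prodM M n" for n
  unfolding prodM_def by (rule PM.sigma_finite) simp

sublocale pMM: pair_sigma_finite "prodM M n" M for n ..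
sublocale MpM: pair_sigma_finite M "prodM M n" for n ..
sublocale ppM: pair_sigma_finite "prodM M n" "prodM M m" for n m ..

lemma prodM_component [measurable (raw)]:
  assumes "i \<le> n"
  shows "(\<lambda>x. x i) \<in> measurable (prodM M n) borel"
  using measurable_component_singleton[of i "{..n}" "\<lambda>_. M"] assms
  by (simp add: measurable_M_iff prodM_def)

lemma prodM_component' [measurable_dest]:
  assumes "f \<in> measurable N (prodM M n)" "g \<in> measurable L N" "i \<le> n"
  shows "(\<lambda>w. (f (g w)) i) \<in> measurable L borel"
  using measurable_compose[OF measurable_compose[OF assms(2,1)] prodM_component[OF assms(3)]] .

lemma measurable_into_prodM:
  assumes "\<And>i. i \<le> n \<Longrightarrow> (\<lambda>w. f w i) \<in> measurable N borel" "\<And>w. w \<in> space N \<Longrightarrow> f w \<in> tup n"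
  shows "f \<in> measurable N (prodM M n)"
  unfolding prodM_def using assms
  by (intro measurable_PiM_single') (auto simp: tup_def measurable_M_iff)

lemma act_measurable [measurable (raw)]:
  assumes [measurable]: "g \<in> measurable N borel" "x \<in> measurable N (prodM M n)"
  shows "(\<lambda>w. act n (g w) (x w)) \<in> measurable N (prodM M n)"
  by (rule measurable_into_prodM) (auto simp: act_apply)

text \<open>A constant left factor gives the diagonal action, a variable one recentres the averaging
  measure. Multiplying by \<open>h\<close> on the right commutes with the diagonal action on
  \<open>x\<close>.\<close>

definition tmul :: "nat \<Rightarrow> (nat \<Rightarrow> 'g) \<Rightarrow> (nat \<Rightarrow> 'g) \<Rightarrow> (nat \<Rightarrow> 'g)" where
  "tmul n x h = restrict (\<lambda>i. x i + h i) {..n}"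

lemma tmul_tup [simp, intro]: "tmul n x h \<in> tup n"
  by (simp add: tmul_def)

lemma tmul_apply: "i \<le> n \<Longrightarrow> tmul n x h i = x i + h i"
  by (simp add: tmul_def)

lemma tmul_measurable [measurable (raw)]:
  assumes [measurable]: "z \<in> measurable N (prodM M n)" "x \<in> measurable N (prodM M n)"
  shows "(\<lambda>w. tmul n (z w) (x w)) \<in> measurable N (prodM M n)"
  by (rule measurable_into_prodM) (auto simp: tmul_apply)

lemma face_measurable [measurable (raw)]:
  assumes [measurable]: "x \<in> measurable N (prodM M (Suc n))"
  shows "(\<lambda>w. face (Suc n) i (x w)) \<in> measurable N (prodM M n)"
proof (rule measurable_into_prodM)
  fix j assume "j \<le> n"
  then show "(\<lambda>w. face (Suc n) i (x w) j) \<in> measurable N borel"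
    by (cases "j < i") (simp_all add: face_apply)
qed simp

lemma mix_measurable [measurable (raw)]:
  assumes [measurable]: "x \<in> measurable N (prodM M n)" "z \<in> measurable N (prodM M n)" and i: "i \<le> n"
  shows "(\<lambda>w. mix n i (x w) (z w)) \<in> measurable N (prodM M (Suc n))"
proof (rule measurable_into_prodM)
  fix j assume "j \<le> Suc n"
  then show "(\<lambda>w. mix n i (x w) (z w) j) \<in> measurable N borel"
    using i by (cases "j \<le> i") (simp_all add: mix_def)
qed simp

lemma xd_measurable [measurable (raw)]:
  assumes [measurable]: "\<alpha> \<in> borel_measurable (prodM M n)" "x \<in> measurable N (prodM M (Suc n))"
  shows "(\<lambda>w. xd n \<alpha> (x w)) \<in> borel_measurable N"
proof -
  have "(\<lambda>w. \<Sum>i\<le>Suc n. (-1)^i * \<alpha> (face (Suc n) i (x w))) \<in> borel_measurable N"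
    by measurable
  moreover have "x w \<in> tup (Suc n)" if "w \<in> space N" for w
    using measurable_space[OF assms(2) that] by simp
  ultimately show ?thesis by (subst measurable_cong) (auto simp: xd_def)
qed

lemma distr_prodM_act: "distr (prodM M n) (prodM M n) (act n g) = prodM M n"
  using distr_PiM_coordinatewise[of "{..n}" "\<lambda>_. M" "\<lambda>_. M" "\<lambda>_ x. g + x"] distr_left PM.product_sigma_finite_axioms
  by (simp add: prodM_def act_def[abs_def])

lemma nn_integral_act:
  assumes "F \<in> borel_measurable (prodM M n)"
  shows "(\<integral>\<^sup>+z. F (act n g z) \<partial>prodM M n) = (\<integral>\<^sup>+z. F z \<partial>prodM M n)"
  using assms by (subst (2) distr_prodM_act[symmetric, of _ g]) (simp add: nn_integral_distr)

section \<open>The normalised bump function and the averaging measures\<close>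

definition ker_mass :: ennreal where
  "ker_mass = (\<integral>\<^sup>+z. ennreal (max 0 (1 - dist 0 z)) \<partial>M)"

lemma ker_mass_finite: "ker_mass < \<infinity>"
proof -
  have "ker_mass \<le> (\<integral>\<^sup>+z. indicator (cball 0 1) z \<partial>M)"
    unfolding ker_mass_def by (intro nn_integral_mono) (auto simp: indicator_def)
  also have "\<dots> < \<infinity>" using emeasure_cball_finite by simp
  finally show ?thesis .
qed

lemma ker_mass_pos: "ker_mass > 0"
proof -
  \<comment> \<open>One number serves as radius and as lower bound: on \<open>cball 0 c\<close> the
    bump is at least \<open>1 - c\<close>, which is at least \<open>c\<close>.\<close>
  obtain c :: real where c: "c > 0" "c \<le> 1/2" by (rule that[of "1/2"]) auto
  have "0 < ennreal c * emeasure M (cball 0 c)"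
    using emeasure_cball_pos[of c] c by (simp add: ennreal_zero_less_mult_iff)
  also have "\<dots> = (\<integral>\<^sup>+z. ennreal c * indicator (cball 0 c) z \<partial>M)"
    by (subst nn_integral_cmult_indicator) auto
  also have "\<dots> \<le> ker_mass"
    unfolding ker_mass_def using c by (intro nn_integral_mono) (auto simp: indicator_def intro!: ennreal_leI)
  finally show ?thesis .
qed

definition ker_height :: real where "ker_height = 1 / enn2real ker_mass"

lemma ker_height_pos: "ker_height > 0"
  using ker_mass_finite ker_mass_pos by (simp add: ker_height_def enn2real_positive_iff less_top)

lemma ker_height_mass: "ennreal ker_height * ker_mass = 1"
proof -
  obtain m where "ker_mass = ennreal m" "m > 0"
    using ker_mass_finite ker_mass_pos by (cases ker_mass) auto
  then show ?thesis by (simp add: ker_height_def ennreal_mult[symmetric])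
qed

text \<open>By left invariance of the metric, averaging against \<open>kern\<close> is convolution with a fixed bump
  function, and the total mass does not depend on the centre.\<close>
definition kern :: "'g \<Rightarrow> 'g \<Rightarrow> real" where
  "kern a z = ker_height * max 0 (1 - dist a z)"

lemma kern_nonneg [simp]: "kern a z \<ge> 0"
  using ker_height_pos by (simp add: kern_def)

lemma kern_le: "kern a z \<le> ker_height"
  using ker_height_pos by (simp add: kern_def)

lemma kern_eq_0: "dist a z \<ge> 1 \<Longrightarrow> kern a z = 0"
  by (simp add: kern_def)

lemma kern_add_left: "kern (g + a) (g + z) = kern a z"
  by (simp add: kern_def)

lemma kern_measurable [measurable (raw)]:
  assumes [measurable]: "a \<in> measurable N borel" "z \<in> measurable N borel"
  shows "(\<lambda>w. kern (a w) (z w)) \<in> borel_measurable N"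
  unfolding kern_def by measurable

lemma kern_measurable' [measurable]: "kern a \<in> borel_measurable borel"
  by (rule kern_measurable[of "\<lambda>_. a" borel "\<lambda>z. z"]) simp_all

lemma nn_integral_kern: "(\<integral>\<^sup>+z. ennreal (kern a z) \<partial>M) = 1"
proof -
  have "(\<integral>\<^sup>+z. ennreal (kern a z) \<partial>M) = (\<integral>\<^sup>+z. ennreal (kern a (a + z)) \<partial>M)"
    by (rule nn_integral_left[symmetric]) simp
  also have "\<dots> = (\<integral>\<^sup>+z. ennreal ker_height * ennreal (max 0 (1 - dist 0 z)) \<partial>M)"
    using dist_add_left[of a 0] ker_height_pos
    by (intro nn_integral_cong) (simp add: kern_def ennreal_mult)
  also have "\<dots> = 1"
    by (subst nn_integral_cmult) (simp_all add: ker_mass_def[symmetric] ker_height_mass)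
  finally show ?thesis .
qed

text \<open>As integrals against probability measures, averages obey Jensen's inequality and have
  marginals that forget a coordinate.\<close>

definition kap :: "'g \<Rightarrow> 'g measure" where
  "kap a = density M (\<lambda>z. ennreal (kern a z))"

lemma prob_space_kap: "prob_space (kap a)"
proof (rule prob_spaceI)
  have [measurable]: "(\<lambda>z. ennreal (kern a z)) \<in> borel_measurable M" by measurable
  show "emeasure (kap a) (space (kap a)) = 1"
    by (simp add: kap_def emeasure_density nn_integral_kern)
qed

lemma sets_kap [measurable_cong, simp]: "sets (kap a) = sets borel"
  by (simp add: kap_def)

lemma product_sigma_finite_kap: "product_sigma_finite (\<lambda>i. kap (x i))"
  unfolding product_sigma_finite_def using prob_space_kap prob_space_imp_sigma_finite by blast

lemma distr_kap: "distr (kap a) (kap (g + a)) (\<lambda>x. g + x) = kap (g + a)"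
proof -
  have "distr (kap a) (kap (g + a)) (\<lambda>x. g + x) = distr (density M (\<lambda>z. ennreal (kern (g + a) (g + z)))) M (\<lambda>x. g + x)"
    by (rule distr_cong) (simp_all add: kap_def kern_add_left)
  also have "\<dots> = density (distr M M (\<lambda>x. g + x)) (\<lambda>z. ennreal (kern (g + a) z))"
    by (rule density_distr[symmetric]) simp_all
  finally show ?thesis by (simp add: distr_left kap_def)
qed

definition KK :: "nat \<Rightarrow> (nat \<Rightarrow> 'g) \<Rightarrow> (nat \<Rightarrow> 'g) measure" where
  "KK n x = PiM {..n} (\<lambda>i. kap (x i))"

definition kk :: "nat \<Rightarrow> (nat \<Rightarrow> 'g) \<Rightarrow> (nat \<Rightarrow> 'g) \<Rightarrow> real" where
  "kk n x z = (\<Prod>i\<le>n. kern (x i) (z i))"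

lemma sets_KK [measurable_cong, simp]: "sets (KK n x) = sets (prodM M n)"
  unfolding KK_def prodM_def by (rule sets_PiM_cong) auto

lemma space_KK [simp]: "space (KK n x) = tup n"
  using sets_eq_imp_space_eq[OF sets_KK] by simp

sublocale KK: prob_space "KK n x" for n x
  unfolding KK_def by (intro prob_space_PiM prob_space_kap)

lemma kk_nonneg [simp]: "kk n x z \<ge> 0"
  by (simp add: kk_def prod_nonneg)

lemma kk_measurable [measurable (raw)]:
  assumes [measurable]: "x \<in> measurable N (prodM M n)" "z \<in> measurable N (prodM M n)"
  shows "(\<lambda>w. kk n (x w) (z w)) \<in> borel_measurable N"
  unfolding kk_def by measurable

lemma KK_density: "KK n x = density (prodM M n) (\<lambda>z. ennreal (kk n x z))"
  unfolding KK_def kap_def prodM_def kk_def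
  using PiM_density[of "{..n}" "\<lambda>_. M" "\<lambda>i z. ennreal (kern (x i) z)"] product_sigma_finite_kap[of x]
    PM.product_sigma_finite_axioms
  by (simp add: prod_ennreal kap_def)

lemma distr_KK_tmul: "distr (KK n z) (prodM M n) (tmul n x) = KK n (tmul n x z)"
proof -
  have "distr (KK n z) (KK n (\<lambda>i. x i + z i)) (tmul n x) = KK n (\<lambda>i. x i + z i)"
    unfolding KK_def tmul_def[abs_def]
    by (rule distr_PiM_coordinatewise)
      (auto intro!: product_sigma_finite_kap distr_kap simp: measurable_cong_sets[OF sets_kap sets_kap])
  moreover have "KK n (\<lambda>i. x i + z i) = KK n (tmul n x z)"
    unfolding KK_def by (rule PiM_cong) (auto simp: tmul_apply)
  ultimately show ?thesis
    by (metis distr_cong sets_KK)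
qed

lemma distr_KK_act: "distr (KK n x) (prodM M n) (act n g) = KK n (act n g x)"
  using distr_KK_tmul[of n x "\<lambda>_. g"] by (simp add: tmul_def[abs_def] act_def[abs_def])

text \<open>Forgetting a vertex drops a factor of mass one. This is what makes smoothing commute
  with the differential (\<open>smooth_xd\<close>).\<close>

lemma distr_KK_face: "distr (KK (Suc n) x) (prodM M n) (face (Suc n) i) = KK n (face (Suc n) i x)"
proof -
  have "distr (KK (Suc n) x) (KK n (face (Suc n) i x)) (face (Suc n) i) = KK n (face (Suc n) i x)"
  proof -
    have "KK n (face (Suc n) i x) = PiM {..n} (\<lambda>j. kap (x (if j < i then j else Suc j)))"
      unfolding KK_def by (rule PiM_cong) (auto simp: face_apply)
    then show ?thesis
      using distr_face[of n "\<lambda>j. kap (x j)" i] prob_space_kap by (simp add: KK_def)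
  qed
  then show ?thesis by (metis distr_cong sets_KK)
qed

text \<open>Absolute continuity: the smoothing of a coarse cochain depends only on its
  class.\<close>

lemma AE_KK: "AE z in prodM M n. P z \<Longrightarrow> AE z in KK n x. P z" if "x \<in> tup n"
  unfolding KK_density using that by (subst AE_density) auto

lemma kk_eq_0: "kk n x z = 0" if "i \<le> n" "dist (x i) (z i) \<ge> 1"
  unfolding kk_def using kern_eq_0[OF that(2)] that(1) by (intro prod_zero) auto

lemma AE_KK_close: "AE z in KK n x. \<forall>i\<le>n. dist (x i) (z i) < 1" if "x \<in> tup n"
  unfolding KK_density using that kk_eq_0
  by (subst AE_density) (auto simp: not_le[symmetric])

lemma kk_le: "kk n x z \<le> ker_height ^ Suc n"
proof -
  have "kk n x z \<le> (\<Prod>i\<le>n. ker_height)"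
    unfolding kk_def by (intro prod_mono) (simp add: kern_le)
  then show ?thesis by (simp del: prod.atMost_Suc)
qed

text \<open>With the height factored out the factors lie in [0,1], where a difference of products is
  at most the sum of the differences of the factors, and each tent function is 1-Lipschitz.
  Continuity of smoothed maps rests on this estimate.\<close>

lemma kk_diff: "\<bar>kk n x z - kk n x' z\<bar> \<le> ker_height ^ Suc n * (\<Sum>i\<le>n. dist (x i) (x' i))"
proof -
  have *: "kk n x z = ker_height ^ Suc n * (\<Prod>i\<le>n. max 0 (1 - dist (x i) (z i)))" for x
    by (simp add: kk_def kern_def prod.distrib del: prod.atMost_Suc)
  have "\<bar>(\<Prod>i\<le>n. max 0 (1 - dist (x i) (z i))) - (\<Prod>i\<le>n. max 0 (1 - dist (x' i) (z i)))\<bar>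
      \<le> (\<Sum>i\<le>n. \<bar>max 0 (1 - dist (x i) (z i)) - max 0 (1 - dist (x' i) (z i))\<bar>)"
    using norm_prod_diff[of "{..n}" "\<lambda>i. max 0 (1 - dist (x i) (z i))" "\<lambda>i. max 0 (1 - dist (x' i) (z i))"]
    by simp
  also have "\<dots> \<le> (\<Sum>i\<le>n. dist (x i) (x' i))"
  proof (rule sum_mono)
    fix i
    show "\<bar>max 0 (1 - dist (x i) (z i)) - max 0 (1 - dist (x' i) (z i))\<bar> \<le> dist (x i) (x' i)"
      using dist_triangle[of "x i" "z i" "x' i"] dist_triangle2[of "x' i" "z i" "x i"]
      by (auto simp: max_def dist_commute)
  qed
  finally show ?thesis
    using ker_height_pos unfolding *
    by (simp add: right_diff_distrib[symmetric] abs_mult)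
qed

subsection \<open>Unfolding integrals over tuples of bounded diameter\<close>

text \<open>\<open>GR n R\<close> is stable under the diagonal action and thus not compact in
  general. Bounding the zeroth entry cuts out a compact slice, met by every orbit in
  \<open>GR n R\<close> once \<open>\<rho>\<close> is nonnegative.\<close>

definition DD :: "nat \<Rightarrow> real \<Rightarrow> real \<Rightarrow> (nat \<Rightarrow> 'g) set" where
  "DD n \<rho> R = {z \<in> GR n R. dist 0 (z 0) \<le> \<rho>}"

text \<open>Unlike \<open>DD n \<rho> R\<close> a product set, so faces and prisms can be integrated
  over it one variable at a time. The inclusions \<open>DD_subset_box\<close> and
  \<open>box_subset_DD\<close> move between the two kinds of set at the price of a larger
  radius.\<close>

definition box :: "nat \<Rightarrow> real \<Rightarrow> (nat \<Rightarrow> 'g) set" where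
  "box n r = PiE {..n} (\<lambda>_. cball 0 r)"

lemma cball_borel [measurable]: "cball (a::'g) r \<in> sets borel"
  by simp

lemma GR_sets [measurable]: "GR n R \<in> sets (prodM M n)"
proof -
  have "GR n R = {x \<in> space (prodM M n). \<forall>i\<in>{..n}. \<forall>j\<in>{..n}. dist (x i) (x j) \<le> R}"
    by (auto simp: GR_def)
  also have "\<dots> \<in> sets (prodM M n)"
    by measurable
  finally show ?thesis .
qed

lemma DD_sets [measurable]: "DD n \<rho> R \<in> sets (prodM M n)"
proof -
  have "DD n \<rho> R = GR n R \<inter> {x \<in> space (prodM M n). dist 0 (x 0) \<le> \<rho>}"
    by (auto simp: DD_def GR_def)
  also have "\<dots> \<in> sets (prodM M n)" by (intro sets.Int) measurable
  finally show ?thesis .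
qed

lemma box_sets [measurable]: "box n r \<in> sets (prodM M n)"
  unfolding box_def prodM_def by (intro sets_PiM_I_finite) auto

lemma box_tup: "z \<in> box n r \<Longrightarrow> z \<in> tup n"
  by (auto simp: box_def tup_def PiE_iff)

lemma mem_box_iff: "z \<in> box n r \<longleftrightarrow> z \<in> tup n \<and> (\<forall>i\<le>n. dist 0 (z i) \<le> r)"
  by (auto simp: box_def tup_def PiE_iff)

lemma DD_subset_box: "DD n \<rho> R \<subseteq> box n (\<rho> + R)"
proof
  fix z assume z: "z \<in> DD n \<rho> R"
  have "dist 0 (z i) \<le> \<rho> + R" if "i \<le> n" for i
  proof -
    have "dist (z 0) (z i) \<le> R" using z that by (auto simp: DD_def GR_def)
    moreover have "dist 0 (z 0) \<le> \<rho>" using z by (auto simp: DD_def)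
    ultimately show ?thesis using dist_triangle[of 0 "z i" "z 0"] by linarith
  qed
  then show "z \<in> box n (\<rho> + R)" using z by (auto simp: mem_box_iff DD_def GR_def)
qed

lemma box_subset_DD: "box n r \<subseteq> DD n r (2 * r)"
proof
  fix z assume z: "z \<in> box n r"
  have "dist (z i) (z j) \<le> 2 * r" if "i \<le> n" "j \<le> n" for i j
  proof -
    have "dist 0 (z i) \<le> r" "dist 0 (z j) \<le> r" using z that by (auto simp: mem_box_iff)
    then show ?thesis using dist_triangle3[of "z i" "z j" 0] by linarith
  qed
  then show "z \<in> DD n r (2 * r)" using z by (auto simp: DD_def GR_def mem_box_iff)
qed

lemma box_mono: "r \<le> s \<Longrightarrow> box n r \<subseteq> box n s"
  by (auto simp: mem_box_iff) (meson order_trans)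

lemma emeasure_box: "emeasure (prodM M n) (box n r) = emeasure M (cball 0 r) ^ Suc n"
  unfolding box_def prodM_def by (subst PM.emeasure_PiM) (auto simp del: prod.atMost_Suc)

lemma emeasure_box_finite: "emeasure (prodM M n) (box n r) < \<infinity>"
  using emeasure_cball_finite[of 0 r] by (simp add: emeasure_box power_less_top_ennreal less_top del: power_Suc)

lemma compact_box: "compact (box n r)"
proof -
  \<comment> \<open>Entries beyond \<open>n\<close> are pinned to \<open>undefined\<close>, so
    Tychonoff applies in the full product over all indices.\<close>
  have "box n r = PiE UNIV (\<lambda>i. if i \<le> n then cball 0 r else {undefined})"
    by (auto simp: box_def PiE_iff extensional_def split: if_splits)
  moreover have "compactin (product_topology (\<lambda>_::nat. euclidean :: 'g topology) UNIV) (PiE UNIV (\<lambda>i. if i \<le> n then cball 0 r else {undefined}))"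
    using proper_metric by (subst compactin_PiE) auto
  ultimately show ?thesis
    by (simp add: euclidean_product_topology)
qed

lemma closed_GR_cond: "closed {z::nat \<Rightarrow> 'g. (\<forall>i\<le>n. \<forall>j\<le>n. dist (z i) (z j) \<le> R) \<and> dist 0 (z 0) \<le> \<rho>}"
  by (intro closed_Collect_conj closed_Collect_all closed_Collect_imp closed_Collect_le open_Collect_const
      continuous_intros continuous_on_product_coordinates) 

lemma compact_DD: "compact (DD n \<rho> R)"
proof -
  have "DD n \<rho> R = box n (\<rho> + R) \<inter> {z. (\<forall>i\<le>n. \<forall>j\<le>n. dist (z i) (z j) \<le> R) \<and> dist 0 (z 0) \<le> \<rho>}"
    using DD_subset_box[of n \<rho> R] by (auto simp: DD_def GR_def mem_box_iff)
  then show ?thesis using compact_box closed_GR_cond by (simp add: compact_Int_closed)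
qed

lemma DD_act: "z \<in> tup n \<Longrightarrow> act n y z \<in> DD n \<rho> R \<longleftrightarrow> z \<in> GR n R \<and> y + z 0 \<in> cball 0 \<rho>"
  by (auto simp: DD_def GR_def act_apply)

text \<open>For \<open>F\<close> the squared modulus of \<open>\<alpha>\<close> this is the squared
  L^2 norm at \<open>z\<close> of the invariant map belonging to \<open>\<alpha>\<close>
  (\<open>ver_N2\<close>).\<close>

definition orb :: "nat \<Rightarrow> ((nat \<Rightarrow> 'g) \<Rightarrow> ennreal) \<Rightarrow> (nat \<Rightarrow> 'g) \<Rightarrow> ennreal" where
  "orb n F z = (\<integral>\<^sup>+y. F (act n (- y) z) \<partial>M)"

lemma orb_measurable [measurable (raw)]:
  assumes [measurable]: "F \<in> borel_measurable (prodM M n)" "z \<in> measurable N (prodM M n)"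
  shows "(\<lambda>w. orb n F (z w)) \<in> borel_measurable N"
  unfolding orb_def by measurable

text \<open>A set of representatives for the diagonal action is thickened to \<open>DD n \<rho> R\<close>; right
  invariance of the measure makes the time an orbit spends there independent of the orbit.\<close>
lemma nn_integral_orb:
  assumes F [measurable]: "F \<in> borel_measurable (prodM M n)"
  shows "(\<integral>\<^sup>+z. indicator (DD n \<rho> R) z * orb n F z \<partial>prodM M n)
     = emeasure M (cball 0 \<rho>) * (\<integral>\<^sup>+z. indicator (GR n R) z * F z \<partial>prodM M n)"
proof -
  have "(\<integral>\<^sup>+z. indicator (DD n \<rho> R) z * orb n F z \<partial>prodM M n)
      = (\<integral>\<^sup>+z. (\<integral>\<^sup>+y. indicator (DD n \<rho> R) z * F (act n (- y) z) \<partial>M) \<partial>prodM M n)"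
    unfolding orb_def by (intro nn_integral_cong nn_integral_cmult[symmetric]) measurable
  also have "\<dots> = (\<integral>\<^sup>+y. (\<integral>\<^sup>+z. indicator (DD n \<rho> R) z * F (act n (- y) z) \<partial>prodM M n) \<partial>M)"
    by (rule pMM.Fubini'[symmetric]) measurable
  \<comment> \<open>For fixed \<open>y\<close> the substitution of \<open>act n y z\<close> for
    \<open>z\<close> moves the action from \<open>F\<close> onto the slice.\<close>
  also have "\<dots> = (\<integral>\<^sup>+y. (\<integral>\<^sup>+z. indicator (DD n \<rho> R) (act n y z) * F z \<partial>prodM M n) \<partial>M)"
  proof (rule nn_integral_cong)
    fix y
    have "(\<integral>\<^sup>+z. indicator (DD n \<rho> R) z * F (act n (- y) z) \<partial>prodM M n)
      = (\<integral>\<^sup>+z. indicator (DD n \<rho> R) (act n y z) * F (act n (- y) (act n y z)) \<partial>prodM M n)"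
      by (rule nn_integral_act[symmetric]) measurable
    also have "\<dots> = (\<integral>\<^sup>+z. indicator (DD n \<rho> R) (act n y z) * F z \<partial>prodM M n)"
      by (rule nn_integral_cong) simp
    finally show "(\<integral>\<^sup>+z. indicator (DD n \<rho> R) z * F (act n (- y) z) \<partial>prodM M n) = \<dots>" .
  qed
  also have "\<dots> = (\<integral>\<^sup>+z. (\<integral>\<^sup>+y. indicator (DD n \<rho> R) (act n y z) * F z \<partial>M) \<partial>prodM M n)"
    by (rule pMM.Fubini') measurable
  also have "\<dots> = (\<integral>\<^sup>+z. emeasure M (cball 0 \<rho>) * (indicator (GR n R) z * F z) \<partial>prodM M n)"
  proof (rule nn_integral_cong)
    fix z assume "z \<in> space (prodM M n)"
    then have z: "z \<in> tup n" by simp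
    have "(\<integral>\<^sup>+y. indicator (DD n \<rho> R) (act n y z) * F z \<partial>M)
        = (\<integral>\<^sup>+y. (indicator (GR n R) z * F z) * indicator (cball 0 \<rho>) (y + z 0) \<partial>M)"
      by (intro nn_integral_cong) (auto simp: indicator_def DD_act[OF z])
    also have "\<dots> = (indicator (GR n R) z * F z) * (\<integral>\<^sup>+y. indicator (cball 0 \<rho>) (y + z 0) \<partial>M)"
      by (rule nn_integral_cmult) measurable
    \<comment> \<open>What remains is the measure of a ball translated on the right by the inverse
      of \<open>z 0\<close>. This is where unimodularity enters.\<close>
    also have "(\<integral>\<^sup>+y. indicator (cball 0 \<rho>) (y + z 0) \<partial>M) = emeasure M (cball 0 \<rho>)"
      by (subst nn_integral_right) auto
    finally show "(\<integral>\<^sup>+y. indicator (DD n \<rho> R) (act n y z) * F z \<partial>M) = emeasure M (cball 0 \<rho>) * (indicator (GR n R) z * F z)"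
      by (simp add: mult_ac)
  qed
  also have "\<dots> = emeasure M (cball 0 \<rho>) * (\<integral>\<^sup>+z. indicator (GR n R) z * F z \<partial>prodM M n)"
    by (rule nn_integral_cmult) measurable
  finally show ?thesis .
qed

lemma nn_integral_box_orb_le:
  assumes F [measurable]: "F \<in> borel_measurable (prodM M n)"
  shows "(\<integral>\<^sup>+z. indicator (box n r) z * orb n F z \<partial>prodM M n)
     \<le> emeasure M (cball 0 r) * (\<integral>\<^sup>+z. indicator (GR n (2 * r)) z * F z \<partial>prodM M n)"
proof -
  have "(\<integral>\<^sup>+z. indicator (box n r) z * orb n F z \<partial>prodM M n) \<le> (\<integral>\<^sup>+z. indicator (DD n r (2 * r)) z * orb n F z \<partial>prodM M n)"
    using box_subset_DD[of n r] by (intro nn_integral_mono mult_right_mono) (auto simp: indicator_def)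
  then show ?thesis by (simp add: nn_integral_orb)
qed

subsubsection \<open>Uniform measures on balls\<close>

text \<open>Normalised so that \<open>distr_face\<close> and \<open>distr_mix\<close> apply;
  \<open>nn_integral_punif\<close> restores the volumes afterwards.\<close>

definition unif :: "real \<Rightarrow> 'g measure" where
  "unif r = density M (\<lambda>z. indicator (cball 0 r) z / emeasure M (cball 0 r))"

lemma sets_unif [measurable_cong, simp]: "sets (unif r) = sets borel"
  by (simp add: unif_def)

lemma space_unif [simp]: "space (unif r) = UNIV"
  by (simp add: unif_def)

lemma cball_cancel: "r > 0 \<Longrightarrow> emeasure M (cball 0 r) * inverse (emeasure M (cball 0 r)) = 1"
  using emeasure_cball_pos[of r 0] emeasure_cball_finite[of 0 r]
  by (metis ennreal_divide_self divide_ennreal_def infinity_ennreal_def less_irrefl)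

lemma prob_space_unif: "r > 0 \<Longrightarrow> prob_space (unif r)"
proof (rule prob_spaceI)
  assume r: "r > 0"
  have "emeasure (unif r) (space (unif r)) = (\<integral>\<^sup>+z. indicator (cball 0 r) z * inverse (emeasure M (cball 0 r)) \<partial>M)"
    by (simp add: unif_def emeasure_density divide_ennreal_def)
  also have "\<dots> = emeasure M (cball 0 r) * inverse (emeasure M (cball 0 r))"
    by (subst nn_integral_multc) auto
  finally show "emeasure (unif r) (space (unif r)) = 1" using cball_cancel[OF r] by simp
qed

definition punif :: "nat \<Rightarrow> real \<Rightarrow> (nat \<Rightarrow> 'g) measure" where
  "punif n r = PiM {..n} (\<lambda>_. unif r)"

lemma sets_punif [measurable_cong, simp]: "sets (punif n r) = sets (prodM M n)"
  unfolding punif_def prodM_def by (rule sets_PiM_cong) auto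

lemma punif_density:
  assumes r: "r > 0"
  shows "punif n r = density (prodM M n) (\<lambda>z. indicator (box n r) z * inverse (emeasure M (cball 0 r)) ^ Suc n)"
proof -
  have "product_sigma_finite (\<lambda>_::nat. unif r)"
    using prob_space_unif[OF r] prob_space_imp_sigma_finite by (auto simp: product_sigma_finite_def)
  then have "punif n r = density (prodM M n) (\<lambda>z. \<Prod>i\<le>n. indicator (cball 0 r) (z i) / emeasure M (cball 0 r))"
    using PiM_density[of "{..n}" "\<lambda>_. M" "\<lambda>_ z. indicator (cball 0 r) z / emeasure M (cball 0 r)"] PM.product_sigma_finite_axioms
    by (simp add: punif_def prodM_def unif_def)
  also have "\<dots> = density (prodM M n) (\<lambda>z. indicator (box n r) z * inverse (emeasure M (cball 0 r)) ^ Suc n)"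
  proof (rule density_cong)
    show "AE z in prodM M n. (\<Prod>i\<le>n. indicator (cball 0 r) (z i) / emeasure M (cball 0 r)) = indicator (box n r) z * inverse (emeasure M (cball 0 r)) ^ Suc n"
    proof (rule AE_I2)
      fix z assume "z \<in> space (prodM M n)"
      then have "(\<Prod>i\<le>n. indicator (cball 0 r) (z i)) = (indicator (box n r) z :: ennreal)"
        by (auto simp: indicator_def mem_box_iff intro!: prod_zero prod.neutral simp del: prod.atMost_Suc)
      then show "(\<Prod>i\<le>n. indicator (cball 0 r) (z i) / emeasure M (cball 0 r)) = indicator (box n r) z * inverse (emeasure M (cball 0 r)) ^ Suc n"
        by (simp add: divide_ennreal_def prod.distrib del: prod.atMost_Suc power_Suc)
    qed
  qed (auto intro!: borel_measurable_prod_ennreal borel_measurable_divide_ennreal)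
  finally show ?thesis .
qed

lemma nn_integral_punif:
  assumes r: "r > 0" and F [measurable]: "F \<in> borel_measurable (prodM M n)"
  shows "(\<integral>\<^sup>+z. indicator (box n r) z * F z \<partial>prodM M n) = emeasure M (cball 0 r) ^ Suc n * (\<integral>\<^sup>+z. F z \<partial>punif n r)"
proof -
  have c: "emeasure M (cball 0 r) ^ Suc n * inverse (emeasure M (cball 0 r)) ^ Suc n = 1"
    using cball_cancel[OF r] by (simp only: power_mult_distrib[symmetric] power_one)
  have "(\<integral>\<^sup>+z. F z \<partial>punif n r) = (\<integral>\<^sup>+z. inverse (emeasure M (cball 0 r)) ^ Suc n * (indicator (box n r) z * F z) \<partial>prodM M n)"
    unfolding punif_density[OF r] by (subst nn_integral_density) (auto simp: mult_ac)
  also have "\<dots> = inverse (emeasure M (cball 0 r)) ^ Suc n * (\<integral>\<^sup>+z. indicator (box n r) z * F z \<partial>prodM M n)"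
    by (rule nn_integral_cmult) measurable
  finally show ?thesis using c by (simp only: mult.assoc[symmetric] mult_1)
qed

lemma nn_integral_box_face:
  assumes r: "r > 0" and F [measurable]: "F \<in> borel_measurable (prodM M n)"
  shows "(\<integral>\<^sup>+z. indicator (box (Suc n) r) z * F (face (Suc n) i z) \<partial>prodM M (Suc n))
     = emeasure M (cball 0 r) * (\<integral>\<^sup>+z. indicator (box n r) z * F z \<partial>prodM M n)"
proof -
  have m [measurable]: "face (Suc n) i \<in> measurable (punif (Suc n) r) (punif n r)"
    by measurable
  have "(\<integral>\<^sup>+z. F z \<partial>punif n r) = (\<integral>\<^sup>+z. F z \<partial>distr (punif (Suc n) r) (punif n r) (face (Suc n) i))"
    using distr_face[of n "\<lambda>_. unif r" i] prob_space_unif[OF r] by (simp add: punif_def)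
  also have "\<dots> = (\<integral>\<^sup>+z. F (face (Suc n) i z) \<partial>punif (Suc n) r)"
    by (rule nn_integral_distr) measurable
  finally have e: "(\<integral>\<^sup>+z. F z \<partial>punif n r) = (\<integral>\<^sup>+z. F (face (Suc n) i z) \<partial>punif (Suc n) r)" .
  have "(\<integral>\<^sup>+z. indicator (box (Suc n) r) z * F (face (Suc n) i z) \<partial>prodM M (Suc n))
      = emeasure M (cball 0 r) ^ Suc (Suc n) * (\<integral>\<^sup>+z. F (face (Suc n) i z) \<partial>punif (Suc n) r)"
    by (rule nn_integral_punif[OF r]) measurable
  then show ?thesis
    by (simp only: nn_integral_punif[OF r F] e power_Suc mult.assoc)
qed

text \<open>Of the 2n + 2 entries of \<open>x\<close> and \<open>z\<close> only n + 2 occur in the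
  prism simplex; the other n each contribute the volume of a ball.\<close>

lemma nn_integral_box_mix:
  assumes r: "r > 0" and i: "i \<le> n" and F [measurable]: "F \<in> borel_measurable (prodM M (Suc n))"
  shows "(\<integral>\<^sup>+x. indicator (box n r) x * (\<integral>\<^sup>+z. indicator (box n r) z * F (mix n i x z) \<partial>prodM M n) \<partial>prodM M n)
     = emeasure M (cball 0 r) ^ n * (\<integral>\<^sup>+z. indicator (box (Suc n) r) z * F z \<partial>prodM M (Suc n))"
proof -
  note i [measurable]
  interpret P: prob_space "punif n r"
    unfolding punif_def using prob_space_unif[OF r] by (rule prob_space_PiM)
  let ?b = "emeasure M (cball 0 r)"
  have "(\<integral>\<^sup>+z. F z \<partial>punif (Suc n) r) = (\<integral>\<^sup>+z. F z \<partial>distr (punif n r \<Otimes>\<^sub>M punif n r) (punif (Suc n) r) (\<lambda>(x,z). mix n i x z))"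
    using distr_mix[OF prob_space_unif[OF r] i] by (simp add: punif_def)
  also have "\<dots> = (\<integral>\<^sup>+p. F (mix n i (fst p) (snd p)) \<partial>(punif n r \<Otimes>\<^sub>M punif n r))"
    unfolding case_prod_unfold by (rule nn_integral_distr) measurable
  also have "\<dots> = (\<integral>\<^sup>+x. \<integral>\<^sup>+z. F (mix n i x z) \<partial>punif n r \<partial>punif n r)"
    by (subst P.nn_integral_fst[symmetric]) auto
  finally have e: "(\<integral>\<^sup>+z. F z \<partial>punif (Suc n) r) = (\<integral>\<^sup>+x. \<integral>\<^sup>+z. F (mix n i x z) \<partial>punif n r \<partial>punif n r)" .
  have "(\<integral>\<^sup>+x. indicator (box n r) x * (\<integral>\<^sup>+z. indicator (box n r) z * F (mix n i x z) \<partial>prodM M n) \<partial>prodM M n)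
      = ?b ^ Suc n * (\<integral>\<^sup>+x. (\<integral>\<^sup>+z. indicator (box n r) z * F (mix n i x z) \<partial>prodM M n) \<partial>punif n r)"
    by (rule nn_integral_punif[OF r]) measurable
  also have "(\<integral>\<^sup>+x. (\<integral>\<^sup>+z. indicator (box n r) z * F (mix n i x z) \<partial>prodM M n) \<partial>punif n r)
      = (\<integral>\<^sup>+x. ?b ^ Suc n * (\<integral>\<^sup>+z. F (mix n i x z) \<partial>punif n r) \<partial>punif n r)"
    by (rule nn_integral_cong, rule nn_integral_punif[OF r]) (auto simp: sets_eq_imp_space_eq[OF sets_punif])
  also have "\<dots> = ?b ^ Suc n * (\<integral>\<^sup>+x. \<integral>\<^sup>+z. F (mix n i x z) \<partial>punif n r \<partial>punif n r)"
    by (rule nn_integral_cmult) measurable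
  also note e[symmetric]
  also have "?b ^ Suc n * (?b ^ Suc n * (\<integral>\<^sup>+z. F z \<partial>punif (Suc n) r)) = ?b ^ n * (?b ^ Suc (Suc n) * (\<integral>\<^sup>+z. F z \<partial>punif (Suc n) r))"
    by (simp add: mult_ac)
  also have "\<dots> = ?b ^ n * (\<integral>\<^sup>+z. indicator (box (Suc n) r) z * F z \<partial>prodM M (Suc n))"
    by (simp only: nn_integral_punif[OF r F])
  finally show ?thesis .
qed

section \<open>Null sets under face and prism maps\<close>

lemma AE_prodM_boxI:
  assumes "\<And>r. r > 0 \<Longrightarrow> AE z in prodM M n. z \<in> box n r \<longrightarrow> P z"
  shows "AE z in prodM M n. P z"
proof -
  have "AE z in prodM M n. \<forall>k::nat. z \<in> box n (real k + 1) \<longrightarrow> P z"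
    using assms by (subst AE_all_countable) auto
  then show ?thesis
  proof (rule AE_mp, intro AE_I2 impI)
    fix z assume z: "z \<in> space (prodM M n)" and *: "\<forall>k::nat. z \<in> box n (real k + 1) \<longrightarrow> P z"
    obtain k :: nat where k: "(\<Sum>i\<le>n. dist 0 (z i)) \<le> real k" using real_arch_simple by blast
    have "dist 0 (z i) \<le> real k + 1" if "i \<le> n" for i
      using member_le_sum[of i "{..n}" "\<lambda>i. dist 0 (z i)"] that k by auto
    then show "P z" using * z by (auto simp: mem_box_iff)
  qed
qed

text \<open>The forgotten variable may have infinite mass, so the face map need not carry Haar
  measure to a multiple of Haar measure. Inside a box the preimage of a null set has measure zero
  times the volume of a ball, and boxes exhaust all tuples.\<close>

lemma AE_face:
  assumes "AE z in prodM M n. P z"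
  shows "AE z in prodM M (Suc n). P (face (Suc n) i z)"
proof (rule AE_prodM_boxI)
  fix r :: real assume r: "r > 0"
  obtain N where N [measurable]: "N \<in> sets (prodM M n)" and N0: "emeasure (prodM M n) N = 0"
    and sub: "{z \<in> tup n. \<not> P z} \<subseteq> N"
    using assms by (auto elim!: AE_E)
  have "(\<integral>\<^sup>+z. indicator (box n r) z * indicator N z \<partial>prodM M n) \<le> (\<integral>\<^sup>+z. indicator N z \<partial>prodM M n)"
    by (intro nn_integral_mono) (auto simp: indicator_def)
  then have "(\<integral>\<^sup>+z. indicator (box n r) z * indicator N z \<partial>prodM M n) = 0" using N0 by simp
  then have "(\<integral>\<^sup>+z. indicator (box (Suc n) r) z * indicator N (face (Suc n) i z) \<partial>prodM M (Suc n)) = 0"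
    by (simp add: nn_integral_box_face[OF r])
  then have "AE z in prodM M (Suc n). indicator (box (Suc n) r) z * indicator N (face (Suc n) i z) = (0::ennreal)"
    by (subst (asm) nn_integral_0_iff_AE) auto
  then show "AE z in prodM M (Suc n). z \<in> box (Suc n) r \<longrightarrow> P (face (Suc n) i z)"
    by eventually_elim (use sub in \<open>auto simp: indicator_def split: if_splits\<close>)
qed

text \<open>Same argument inside boxes. The iterated form is the one suited to averaging over
  \<open>z\<close> with \<open>x\<close> fixed.\<close>

lemma AE_mix:
  assumes "AE z in prodM M (Suc n). P z" and i: "i \<le> n"
  shows "AE x in prodM M n. AE z in prodM M n. P (mix n i x z)"
proof -
  note i [measurable]
  obtain N where N [measurable]: "N \<in> sets (prodM M (Suc n))" and N0: "emeasure (prodM M (Suc n)) N = 0"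
    and sub: "{z \<in> tup (Suc n). \<not> P z} \<subseteq> N"
    using assms by (auto elim!: AE_E)
  have *: "AE x in prodM M n. x \<in> box n r \<longrightarrow> (AE z in prodM M n. z \<in> box n r \<longrightarrow> P (mix n i x z))" if r: "r > 0" for r
  proof -
    have "(\<integral>\<^sup>+z. indicator (box (Suc n) r) z * indicator N z \<partial>prodM M (Suc n)) \<le> (\<integral>\<^sup>+z. indicator N z \<partial>prodM M (Suc n))"
      by (intro nn_integral_mono) (auto simp: indicator_def)
    then have "(\<integral>\<^sup>+z. indicator (box (Suc n) r) z * indicator N z \<partial>prodM M (Suc n)) = 0" using N0 by simp
    then have "(\<integral>\<^sup>+x. indicator (box n r) x * (\<integral>\<^sup>+z. indicator (box n r) z * indicator N (mix n i x z) \<partial>prodM M n) \<partial>prodM M n) = 0"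
      by (simp add: nn_integral_box_mix[OF r i])
    then have "AE x in prodM M n. indicator (box n r) x * (\<integral>\<^sup>+z. indicator (box n r) z * indicator N (mix n i x z) \<partial>prodM M n) = (0::ennreal)"
      by (subst (asm) nn_integral_0_iff_AE) auto
    then show ?thesis
    proof eventually_elim
      fix x assume 0: "indicator (box n r) x * (\<integral>\<^sup>+z. indicator (box n r) z * indicator N (mix n i x z) \<partial>prodM M n) = (0::ennreal)"
      show "x \<in> box n r \<longrightarrow> (AE z in prodM M n. z \<in> box n r \<longrightarrow> P (mix n i x z))"
      proof
        assume x: "x \<in> box n r"
        with 0 have "(\<integral>\<^sup>+z. indicator (box n r) z * indicator N (mix n i x z) \<partial>prodM M n) = (0::ennreal)" by simp
        then have "AE z in prodM M n. indicator (box n r) z * indicator N (mix n i x z) = (0::ennreal)"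
          using box_tup[OF x] by (subst (asm) nn_integral_0_iff_AE) auto
        then show "AE z in prodM M n. z \<in> box n r \<longrightarrow> P (mix n i x z)"
          by eventually_elim (use sub in \<open>auto simp: indicator_def split: if_splits\<close>)
      qed
    qed
  qed
  have "AE x in prodM M n. \<forall>k::nat. x \<in> box n (real k + 1) \<longrightarrow> (AE z in prodM M n. z \<in> box n (real k + 1) \<longrightarrow> P (mix n i x z))"
    using * by (subst AE_all_countable) auto
  from this AE_space show ?thesis
  proof eventually_elim
    fix x assume x: "x \<in> space (prodM M n)"
      and *: "\<forall>k::nat. x \<in> box n (real k + 1) \<longrightarrow> (AE z in prodM M n. z \<in> box n (real k + 1) \<longrightarrow> P (mix n i x z))"
    show "AE z in prodM M n. P (mix n i x z)"
    proof (rule AE_prodM_boxI)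
      fix r :: real assume r: "r > 0"
      \<comment> \<open>One integer radius has to cover both the given \<open>x\<close> and the box
        in which \<open>z\<close> is tested.\<close>
      obtain k :: nat where k: "max r (\<Sum>i\<le>n. dist 0 (x i)) \<le> real k" using real_arch_simple by blast
      have "dist 0 (x i) \<le> real k + 1" if "i \<le> n" for i
        using member_le_sum[of i "{..n}" "\<lambda>i. dist 0 (x i)"] that k by auto
      then have "AE z in prodM M n. z \<in> box n (real k + 1) \<longrightarrow> P (mix n i x z)"
        using * x by (auto simp: mem_box_iff)
      then show "AE z in prodM M n. z \<in> box n r \<longrightarrow> P (mix n i x z)"
        by eventually_elim (use box_mono[of r "real k + 1" n] k in auto)
    qed
  qed
qed

section \<open>Integral estimates for faces and averaged prisms\<close>

lemma ennreal_le_divide_cball: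
  assumes "emeasure M (cball 0 1) * a \<le> c"
  shows "a \<le> inverse (emeasure M (cball 0 1)) * c"
proof -
  have "a = (emeasure M (cball 0 1) * inverse (emeasure M (cball 0 1))) * a"
    by (simp add: cball_cancel)
  also have "\<dots> = inverse (emeasure M (cball 0 1)) * (emeasure M (cball 0 1) * a)"
    by (simp only: mult_ac)
  also have "\<dots> \<le> inverse (emeasure M (cball 0 1)) * c"
    by (rule mult_left_mono[OF assms]) simp
  finally show ?thesis .
qed

lemma inverse_cball_finite: "inverse (emeasure M (cball 0 1)) < \<infinity>"
  using emeasure_cball_pos[of 1 0] by (simp add: less_top[symmetric])

text \<open>Unfold to the slice \<open>DD (Suc n) 1 R\<close>, enlarge it to the box of radius 1 +
  R, integrate out the vertex there and fold back. A box of radius r has diameter at most 2 r, which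
  explains the new radius. \<open>C\<close> does not depend on \<open>F\<close>, so the bound
  expresses continuity.\<close>

lemma nn_integral_GR_face:
  assumes R: "R > 0"
  shows "\<exists>C<\<infinity>. \<forall>F\<in>borel_measurable (prodM M n).
     (\<integral>\<^sup>+z. indicator (GR (Suc n) R) z * F (face (Suc n) i z) \<partial>prodM M (Suc n))
       \<le> C * (\<integral>\<^sup>+z. indicator (GR n (2 * (1 + R))) z * F z \<partial>prodM M n)"
proof -
  let ?b = "emeasure M (cball 0 (1 + R))"
  have "(\<integral>\<^sup>+z. indicator (GR (Suc n) R) z * F (face (Suc n) i z) \<partial>prodM M (Suc n))
       \<le> (inverse (emeasure M (cball 0 1)) * (?b * ?b)) * (\<integral>\<^sup>+z. indicator (GR n (2 * (1 + R))) z * F z \<partial>prodM M n)"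
    if F [measurable]: "F \<in> borel_measurable (prodM M n)" for F
  proof -
    have "emeasure M (cball 0 1) * (\<integral>\<^sup>+z. indicator (GR (Suc n) R) z * F (face (Suc n) i z) \<partial>prodM M (Suc n))
       = (\<integral>\<^sup>+z. indicator (DD (Suc n) 1 R) z * orb (Suc n) (\<lambda>z. F (face (Suc n) i z)) z \<partial>prodM M (Suc n))"
      by (rule nn_integral_orb[symmetric]) measurable
    \<comment> \<open>Faces commute with the action, so the orbit integral of the pulled back
      function is the orbit integral of \<open>F\<close> at the face.\<close>
    also have "\<dots> \<le> (\<integral>\<^sup>+z. indicator (box (Suc n) (1 + R)) z * orb n F (face (Suc n) i z) \<partial>prodM M (Suc n))"
      using DD_subset_box[of "Suc n" 1 R]
      by (intro nn_integral_mono) (auto simp: indicator_def orb_def)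
    also have "\<dots> = ?b * (\<integral>\<^sup>+z. indicator (box n (1 + R)) z * orb n F z \<partial>prodM M n)"
      using R by (intro nn_integral_box_face) auto
    also have "\<dots> \<le> ?b * (?b * (\<integral>\<^sup>+z. indicator (GR n (2 * (1 + R))) z * F z \<partial>prodM M n))"
      by (intro mult_left_mono nn_integral_box_orb_le F) auto
    finally show ?thesis using ennreal_le_divide_cball by (simp add: mult.assoc)
  qed
  moreover have "inverse (emeasure M (cball 0 1)) * (?b * ?b) < \<infinity>"
    using inverse_cball_finite emeasure_cball_finite[of 0 "1 + R"] by (simp add: ennreal_mult_less_top)
  ultimately show ?thesis by blast
qed

lemma nn_integral_KK_act:
  assumes "F \<in> borel_measurable (prodM M n)"
  shows "(\<integral>\<^sup>+z. F z \<partial>KK n (act n g x)) = (\<integral>\<^sup>+z. F (act n g z) \<partial>KK n x)"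
  using assms by (subst distr_KK_act[symmetric]) (simp add: nn_integral_distr)

lemma nn_integral_KK:
  assumes [measurable]: "F \<in> borel_measurable (prodM M n)" and x: "x \<in> tup n"
  shows "(\<integral>\<^sup>+z. F z \<partial>KK n x) = (\<integral>\<^sup>+z. ennreal (kk n x z) * F z \<partial>prodM M n)"
  unfolding KK_density using x by (subst nn_integral_density) auto

lemma KK_nn_measurable [measurable (raw)]:
  assumes [measurable]: "(\<lambda>(w, z). F w z) \<in> borel_measurable (N \<Otimes>\<^sub>M prodM M n)" "x \<in> measurable N (prodM M n)"
  shows "(\<lambda>w. \<integral>\<^sup>+z. F w z \<partial>KK n (x w)) \<in> borel_measurable N"
proof -
  have "(\<lambda>w. \<integral>\<^sup>+z. ennreal (kk n (x w) z) * F w z \<partial>prodM M n) \<in> borel_measurable N"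
    by measurable
  moreover have "x w \<in> tup n" if "w \<in> space N" for w
    using measurable_space[OF assms(2) that] by simp
  ultimately show ?thesis
    by (subst measurable_cong) (auto simp: nn_integral_KK)
qed

lemma KK_close:
  assumes x: "x \<in> box n r" and z: "z \<in> tup n"
  shows "kk n x z \<le> ker_height ^ Suc n * indicator (box n (r + 1)) z"
proof (cases "\<exists>i\<le>n. dist (x i) (z i) \<ge> 1")
  case True
  then obtain i where "i \<le> n" "dist (x i) (z i) \<ge> 1" by blast
  then have "kk n x z = 0" by (rule kk_eq_0)
  then show ?thesis using ker_height_pos by simp
next
  case False
  have "dist 0 (z j) \<le> r + 1" if "j \<le> n" for j
  proof -
    have "dist 0 (x j) \<le> r" using x that by (auto simp: mem_box_iff)
    moreover have "dist (x j) (z j) < 1" using False that by force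
    ultimately show ?thesis using dist_triangle[of 0 "z j" "x j"] by linarith
  qed
  then have "z \<in> box n (r + 1)" using z by (simp add: mem_box_iff)
  then show ?thesis using kk_le by simp
qed

text \<open>The scheme of \<open>nn_integral_GR_face\<close>, with the averaging density replaced by
  its upper bound. The kernel reaches one unit beyond \<open>x\<close>, so the box has radius 2 + R
  instead of 1 + R.\<close>

lemma nn_integral_GR_mix:
  assumes R: "R > 0" and i: "i \<le> n"
  shows "\<exists>C<\<infinity>. \<forall>F\<in>borel_measurable (prodM M (Suc n)).
     (\<integral>\<^sup>+x. indicator (GR n R) x * (\<integral>\<^sup>+z. F (mix n i x z) \<partial>KK n x) \<partial>prodM M n)
       \<le> C * (\<integral>\<^sup>+z. indicator (GR (Suc n) (2 * (2 + R))) z * F z \<partial>prodM M (Suc n))"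
proof -
  note i [measurable]
  let ?b = "emeasure M (cball 0 (2 + R))"
  let ?c = "ennreal (ker_height ^ Suc n)"
  let ?C = "inverse (emeasure M (cball 0 1)) * (?c * (?b ^ n * ?b))"
  have "(\<integral>\<^sup>+x. indicator (GR n R) x * (\<integral>\<^sup>+z. F (mix n i x z) \<partial>KK n x) \<partial>prodM M n)
       \<le> ?C * (\<integral>\<^sup>+z. indicator (GR (Suc n) (2 * (2 + R))) z * F z \<partial>prodM M (Suc n))"
    if F [measurable]: "F \<in> borel_measurable (prodM M (Suc n))" for F
  proof -
    let ?Q = "\<lambda>x. \<integral>\<^sup>+z. F (mix n i x z) \<partial>KK n x"
    \<comment> \<open>Left invariance of the kernel: translating \<open>x\<close> translates the
      averaging measure, so the orbit integral passes under the average.\<close>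
    have orbQ: "orb n ?Q x = (\<integral>\<^sup>+z. ennreal (kk n x z) * orb (Suc n) F (mix n i x z) \<partial>prodM M n)"
      if x [simp]: "x \<in> tup n" for x
    proof -
      have "orb n ?Q x = (\<integral>\<^sup>+y. \<integral>\<^sup>+z. F (act (Suc n) (- y) (mix n i x z)) \<partial>KK n x \<partial>M)"
        unfolding orb_def
        by (intro nn_integral_cong) (simp add: nn_integral_KK_act mix_act[OF i])
      also have "\<dots> = (\<integral>\<^sup>+y. \<integral>\<^sup>+z. ennreal (kk n x z) * F (act (Suc n) (- y) (mix n i x z)) \<partial>prodM M n \<partial>M)"
        by (intro nn_integral_cong nn_integral_KK) auto
      also have "\<dots> = (\<integral>\<^sup>+z. \<integral>\<^sup>+y. ennreal (kk n x z) * F (act (Suc n) (- y) (mix n i x z)) \<partial>M \<partial>prodM M n)"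
        by (rule pMM.Fubini') measurable
      also have "\<dots> = (\<integral>\<^sup>+z. ennreal (kk n x z) * orb (Suc n) F (mix n i x z) \<partial>prodM M n)"
        unfolding orb_def by (intro nn_integral_cong nn_integral_cmult) measurable
      finally show ?thesis .
    qed
    have "emeasure M (cball 0 1) * (\<integral>\<^sup>+x. indicator (GR n R) x * ?Q x \<partial>prodM M n)
       = (\<integral>\<^sup>+x. indicator (DD n 1 R) x * orb n ?Q x \<partial>prodM M n)"
      by (rule nn_integral_orb[symmetric]) measurable
    also have "\<dots> \<le> (\<integral>\<^sup>+x. ?c * (indicator (box n (2 + R)) x * (\<integral>\<^sup>+z. indicator (box n (2 + R)) z * orb (Suc n) F (mix n i x z) \<partial>prodM M n)) \<partial>prodM M n)"
    proof (rule nn_integral_mono)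
      fix x assume "x \<in> space (prodM M n)"
      then have x [simp]: "x \<in> tup n" by simp
      show "indicator (DD n 1 R) x * orb n ?Q x \<le> ?c * (indicator (box n (2 + R)) x * (\<integral>\<^sup>+z. indicator (box n (2 + R)) z * orb (Suc n) F (mix n i x z) \<partial>prodM M n))"
      proof (cases "x \<in> DD n 1 R")
        case True
        then have xb: "x \<in> box n (1 + R)" using DD_subset_box[of n 1 R] by auto
        have "orb n ?Q x \<le> (\<integral>\<^sup>+z. ?c * (indicator (box n (2 + R)) z * orb (Suc n) F (mix n i x z)) \<partial>prodM M n)"
          unfolding orbQ[OF x]
        proof (rule nn_integral_mono)
          fix z assume z: "z \<in> space (prodM M n)"
          have "ennreal (kk n x z) \<le> ?c * indicator (box n (2 + R)) z"
            using ennreal_leI[OF KK_close[OF xb, of z]] z by (auto simp: indicator_def add.commute split: if_splits)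
          from mult_right_mono[OF this, of "orb (Suc n) F (mix n i x z)"]
          show "ennreal (kk n x z) * orb (Suc n) F (mix n i x z) \<le> ?c * (indicator (box n (2 + R)) z * orb (Suc n) F (mix n i x z))"
            by (simp add: mult.assoc)
        qed
        also have "\<dots> = ?c * (\<integral>\<^sup>+z. indicator (box n (2 + R)) z * orb (Suc n) F (mix n i x z) \<partial>prodM M n)"
          by (rule nn_integral_cmult) measurable
        finally show ?thesis using True xb box_mono[of "1 + R" "2 + R" n] by auto
      qed simp
    qed
    also have "\<dots> = ?c * (\<integral>\<^sup>+x. indicator (box n (2 + R)) x * (\<integral>\<^sup>+z. indicator (box n (2 + R)) z * orb (Suc n) F (mix n i x z) \<partial>prodM M n) \<partial>prodM M n)"
      by (rule nn_integral_cmult) measurable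
    also have "\<dots> = ?c * (?b ^ n * (\<integral>\<^sup>+z. indicator (box (Suc n) (2 + R)) z * orb (Suc n) F z \<partial>prodM M (Suc n)))"
      using R i by (subst nn_integral_box_mix) auto
    also have "\<dots> \<le> ?c * (?b ^ n * (?b * (\<integral>\<^sup>+z. indicator (GR (Suc n) (2 * (2 + R))) z * F z \<partial>prodM M (Suc n))))"
      by (intro mult_left_mono nn_integral_box_orb_le F) auto
    finally show ?thesis using ennreal_le_divide_cball by (simp add: mult.assoc)
  qed
  moreover have "?C < \<infinity>"
    using inverse_cball_finite emeasure_cball_finite[of 0 "2 + R"]
    by (simp add: ennreal_mult_less_top power_less_top_ennreal)
  ultimately show ?thesis by blast
qed

end

subsection \<open>The two cochain complexes\<close>

lemma xd_diff: "xd n (\<lambda>w. a w - b w) x = xd n a x - xd n b x"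
  by (simp add: xd_def right_diff_distrib sum_subtractf del: sum.atMost_Suc)

lemma xd_zero [simp]: "xd n (\<lambda>w. 0) x = 0"
  by (simp add: xd_def del: sum.atMost_Suc)

lemma cmod_sum_square_le:
  "finite I \<Longrightarrow> (cmod (\<Sum>i\<in>I. u i))\<^sup>2 \<le> real (card I) * (\<Sum>i\<in>I. (cmod (u i))\<^sup>2)"
  using power_mono[OF norm_sum[of u I], of 2] sum_squared_le_sum_of_squares[of "\<lambda>i. cmod (u i)" I]
  by (simp add: mult.commute)

text \<open>The quarters absorb the factors 2 of the squared triangle inequality.\<close>

lemma ennreal_quarter_less:
  assumes "a < ennreal (e / 4)" "b < ennreal (e / 4)"
  shows "2 * a + 2 * b < ennreal e"
proof -
  have "a < \<infinity>" "b < \<infinity>" using assms by (auto intro: less_trans)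
  then obtain a' b' where ab: "a = ennreal a'" "a' \<ge> 0" "b = ennreal b'" "b' \<ge> 0"
    by (cases a; cases b) auto
  then have "a' < e / 4" "b' < e / 4" using assms by (auto simp: ennreal_less_iff)
  moreover have "2 * a + 2 * b = ennreal (2 * a' + 2 * b')"
    using ab by (simp add: ennreal_plus ennreal_mult)
  ultimately show ?thesis using ab by (simp add: ennreal_less_iff del: ennreal_plus)
qed

lemma ennreal_zeroI:
  fixes a :: ennreal
  assumes "C < \<infinity>" "\<And>e. e > (0::real) \<Longrightarrow> a \<le> C * ennreal e"
  shows "a = 0"
proof -
  obtain c where c: "C = ennreal c" "c \<ge> 0" using assms(1) by (cases C) auto
  have *: "a \<le> ennreal e" if "e > 0" for e
  proof -
    have "a \<le> C * ennreal (e / (c + 1))" using c that by (intro assms(2)) auto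
    also have "\<dots> = ennreal (c * (e / (c + 1)))" using c that by (simp add: ennreal_mult[symmetric])
    also have "\<dots> \<le> ennreal e" using c that by (intro ennreal_leI) (simp add: field_simps)
    finally show ?thesis .
  qed
  have "a \<le> 0"
  proof (rule ennreal_le_epsilon)
    fix e :: real assume "e > 0"
    from *[OF this] show "a \<le> 0 + ennreal e" by simp
  qed
  then show ?thesis by simp
qed

section \<open>Squared L^2 norms and the continuous complex\<close>

context unimodular_group
begin

text \<open>Extended real values make Tonelli and monotonicity available without tracking
  integrability. The square satisfies the triangle inequality only up to a factor 2, which suffices
  for the topology.\<close>

definition N2 :: "('g \<Rightarrow> complex) \<Rightarrow> ennreal" where
  "N2 \<phi> = (\<integral>\<^sup>+y. ennreal ((cmod (\<phi> y))\<^sup>2) \<partial>M)"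

lemma N2_cong_AE: "AE y in M. \<phi> y = \<psi> y \<Longrightarrow> N2 \<phi> = N2 \<psi>"
  unfolding N2_def by (intro nn_integral_cong_AE) auto

lemma N2_0 [simp]: "N2 (\<lambda>_. 0) = 0" "N2 0 = 0"
  by (simp_all add: N2_def)

lemma N2_uminus [simp]: "N2 (\<lambda>y. - \<phi> y) = N2 \<phi>"
  by (simp add: N2_def)

lemma N2_minus_commute: "N2 (\<lambda>y. \<phi> y - \<psi> y) = N2 (\<lambda>y. \<psi> y - \<phi> y)"
  by (simp add: N2_def norm_minus_commute)

lemma N2_add_le:
  assumes [measurable]: "\<phi> \<in> borel_measurable borel" "\<psi> \<in> borel_measurable borel"
  shows "N2 (\<lambda>y. \<phi> y + \<psi> y) \<le> 2 * N2 \<phi> + 2 * N2 \<psi>"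
proof -
  have "N2 (\<lambda>y. \<phi> y + \<psi> y) \<le> (\<integral>\<^sup>+y. 2 * ennreal ((cmod (\<phi> y))\<^sup>2) + 2 * ennreal ((cmod (\<psi> y))\<^sup>2) \<partial>M)"
    unfolding N2_def
  proof (rule nn_integral_mono)
    fix y
    show "ennreal ((cmod (\<phi> y + \<psi> y))\<^sup>2) \<le> 2 * ennreal ((cmod (\<phi> y))\<^sup>2) + 2 * ennreal ((cmod (\<psi> y))\<^sup>2)"
      using ennreal_leI[OF cmod_add_square_le[of "\<phi> y" "\<psi> y"]] by (simp add: ennreal_plus ennreal_mult)
  qed
  also have "\<dots> = 2 * N2 \<phi> + 2 * N2 \<psi>"
    unfolding N2_def by (subst nn_integral_add) (auto simp: nn_integral_cmult)
  finally show ?thesis .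
qed

lemma N2_diff_le:
  assumes [measurable]: "\<phi> \<in> borel_measurable borel" "\<psi> \<in> borel_measurable borel"
  shows "N2 (\<lambda>y. \<phi> y - \<psi> y) \<le> 2 * N2 \<phi> + 2 * N2 \<psi>"
  using N2_add_le[of \<phi> "\<lambda>y. - \<psi> y"] by simp

lemma N2_triangle:
  assumes [measurable]: "\<phi> \<in> borel_measurable borel" "\<psi> \<in> borel_measurable borel" "\<theta> \<in> borel_measurable borel"
  shows "N2 (\<lambda>y. \<phi> y - \<psi> y) \<le> 2 * N2 (\<lambda>y. \<phi> y - \<theta> y) + 2 * N2 (\<lambda>y. \<psi> y - \<theta> y)"
  using N2_diff_le[of "\<lambda>y. \<phi> y - \<theta> y" "\<lambda>y. \<psi> y - \<theta> y"] by simp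

lemma N2_sum_le:
  assumes I: "finite I" and [measurable]: "\<And>i. i \<in> I \<Longrightarrow> u i \<in> borel_measurable borel"
  shows "N2 (\<lambda>y. \<Sum>i\<in>I. u i y) \<le> of_nat (card I) * (\<Sum>i\<in>I. N2 (u i))"
proof -
  have "N2 (\<lambda>y. \<Sum>i\<in>I. u i y) \<le> (\<integral>\<^sup>+y. of_nat (card I) * (\<Sum>i\<in>I. ennreal ((cmod (u i y))\<^sup>2)) \<partial>M)"
    unfolding N2_def
  proof (rule nn_integral_mono)
    fix y
    have "ennreal ((cmod (\<Sum>i\<in>I. u i y))\<^sup>2) \<le> ennreal (real (card I) * (\<Sum>i\<in>I. (cmod (u i y))\<^sup>2))"
      by (intro ennreal_leI cmod_sum_square_le I)
    then show "ennreal ((cmod (\<Sum>i\<in>I. u i y))\<^sup>2) \<le> of_nat (card I) * (\<Sum>i\<in>I. ennreal ((cmod (u i y))\<^sup>2))"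
      by (simp add: ennreal_mult sum_nonneg sum_ennreal ennreal_of_nat_eq_real_of_nat)
  qed
  also have "\<dots> = of_nat (card I) * (\<Sum>i\<in>I. N2 (u i))"
    unfolding N2_def by (subst nn_integral_cmult, measurable, subst nn_integral_sum) measurable
  finally show ?thesis .
qed

lemma N2_eq_0: "\<phi> \<in> borel_measurable borel \<Longrightarrow> N2 \<phi> = 0 \<Longrightarrow> AE y in M. \<phi> y = 0"
  unfolding N2_def by (subst (asm) nn_integral_0_iff_AE) (auto simp: measurable_M_iff)

lemma sqint_iff: "sqint M \<phi> \<longleftrightarrow> \<phi> \<in> borel_measurable borel \<and> N2 \<phi> < \<infinity>"
  unfolding sqint_def N2_def by (auto simp: integrable_iff_bounded measurable_M_iff)

text \<open>Finiteness guards against the default value of \<open>l2dist\<close>, whose Bochner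
  integral would be 0 for a divergent integrand.\<close>

lemma l2dist_less_iff:
  assumes [measurable]: "\<phi> \<in> borel_measurable borel" "\<psi> \<in> borel_measurable borel"
    and fin: "N2 \<phi> < \<infinity>" "N2 \<psi> < \<infinity>" and e: "e > 0"
  shows "l2dist M \<phi> \<psi> < e \<longleftrightarrow> N2 (\<lambda>y. \<phi> y - \<psi> y) < ennreal (e\<^sup>2)"
proof -
  have "N2 (\<lambda>y. \<phi> y - \<psi> y) < \<infinity>"
    using N2_diff_le[OF assms(1,2)] fin by (auto simp: ennreal_mult_less_top intro: le_less_trans)
  then obtain r where r: "N2 (\<lambda>y. \<phi> y - \<psi> y) = ennreal r" "r \<ge> 0"
    by (cases "N2 (\<lambda>y. \<phi> y - \<psi> y)") auto
  have "l2dist M \<phi> \<psi> = sqrt r"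
    unfolding l2dist_def using r by (subst integral_eq_nn_integral) (auto simp: N2_def[symmetric])
  moreover have "sqrt r < e \<longleftrightarrow> r < e\<^sup>2"
    using r e real_less_rsqrt real_less_lsqrt by (metis less_eq_real_def real_sqrt_less_iff real_sqrt_abs abs_of_pos)
  ultimately show ?thesis using r by (simp add: ennreal_less_iff)
qed

lemma ccochains_iff:
  "f \<in> ccochains M n \<longleftrightarrow>
      (\<forall>x. x \<notin> tup n \<longrightarrow> f x = 0) \<and>
      (\<forall>x\<in>tup n. f x \<in> borel_measurable borel \<and> N2 (f x) < \<infinity>) \<and>
      (\<forall>x\<in>tup n. \<forall>e>0. \<exists>U. open U \<and> x \<in> U \<and> (\<forall>w\<in>U \<inter> tup n. N2 (\<lambda>y. f w y - f x y) < ennreal e)) \<and>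
      (\<forall>g. \<forall>x\<in>tup n. AE y in M. f (act n g x) y = f x (- g + y))"
proof -
  have "(\<forall>x\<in>tup n. \<forall>e>0. \<exists>U. open U \<and> x \<in> U \<and> (\<forall>w\<in>U \<inter> tup n. l2dist M (f w) (f x) < e))
     \<longleftrightarrow> (\<forall>x\<in>tup n. \<forall>e>0. \<exists>U. open U \<and> x \<in> U \<and> (\<forall>w\<in>U \<inter> tup n. N2 (\<lambda>y. f w y - f x y) < ennreal e))"
    if "\<forall>x\<in>tup n. f x \<in> borel_measurable borel \<and> N2 (f x) < \<infinity>"
  proof -
    have *: "l2dist M (f w) (f x) < e \<longleftrightarrow> N2 (\<lambda>y. f w y - f x y) < ennreal (e\<^sup>2)"
      if "w \<in> tup n" "x \<in> tup n" "e > 0" for w x e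
      using that \<open>\<forall>x\<in>tup n. _\<close> by (intro l2dist_less_iff) auto
    show ?thesis
    proof (intro iffI ballI allI impI)
      fix x :: "nat \<Rightarrow> 'g" and e :: real assume x: "x \<in> tup n" and e: "e > 0"
        and "\<forall>x\<in>tup n. \<forall>e>0. \<exists>U. open U \<and> x \<in> U \<and> (\<forall>w\<in>U \<inter> tup n. l2dist M (f w) (f x) < e)"
      then obtain U where "open U" "x \<in> U" "\<forall>w\<in>U \<inter> tup n. l2dist M (f w) (f x) < sqrt e"
        by (meson real_sqrt_gt_zero)
      then show "\<exists>U. open U \<and> x \<in> U \<and> (\<forall>w\<in>U \<inter> tup n. N2 (\<lambda>y. f w y - f x y) < ennreal e)"
        using *[OF _ x, of _ "sqrt e"] e by auto
    next
      fix x :: "nat \<Rightarrow> 'g" and e :: real assume x: "x \<in> tup n" and e: "e > 0"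
        and "\<forall>x\<in>tup n. \<forall>e>0. \<exists>U. open U \<and> x \<in> U \<and> (\<forall>w\<in>U \<inter> tup n. N2 (\<lambda>y. f w y - f x y) < ennreal e)"
      then obtain U where "open U" "x \<in> U" "\<forall>w\<in>U \<inter> tup n. N2 (\<lambda>y. f w y - f x y) < ennreal (e\<^sup>2)"
        by (meson zero_less_power)
      then show "\<exists>U. open U \<and> x \<in> U \<and> (\<forall>w\<in>U \<inter> tup n. l2dist M (f w) (f x) < e)"
        using *[OF _ x, of _ e] e by auto
    qed
  qed
  then show ?thesis unfolding ccochains_def mem_Collect_eq sqint_iff by blast
qed

lemma ccochainsD:
  assumes "f \<in> ccochains M n"
  shows "x \<notin> tup n \<Longrightarrow> f x = 0" "f x \<in> borel_measurable borel" "N2 (f x) < \<infinity>"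
    "x \<in> tup n \<Longrightarrow> AE y in M. f (act n g x) y = f x (- g + y)"
proof -
  show 1: "x \<notin> tup n \<Longrightarrow> f x = 0" for x using assms by (auto simp: ccochains_iff)
  show "f x \<in> borel_measurable borel" "N2 (f x) < \<infinity>"
    using assms 1[of x] by (cases "x \<in> tup n"; auto simp: ccochains_iff zero_fun_def)+
  show "x \<in> tup n \<Longrightarrow> AE y in M. f (act n g x) y = f x (- g + y)" using assms by (auto simp: ccochains_iff)
qed

lemma ccochains_cont:
  assumes "f \<in> ccochains M n" "x \<in> tup n" "e > 0"
  obtains U where "open U" "x \<in> U" "\<And>w. w \<in> U \<Longrightarrow> w \<in> tup n \<Longrightarrow> N2 (\<lambda>y. f w y - f x y) < ennreal e"
  using assms unfolding ccochains_iff by (meson IntI)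

lemma N2_bounded:
  assumes f: "f \<in> ccochains M n" and K: "compact K" "K \<subseteq> tup n"
  obtains B where "B > 0" "\<And>x. x \<in> K \<Longrightarrow> N2 (f x) \<le> ennreal B"
proof -
  note [measurable] = ccochainsD(2)[OF f]
  have "\<exists>U B. open U \<and> x \<in> U \<and> B > 0 \<and> (\<forall>w\<in>U \<inter> tup n. N2 (f w) \<le> ennreal B)" if xK: "x \<in> K" for x
  proof -
    have x: "x \<in> tup n" using xK K by blast
    obtain U where U: "open U" "x \<in> U" "\<And>w. w \<in> U \<Longrightarrow> w \<in> tup n \<Longrightarrow> N2 (\<lambda>y. f w y - f x y) < ennreal 1"
      using ccochains_cont[OF f x zero_less_one] by blast
    obtain b where b: "N2 (f x) = ennreal b" "b \<ge> 0"
      using ccochainsD(3)[OF f, of x] by (cases "N2 (f x)") auto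
    have "N2 (f w) \<le> ennreal (2 + 2 * b)" if "w \<in> U \<inter> tup n" for w
    proof -
      have "N2 (f w) \<le> 2 * N2 (\<lambda>y. f w y - f x y) + 2 * N2 (f x)"
        using N2_add_le[of "\<lambda>y. f w y - f x y" "f x"] by simp
      also have "\<dots> \<le> 2 * ennreal 1 + 2 * ennreal b"
        using U(3)[of w] that b by (intro add_mono mult_left_mono) auto
      also have "\<dots> = ennreal (2 + 2 * b)" using b by (simp add: ennreal_plus ennreal_mult)
      finally show ?thesis .
    qed
    then show ?thesis using U b by (intro exI[of _ U] exI[of _ "2 + 2 * b"]) auto
  qed
  then obtain U B where UB: "\<And>x. x \<in> K \<Longrightarrow> open (U x) \<and> x \<in> U x \<and> B x > 0 \<and> (\<forall>w\<in>U x \<inter> tup n. N2 (f w) \<le> ennreal (B x))"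
    by metis
  obtain D where D: "D \<subseteq> K" "finite D" "K \<subseteq> (\<Union>x\<in>D. U x)"
    using compactE_image[OF K(1), of K U] UB by (metis UN_I subsetI)
  show ?thesis
  proof (rule that[of "1 + (\<Sum>x\<in>D. B x)"])
    show "1 + (\<Sum>x\<in>D. B x) > 0" using D UB by (intro add_pos_nonneg sum_nonneg) (auto intro: less_imp_le)
    fix w assume w: "w \<in> K"
    then obtain x where x: "x \<in> D" "w \<in> U x" using D by auto
    then have "N2 (f w) \<le> ennreal (B x)" using UB D K w by blast
    also have "B x \<le> (\<Sum>x\<in>D. B x)" using D x UB by (intro member_le_sum) (auto intro: less_imp_le)
    then have "ennreal (B x) \<le> ennreal (1 + (\<Sum>x\<in>D. B x))" by (intro ennreal_leI) auto
    finally show "N2 (f w) \<le> ennreal (1 + (\<Sum>x\<in>D. B x))" .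
  qed
qed

lemma ccochains_add_closed: "add_closed (ccochains M n)"
proof (rule add_closedI)
  show "0 \<in> ccochains M n"
    unfolding ccochains_iff by (auto simp: zero_fun_def)
next
  fix f h assume f: "f \<in> ccochains M n" and h: "h \<in> ccochains M n"
  note [measurable] = ccochainsD(2)[OF f] ccochainsD(2)[OF h]
  show "f - h \<in> ccochains M n"
    unfolding ccochains_iff
  proof (intro conjI ballI allI impI)
    fix x show "x \<notin> tup n \<Longrightarrow> (f - h) x = 0" using ccochainsD(1)[OF f] ccochainsD(1)[OF h] by simp
    show "(f - h) x \<in> borel_measurable borel" by (simp add: fun_diff_def)
    have "N2 ((f - h) x) \<le> 2 * N2 (f x) + 2 * N2 (h x)" using N2_diff_le[of "f x" "h x"] by (simp add: fun_diff_def)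
    also have "\<dots> < \<infinity>" using ccochainsD(3)[OF f] ccochainsD(3)[OF h] by (simp add: ennreal_mult_less_top)
    finally show "N2 ((f - h) x) < \<infinity>" .
  next
    fix g :: 'g and x :: "nat \<Rightarrow> 'g" assume "x \<in> tup n"
    from ccochainsD(4)[OF f this, of g] ccochainsD(4)[OF h this, of g]
    show "AE y in M. (f - h) (act n g x) y = (f - h) x (- g + y)" by eventually_elim auto
  next
    fix x :: "nat \<Rightarrow> 'g" and e :: real assume x: "x \<in> tup n" and e: "e > 0"
    obtain U where U: "open U" "x \<in> U" "\<And>w. w \<in> U \<Longrightarrow> w \<in> tup n \<Longrightarrow> N2 (\<lambda>y. f w y - f x y) < ennreal (e/4)"
      using ccochains_cont[OF f x, of "e/4"] e by auto
    obtain V where V: "open V" "x \<in> V" "\<And>w. w \<in> V \<Longrightarrow> w \<in> tup n \<Longrightarrow> N2 (\<lambda>y. h w y - h x y) < ennreal (e/4)"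
      using ccochains_cont[OF h x, of "e/4"] e by auto
    have "N2 (\<lambda>y. (f - h) w y - (f - h) x y) < ennreal e" if w: "w \<in> (U \<inter> V) \<inter> tup n" for w
    proof -
      have "N2 (\<lambda>y. (f - h) w y - (f - h) x y) = N2 (\<lambda>y. (f w y - f x y) - (h w y - h x y))"
        by (simp add: algebra_simps)
      also have "\<dots> \<le> 2 * N2 (\<lambda>y. f w y - f x y) + 2 * N2 (\<lambda>y. h w y - h x y)"
        by (rule N2_diff_le) measurable
      also have "\<dots> < ennreal e"
        using U(3)[of w] V(3)[of w] w by (intro ennreal_quarter_less) auto
      finally show ?thesis .
    qed
    then show "\<exists>U. open U \<and> x \<in> U \<and> (\<forall>w\<in>U \<inter> tup n. N2 (\<lambda>y. (f - h) w y - (f - h) x y) < ennreal e)"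
      using U V by (intro exI[of _ "U \<inter> V"]) auto
  qed
qed

lemma cd_diff: "cd n (f - h) x y = cd n f x y - cd n h x y"
  by (simp add: cd_eq_xd xd_diff)

lemma cd_zero: "cd n 0 x y = 0"
  by (simp add: cd_eq_xd)

lemma cd_cong_AE:
  assumes "\<And>w. w \<in> tup n \<Longrightarrow> AE y in M. f w y = h w y" and x: "x \<in> tup (Suc n)"
  shows "AE y in M. cd n f x y = cd n h x y"
proof -
  have "AE y in M. \<forall>i\<in>{..Suc n}. f (face (Suc n) i x) y = h (face (Suc n) i x) y"
    using assms by (intro AE_finite_allI) auto
  then show ?thesis by eventually_elim (auto simp: cd_def simp del: sum.atMost_Suc intro!: sum.cong)
qed

lemma cZ_add_closed: "add_closed (cZ M n)"
proof (rule add_closedI)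
  show "0 \<in> cZ M n" using add_closedD(1)[OF ccochains_add_closed] by (auto simp: cZ_def cd_zero)
next
  fix f h assume fh: "f \<in> cZ M n" "h \<in> cZ M n"
  have "AE y in M. cd n (f - h) x y = 0" if "x \<in> tup (Suc n)" for x
  proof -
    have "AE y in M. cd n f x y = 0" "AE y in M. cd n h x y = 0" using fh that by (auto simp: cZ_def)
    then show ?thesis by eventually_elim (simp add: cd_diff)
  qed
  then show "f - h \<in> cZ M n" using fh add_closedD(4)[OF ccochains_add_closed] by (auto simp: cZ_def)
qed

text \<open>A uniform description of all degrees, with a dummy witness \<open>h\<close> in degree 0,
  so that closure under subtraction needs no case distinction.\<close>

lemma cB_iff:
  "f \<in> cB M n \<longleftrightarrow> f \<in> ccochains M n \<and>
     (\<exists>h\<in>ccochains M (n - 1). \<forall>x\<in>tup n. AE y in M. f x y = (if n = 0 then 0 else cd (n - 1) h x y))"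
  using add_closedD(1)[OF ccochains_add_closed] by (cases n) (auto simp: cB_def)

lemma cB_add_closed: "add_closed (cB M n)"
proof (rule add_closedI)
  show "0 \<in> cB M n" using add_closedD(1)[OF ccochains_add_closed]
    unfolding cB_iff by (auto simp: cd_zero intro!: bexI[of _ 0])
  fix f h assume fh: "f \<in> cB M n" "h \<in> cB M n"
  then obtain a b where a: "a \<in> ccochains M (n - 1)" "\<And>x. x \<in> tup n \<Longrightarrow> AE y in M. f x y = (if n = 0 then 0 else cd (n - 1) a x y)"
    and b: "b \<in> ccochains M (n - 1)" "\<And>x. x \<in> tup n \<Longrightarrow> AE y in M. h x y = (if n = 0 then 0 else cd (n - 1) b x y)"
    unfolding cB_iff by blast
  have "AE y in M. (f - h) x y = (if n = 0 then 0 else cd (n - 1) (a - b) x y)" if "x \<in> tup n" for x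
    using a(2)[OF that] b(2)[OF that] by eventually_elim (simp add: cd_diff)
  then show "f - h \<in> cB M n"
    using fh a(1) b(1) add_closedD(4)[OF ccochains_add_closed] unfolding cB_iff by blast
qed

lemma cB_subset_cZ: "cB M n \<subseteq> cZ M n"
proof
  fix f assume f: "f \<in> cB M n"
  show "f \<in> cZ M n"
  proof (cases n)
    case 0
    then have "\<And>w. w \<in> tup n \<Longrightarrow> AE y in M. f w y = 0 w y" using f by (auto simp: cB_def)
    then have "AE y in M. cd n f x y = cd n 0 x y" if "x \<in> tup (Suc n)" for x
      using that by (rule cd_cong_AE)
    then show ?thesis using f by (auto simp: cZ_def cB_def cd_zero)
  next
    case (Suc m)
    then obtain a where "\<And>x. x \<in> tup n \<Longrightarrow> AE y in M. f x y = cd m a x y"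
      using f by (auto simp: cB_def)
    then have "AE y in M. cd n f x y = cd n (cd m a) x y" if "x \<in> tup (Suc n)" for x
      using that by (rule cd_cong_AE)
    moreover have "cd n (cd m a) x y = 0" for x y
      unfolding cd_eq_xd Suc by (rule xd_xd)
    ultimately show ?thesis using f by (auto simp: cZ_def cB_def)
  qed
qed

lemma cBcl_iff:
  "f \<in> cBcl M n \<longleftrightarrow> f \<in> ccochains M n \<and> (\<forall>K. compact K \<and> K \<subseteq> tup n \<longrightarrow>
      (\<forall>e>0. \<exists>b\<in>cB M n. \<forall>x\<in>K. N2 (\<lambda>y. f x y - b x y) < ennreal e))"
proof -
  have *: "l2dist M (f x) (b x) < e \<longleftrightarrow> N2 (\<lambda>y. f x y - b x y) < ennreal (e\<^sup>2)"
    if "f \<in> ccochains M n" "b \<in> cB M n" "e > 0" for x b e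
    using that ccochainsD[OF that(1)] ccochainsD[of b n] by (intro l2dist_less_iff) (auto simp: cB_def)
  show ?thesis
  proof (cases "f \<in> ccochains M n")
    case True
    have "(\<forall>e>0. \<exists>b\<in>cB M n. \<forall>x\<in>K. l2dist M (f x) (b x) < e) \<longleftrightarrow> (\<forall>e>0. \<exists>b\<in>cB M n. \<forall>x\<in>K. N2 (\<lambda>y. f x y - b x y) < ennreal e)" for K
    proof (intro iffI allI impI)
      fix e :: real assume e: "e > 0" and "\<forall>e>0. \<exists>b\<in>cB M n. \<forall>x\<in>K. l2dist M (f x) (b x) < e"
      then obtain b where "b \<in> cB M n" "\<forall>x\<in>K. l2dist M (f x) (b x) < sqrt e" by (meson real_sqrt_gt_zero)
      then show "\<exists>b\<in>cB M n. \<forall>x\<in>K. N2 (\<lambda>y. f x y - b x y) < ennreal e"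
        using *[OF True, of b "sqrt e"] e by auto
    next
      fix e :: real assume e: "e > 0" and "\<forall>e>0. \<exists>b\<in>cB M n. \<forall>x\<in>K. N2 (\<lambda>y. f x y - b x y) < ennreal e"
      then obtain b where "b \<in> cB M n" "\<forall>x\<in>K. N2 (\<lambda>y. f x y - b x y) < ennreal (e\<^sup>2)" by (meson zero_less_power)
      then show "\<exists>b\<in>cB M n. \<forall>x\<in>K. l2dist M (f x) (b x) < e"
        using *[OF True, of b e] e by auto
    qed
    then show ?thesis by (simp add: cBcl_def)
  qed (simp add: cBcl_def)
qed

lemma cBclD:
  assumes "f \<in> cBcl M n" "compact K" "K \<subseteq> tup n" "e > 0"
  shows "\<exists>b\<in>cB M n. \<forall>x\<in>K. N2 (\<lambda>y. f x y - b x y) < ennreal e"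
  using assms unfolding cBcl_iff by blast

lemma cB_subset_cBcl: "cB M n \<subseteq> cBcl M n"
proof
  fix f assume f: "f \<in> cB M n"
  moreover have "f \<in> ccochains M n" using f by (simp add: cB_def)
  ultimately show "f \<in> cBcl M n" unfolding cBcl_iff
    by (auto intro!: bexI[of _ f])
qed

lemma cBcl_add_closed: "add_closed (cBcl M n)"
proof (rule add_closedI)
  show "0 \<in> cBcl M n" using cB_subset_cBcl add_closedD(1)[OF cB_add_closed] by blast
next
  fix f h assume f: "f \<in> cBcl M n" and h: "h \<in> cBcl M n"
  then have fh: "f \<in> ccochains M n" "h \<in> ccochains M n" by (auto simp: cBcl_iff)
  have "\<exists>b\<in>cB M n. \<forall>x\<in>K. N2 (\<lambda>y. (f - h) x y - b x y) < ennreal e"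
    if K: "compact K" "K \<subseteq> tup n" and e: "e > 0" for K e
  proof -
    obtain a where a: "a \<in> cB M n" "\<forall>x\<in>K. N2 (\<lambda>y. f x y - a x y) < ennreal (e/4)"
      using cBclD[OF f K, of "e/4"] e by auto
    obtain b where b: "b \<in> cB M n" "\<forall>x\<in>K. N2 (\<lambda>y. h x y - b x y) < ennreal (e/4)"
      using cBclD[OF h K, of "e/4"] e by auto
    have "a \<in> ccochains M n" "b \<in> ccochains M n" using a b by (auto simp: cB_def)
    note [measurable] = ccochainsD(2)[OF fh(1)] ccochainsD(2)[OF fh(2)] ccochainsD(2)[OF this(1)] ccochainsD(2)[OF this(2)]
    have "N2 (\<lambda>y. (f - h) x y - (a - b) x y) < ennreal e" if "x \<in> K" for x
    proof -
      have "N2 (\<lambda>y. (f - h) x y - (a - b) x y) = N2 (\<lambda>y. (f x y - a x y) - (h x y - b x y))"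
        by (simp add: algebra_simps)
      also have "\<dots> \<le> 2 * N2 (\<lambda>y. f x y - a x y) + 2 * N2 (\<lambda>y. h x y - b x y)"
        by (rule N2_diff_le) measurable
      also have "\<dots> < ennreal e"
        using a b that by (intro ennreal_quarter_less) auto
      finally show ?thesis .
    qed
    then show ?thesis using add_closedD(4)[OF cB_add_closed a(1) b(1)] by blast
  qed
  then show "f - h \<in> cBcl M n" using add_closedD(4)[OF ccochains_add_closed fh] unfolding cBcl_iff by blast
qed

text \<open>The coboundary at one tuple involves \<open>f\<close> only at finitely many faces, a
  compact set; approximating \<open>f\<close> there by coboundaries makes its differential
  arbitrarily small.\<close>

lemma cBcl_subset_cZ: "cBcl M n \<subseteq> cZ M n"
proof
  fix f assume f: "f \<in> cBcl M n"
  then have fc: "f \<in> ccochains M n" by (auto simp: cBcl_iff)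
  note [measurable] = ccochainsD(2)[OF fc]
  have "AE y in M. cd n f x y = 0" if x: "x \<in> tup (Suc n)" for x
  proof (rule N2_eq_0)
    show "cd n f x \<in> borel_measurable borel"
      using x by (simp add: cd_def del: sum.atMost_Suc)
    show "N2 (cd n f x) = 0"
    proof (rule ennreal_zeroI)
      \<comment> \<open>One factor comes from Cauchy-Schwarz for a sum of n + 2 terms, the other
        from adding n + 2 errors.\<close>
      let ?C = "(of_nat (Suc (Suc n)) * of_nat (Suc (Suc n))) :: ennreal"
      show "?C < \<infinity>" by (simp add: ennreal_mult_less_top of_nat_less_top)
      fix e :: real assume e: "e > 0"
      let ?K = "(\<lambda>i. face (Suc n) i x) ` {..Suc n}"
      have "compact ?K" "?K \<subseteq> tup n" by (auto intro: finite_imp_compact)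
      then obtain b where b: "b \<in> cB M n" "\<forall>w\<in>?K. N2 (\<lambda>y. f w y - b w y) < ennreal e"
        using f e unfolding cBcl_iff by blast
      then have bz: "b \<in> cZ M n" using cB_subset_cZ by blast
      then have bc: "b \<in> ccochains M n" by (auto simp: cZ_def)
      note [measurable] = ccochainsD(2)[OF bc]
      have "AE y in M. cd n b x y = 0" using bz x by (auto simp: cZ_def)
      then have "AE y in M. cd n f x y = cd n (f - b) x y"
        by eventually_elim (simp add: cd_diff)
      then have "N2 (cd n f x) = N2 (cd n (f - b) x)" by (rule N2_cong_AE)
      also have "cd n (f - b) x = (\<lambda>y. \<Sum>i\<le>Suc n. (-1)^i * (f (face (Suc n) i x) y - b (face (Suc n) i x) y))"
        using x by (simp add: cd_def del: sum.atMost_Suc)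
      also have "N2 \<dots> \<le> of_nat (card {..Suc n}) * (\<Sum>i\<le>Suc n. N2 (\<lambda>y. (-1)^i * (f (face (Suc n) i x) y - b (face (Suc n) i x) y)))"
        by (rule N2_sum_le) auto
      also have "\<dots> = of_nat (Suc (Suc n)) * (\<Sum>i\<le>Suc n. N2 (\<lambda>y. f (face (Suc n) i x) y - b (face (Suc n) i x) y))"
        by (simp add: N2_def norm_mult norm_power del: sum.atMost_Suc)
      also have "\<dots> \<le> of_nat (Suc (Suc n)) * (\<Sum>i\<le>Suc n. ennreal e)"
        using b by (intro mult_left_mono sum_mono) (auto intro: less_imp_le)
      also have "\<dots> = ?C * ennreal e" by (simp add: mult.assoc del: sum.atMost_Suc of_nat_Suc)
      finally show "N2 (cd n f x) \<le> ?C * ennreal e" .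
    qed
  qed
  then show "f \<in> cZ M n" using fc by (auto simp: cZ_def)
qed

section \<open>The coarse complex\<close>

lemma xcochainsD:
  assumes "\<alpha> \<in> xcochains M n"
  shows "x \<notin> tup n \<Longrightarrow> \<alpha> x = 0" "\<alpha> \<in> borel_measurable (prodM M n)" "R > 0 \<Longrightarrow> xnorm2 M n R \<alpha> < \<infinity>"
  using assms by (auto simp: xcochains_def)

lemma xnorm2_cong_AE:
  assumes "AE x in prodM M n. \<alpha> x = \<beta> x"
  shows "xnorm2 M n R \<alpha> = xnorm2 M n R \<beta>"
  unfolding xnorm2_def by (rule nn_integral_cong_AE) (use assms in eventually_elim, simp)

lemma xnorm2_diff_le:
  assumes [measurable]: "\<alpha> \<in> borel_measurable (prodM M n)" "\<beta> \<in> borel_measurable (prodM M n)"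
  shows "xnorm2 M n R (\<alpha> - \<beta>) \<le> 2 * xnorm2 M n R \<alpha> + 2 * xnorm2 M n R \<beta>"
proof -
  have "xnorm2 M n R (\<alpha> - \<beta>) \<le> (\<integral>\<^sup>+x. 2 * (indicator (GR n R) x * ennreal ((cmod (\<alpha> x))\<^sup>2)) + 2 * (indicator (GR n R) x * ennreal ((cmod (\<beta> x))\<^sup>2)) \<partial>prodM M n)"
    unfolding xnorm2_def
  proof (rule nn_integral_mono)
    fix x
    show "indicator (GR n R) x * ennreal ((cmod ((\<alpha> - \<beta>) x))\<^sup>2) \<le> 2 * (indicator (GR n R) x * ennreal ((cmod (\<alpha> x))\<^sup>2)) + 2 * (indicator (GR n R) x * ennreal ((cmod (\<beta> x))\<^sup>2))"
      using ennreal_leI[OF cmod_add_square_le[of "\<alpha> x" "- \<beta> x"]] by (simp add: ennreal_mult indicator_def)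
  qed
  also have "\<dots> = 2 * xnorm2 M n R \<alpha> + 2 * xnorm2 M n R \<beta>"
    unfolding xnorm2_def by (subst nn_integral_add) (auto simp: nn_integral_cmult)
  finally show ?thesis .
qed

lemma xcochains_add_closed: "add_closed (xcochains M n)"
proof (rule add_closedI)
  show "0 \<in> xcochains M n" by (auto simp: xcochains_def xnorm2_def zero_fun_def)
next
  fix \<alpha> \<beta> assume a: "\<alpha> \<in> xcochains M n" and b: "\<beta> \<in> xcochains M n"
  note [measurable] = xcochainsD(2)[OF a] xcochainsD(2)[OF b]
  have "xnorm2 M n R (\<alpha> - \<beta>) < \<infinity>" if "R > 0" for R
    using xnorm2_diff_le[of \<alpha> n \<beta> R] xcochainsD(3)[OF a that] xcochainsD(3)[OF b that]
    by (auto simp: ennreal_mult_less_top intro: le_less_trans)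
  moreover have "\<alpha> - \<beta> \<in> borel_measurable (prodM M n)" by (simp add: fun_diff_def)
  ultimately show "\<alpha> - \<beta> \<in> xcochains M n"
    using xcochainsD(1)[OF a] xcochainsD(1)[OF b] by (auto simp: xcochains_def)
qed

lemma xd_diff': "xd n (\<alpha> - \<beta>) x = xd n \<alpha> x - xd n \<beta> x"
  using xd_diff[of n \<alpha> \<beta> x] by (simp add: fun_diff_def)

lemma xd_zero': "xd n 0 x = 0"
  using xd_zero[of n x] by (simp add: zero_fun_def)

lemma xd_cong_AE:
  assumes "AE w in prodM M n. \<alpha> w = \<beta> w"
  shows "AE x in prodM M (Suc n). xd n \<alpha> x = xd n \<beta> x"
proof -
  have "AE x in prodM M (Suc n). \<forall>i\<in>{..Suc n}. \<alpha> (face (Suc n) i x) = \<beta> (face (Suc n) i x)"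
    using AE_face[OF assms] by (intro AE_finite_allI) auto
  then show ?thesis by eventually_elim (auto simp: xd_def simp del: sum.atMost_Suc intro!: sum.cong)
qed

lemma xZ_add_closed: "add_closed (xZ M n)"
proof (rule add_closedI)
  show "0 \<in> xZ M n" using add_closedD(1)[OF xcochains_add_closed] by (auto simp: xZ_def xd_zero')
next
  fix \<alpha> \<beta> assume ab: "\<alpha> \<in> xZ M n" "\<beta> \<in> xZ M n"
  then have "AE x in prodM M (Suc n). xd n \<alpha> x = 0" "AE x in prodM M (Suc n). xd n \<beta> x = 0"
    by (auto simp: xZ_def)
  then have "AE x in prodM M (Suc n). xd n (\<alpha> - \<beta>) x = 0" by eventually_elim (simp add: xd_diff')
  then show "\<alpha> - \<beta> \<in> xZ M n" using ab add_closedD(4)[OF xcochains_add_closed] by (auto simp: xZ_def)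
qed

lemma xB_iff:
  "\<alpha> \<in> xB M n \<longleftrightarrow> \<alpha> \<in> xcochains M n \<and>
     (case n of 0 \<Rightarrow> AE x in prodM M n. \<alpha> x = 0 | Suc m \<Rightarrow> \<exists>\<beta>\<in>xcochains M m. AE x in prodM M n. \<alpha> x = xd m \<beta> x)"
  by (cases n) (auto simp: xB_def)

lemma xB_iff':
  "\<alpha> \<in> xB M n \<longleftrightarrow> \<alpha> \<in> xcochains M n \<and>
     (\<exists>\<beta>\<in>xcochains M (n - 1). AE x in prodM M n. \<alpha> x = (if n = 0 then 0 else xd (n - 1) \<beta> x))"
  using add_closedD(1)[OF xcochains_add_closed] by (cases n) (auto simp: xB_def)

lemma xB_add_closed: "add_closed (xB M n)"
proof (rule add_closedI)
  show "0 \<in> xB M n" using add_closedD(1)[OF xcochains_add_closed]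
    unfolding xB_iff' by (auto simp: xd_zero' intro!: bexI[of _ 0])
  fix \<alpha> \<beta> assume ab: "\<alpha> \<in> xB M n" "\<beta> \<in> xB M n"
  then obtain a b where a: "a \<in> xcochains M (n - 1)" "AE x in prodM M n. \<alpha> x = (if n = 0 then 0 else xd (n - 1) a x)"
    and b: "b \<in> xcochains M (n - 1)" "AE x in prodM M n. \<beta> x = (if n = 0 then 0 else xd (n - 1) b x)"
    unfolding xB_iff' by blast
  have "AE x in prodM M n. (\<alpha> - \<beta>) x = (if n = 0 then 0 else xd (n - 1) (a - b) x)"
    using a(2) b(2) by eventually_elim (simp add: xd_diff')
  then show "\<alpha> - \<beta> \<in> xB M n"
    using ab a(1) b(1) add_closedD(4)[OF xcochains_add_closed] unfolding xB_iff' by blast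
qed

lemma xB_subset_xZ: "xB M n \<subseteq> xZ M n"
proof
  fix \<alpha> assume \<alpha>: "\<alpha> \<in> xB M n"
  show "\<alpha> \<in> xZ M n"
  proof (cases n)
    case 0
    then have "AE w in prodM M n. \<alpha> w = 0 w" using \<alpha> by (auto simp: xB_iff)
    from xd_cong_AE[OF this] show ?thesis using \<alpha> by (auto simp: xZ_def xB_iff xd_zero')
  next
    case (Suc m)
    then obtain a where "AE x in prodM M n. \<alpha> x = xd m a x" using \<alpha> by (auto simp: xB_iff)
    from xd_cong_AE[OF this] show ?thesis using \<alpha> Suc by (auto simp: xZ_def xB_iff xd_xd)
  qed
qed

lemma xB_subset_xBcl: "xB M n \<subseteq> xBcl M n"
proof
  fix \<alpha> assume "\<alpha> \<in> xB M n"
  moreover have "xnorm2 M n R (\<alpha> - \<alpha>) = 0" for R by (simp add: xnorm2_def)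
  ultimately show "\<alpha> \<in> xBcl M n" unfolding xBcl_def by (auto simp: xB_iff intro!: bexI[of _ \<alpha>])
qed

lemma xBclD:
  assumes "\<alpha> \<in> xBcl M n" "R > 0" "e > 0"
  shows "\<exists>\<beta>\<in>xB M n. xnorm2 M n R (\<alpha> - \<beta>) < ennreal e"
  using assms unfolding xBcl_def by blast

lemma xBcl_add_closed: "add_closed (xBcl M n)"
proof (rule add_closedI)
  show "0 \<in> xBcl M n" using xB_subset_xBcl add_closedD(1)[OF xB_add_closed] by blast
next
  fix \<alpha> \<beta> assume ab: "\<alpha> \<in> xBcl M n" "\<beta> \<in> xBcl M n"
  then have abc: "\<alpha> \<in> xcochains M n" "\<beta> \<in> xcochains M n" by (auto simp: xBcl_def)
  have "\<exists>\<gamma>\<in>xB M n. xnorm2 M n R (\<alpha> - \<beta> - \<gamma>) < ennreal e" if R: "R > 0" and e: "e > 0" for R e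
  proof -
    obtain a b where a: "a \<in> xB M n" "xnorm2 M n R (\<alpha> - a) < ennreal (e/4)"
      and b: "b \<in> xB M n" "xnorm2 M n R (\<beta> - b) < ennreal (e/4)"
      using xBclD[OF ab(1) R, of "e/4"] xBclD[OF ab(2) R, of "e/4"] e by auto
    have "\<alpha> - a \<in> xcochains M n" "\<beta> - b \<in> xcochains M n"
      using a b abc add_closedD(4)[OF xcochains_add_closed] by (auto simp: xB_iff)
    then have "xnorm2 M n R ((\<alpha> - a) - (\<beta> - b)) \<le> 2 * xnorm2 M n R (\<alpha> - a) + 2 * xnorm2 M n R (\<beta> - b)"
      by (intro xnorm2_diff_le xcochainsD)
    also have "\<dots> < ennreal e" using a b by (intro ennreal_quarter_less)
    also have "(\<alpha> - a) - (\<beta> - b) = \<alpha> - \<beta> - (a - b)" by simp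
    finally show ?thesis using add_closedD(4)[OF xB_add_closed a(1) b(1)] by blast
  qed
  then show "\<alpha> - \<beta> \<in> xBcl M n" using add_closedD(4)[OF xcochains_add_closed abc] unfolding xBcl_def by blast
qed

lemma AE_GRI:
  assumes "\<And>R. R > 0 \<Longrightarrow> AE z in prodM M n. z \<in> GR n R \<longrightarrow> P z"
  shows "AE z in prodM M n. P z"
proof (rule AE_prodM_boxI)
  fix r :: real assume "r > 0"
  then have "AE z in prodM M n. z \<in> GR n (2 * r) \<longrightarrow> P z" using assms[of "2 * r"] by simp
  then show "AE z in prodM M n. z \<in> box n r \<longrightarrow> P z"
    by eventually_elim (use box_subset_DD[of n r] in \<open>auto simp: DD_def\<close>)
qed

lemma xnorm2_eq_0:
  assumes [measurable]: "\<alpha> \<in> borel_measurable (prodM M n)" and "\<And>R. R > 0 \<Longrightarrow> xnorm2 M n R \<alpha> = 0"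
  shows "AE z in prodM M n. \<alpha> z = 0"
proof (rule AE_GRI)
  fix R :: real assume "R > 0"
  then have "xnorm2 M n R \<alpha> = 0" by fact
  then have "AE z in prodM M n. indicator (GR n R) z * ennreal ((cmod (\<alpha> z))\<^sup>2) = 0"
    unfolding xnorm2_def by (subst (asm) nn_integral_0_iff_AE) auto
  then show "AE z in prodM M n. z \<in> GR n R \<longrightarrow> \<alpha> z = 0"
    by eventually_elim (auto simp: indicator_def)
qed

text \<open>Continuity of the differential: a seminorm of the image is controlled by a seminorm of
  larger radius. Cocycles are therefore closed and contain the closure of the coboundaries.\<close>

lemma xnorm2_xd_le:
  assumes R: "R > 0"
  shows "\<exists>C<\<infinity>. \<forall>\<alpha>\<in>borel_measurable (prodM M n). xnorm2 M (Suc n) R (xd n \<alpha>) \<le> C * xnorm2 M n (2 * (1 + R)) \<alpha>"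
proof -
  have "\<forall>i. \<exists>C<\<infinity>. \<forall>F\<in>borel_measurable (prodM M n).
     (\<integral>\<^sup>+z. indicator (GR (Suc n) R) z * F (face (Suc n) i z) \<partial>prodM M (Suc n))
       \<le> C * (\<integral>\<^sup>+z. indicator (GR n (2 * (1 + R))) z * F z \<partial>prodM M n)"
    using nn_integral_GR_face[OF R] by blast
  from choice[OF this] obtain C where C': "\<forall>i. C i < \<infinity> \<and> (\<forall>F\<in>borel_measurable (prodM M n).
     (\<integral>\<^sup>+z. indicator (GR (Suc n) R) z * F (face (Suc n) i z) \<partial>prodM M (Suc n))
       \<le> C i * (\<integral>\<^sup>+z. indicator (GR n (2 * (1 + R))) z * F z \<partial>prodM M n))" ..
  then have C: "C i < \<infinity>" "F \<in> borel_measurable (prodM M n) \<Longrightarrow>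
     (\<integral>\<^sup>+z. indicator (GR (Suc n) R) z * F (face (Suc n) i z) \<partial>prodM M (Suc n))
       \<le> C i * (\<integral>\<^sup>+z. indicator (GR n (2 * (1 + R))) z * F z \<partial>prodM M n)" for i F
    by (fast, fast)
  let ?k = "of_nat (Suc (Suc n)) :: ennreal"
  have "xnorm2 M (Suc n) R (xd n \<alpha>) \<le> (?k * (\<Sum>i\<le>Suc n. C i)) * xnorm2 M n (2 * (1 + R)) \<alpha>"
    if [measurable]: "\<alpha> \<in> borel_measurable (prodM M n)" for \<alpha>
  proof -
    let ?F = "\<lambda>z. ennreal ((cmod (\<alpha> z))\<^sup>2)"
    have "xnorm2 M (Suc n) R (xd n \<alpha>) \<le> (\<integral>\<^sup>+z. ?k * (\<Sum>i\<le>Suc n. indicator (GR (Suc n) R) z * ?F (face (Suc n) i z)) \<partial>prodM M (Suc n))"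
      unfolding xnorm2_def
    proof (rule nn_integral_mono)
      fix z assume "z \<in> space (prodM M (Suc n))"
      then have "(cmod (xd n \<alpha> z))\<^sup>2 \<le> real (card {..Suc n}) * (\<Sum>i\<le>Suc n. (cmod ((-1)^i * \<alpha> (face (Suc n) i z)))\<^sup>2)"
        using cmod_sum_square_le[of "{..Suc n}" "\<lambda>i. (-1)^i * \<alpha> (face (Suc n) i z)"] by (simp add: xd_def del: sum.atMost_Suc)
      then have "ennreal ((cmod (xd n \<alpha> z))\<^sup>2) \<le> ennreal (real (Suc (Suc n)) * (\<Sum>i\<le>Suc n. (cmod (\<alpha> (face (Suc n) i z)))\<^sup>2))"
        by (intro ennreal_leI) (simp add: norm_mult norm_power del: sum.atMost_Suc)
      also have "\<dots> = ?k * (\<Sum>i\<le>Suc n. ?F (face (Suc n) i z))"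
        by (simp add: ennreal_mult sum_nonneg sum_ennreal ennreal_of_nat_eq_real_of_nat del: sum.atMost_Suc of_nat_Suc)
      finally show "indicator (GR (Suc n) R) z * ennreal ((cmod (xd n \<alpha> z))\<^sup>2) \<le> ?k * (\<Sum>i\<le>Suc n. indicator (GR (Suc n) R) z * ?F (face (Suc n) i z))"
        by (auto simp: indicator_def simp del: sum.atMost_Suc of_nat_Suc)
    qed
    also have "\<dots> = ?k * (\<Sum>i\<le>Suc n. \<integral>\<^sup>+z. indicator (GR (Suc n) R) z * ?F (face (Suc n) i z) \<partial>prodM M (Suc n))"
      by (subst nn_integral_cmult, measurable, subst nn_integral_sum) measurable
    also have "\<dots> \<le> ?k * (\<Sum>i\<le>Suc n. C i * xnorm2 M n (2 * (1 + R)) \<alpha>)"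
      unfolding xnorm2_def by (intro mult_left_mono sum_mono C(2)) auto
    finally show ?thesis by (simp only: sum_distrib_right mult.assoc)
  qed
  moreover have "(\<Sum>i\<le>Suc n. C i) < \<infinity>"
    unfolding infinity_ennreal_def by (subst ennreal_sum_less_top) (use C(1) in auto)
  then have "?k * (\<Sum>i\<le>Suc n. C i) < \<infinity>"
    by (simp add: ennreal_mult_less_top of_nat_less_top del: sum.atMost_Suc of_nat_Suc)
  ultimately show ?thesis by blast
qed

lemma xBcl_subset_xZ: "xBcl M n \<subseteq> xZ M n"
proof
  fix \<alpha> assume a: "\<alpha> \<in> xBcl M n"
  then have ac: "\<alpha> \<in> xcochains M n" by (auto simp: xBcl_def)
  note [measurable] = xcochainsD(2)[OF ac]
  have "AE z in prodM M (Suc n). xd n \<alpha> z = 0"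
  proof (rule xnorm2_eq_0)
    fix R :: real assume R: "R > 0"
    obtain C where C: "C < \<infinity>" "\<And>\<alpha>. \<alpha> \<in> borel_measurable (prodM M n) \<Longrightarrow> xnorm2 M (Suc n) R (xd n \<alpha>) \<le> C * xnorm2 M n (2 * (1 + R)) \<alpha>"
      using xnorm2_xd_le[OF R] by metis
    show "xnorm2 M (Suc n) R (xd n \<alpha>) = 0"
    proof (rule ennreal_zeroI[OF C(1)])
      fix e :: real assume e: "e > 0"
      obtain b where b: "b \<in> xB M n" "xnorm2 M n (2 * (1 + R)) (\<alpha> - b) < ennreal e"
        using xBclD[OF a, of "2 * (1 + R)" e] R e by auto
      have "b \<in> xZ M n" using b xB_subset_xZ by blast
      then have "AE z in prodM M (Suc n). xd n b z = 0" by (auto simp: xZ_def)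
      then have "AE z in prodM M (Suc n). xd n \<alpha> z = xd n (\<alpha> - b) z" by eventually_elim (simp add: xd_diff')
      then have "xnorm2 M (Suc n) R (xd n \<alpha>) = xnorm2 M (Suc n) R (xd n (\<alpha> - b))" by (rule xnorm2_cong_AE)
      also have "\<dots> \<le> C * xnorm2 M n (2 * (1 + R)) (\<alpha> - b)"
        using b ac add_closedD(4)[OF xcochains_add_closed] by (intro C(2) xcochainsD(2)) (auto simp: xB_iff)
      also have "\<dots> \<le> C * ennreal e" using b by (intro mult_left_mono) auto
      finally show "xnorm2 M (Suc n) R (xd n \<alpha>) \<le> C * ennreal e" .
    qed
  qed measurable
  then show "\<alpha> \<in> xZ M n" using ac by (auto simp: xZ_def)
qed

subsection \<open>Jointly measurable versions of invariant continuous cochains\<close>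

text \<open>The indicator of the exceptional set has vanishing orbit integrals, so
  \<open>nn_integral_orb\<close> makes the set null in every \<open>GR n R\<close>. Equalities in
  L^2 at each tuple thus become equalities almost everywhere on tuples.\<close>

lemma AE_orbI:
  assumes [measurable]: "Measurable.pred (prodM M n) P"
    and ae: "\<And>x. x \<in> tup n \<Longrightarrow> AE y in M. P (act n (- y) x)"
  shows "AE z in prodM M n. P z"
proof (rule AE_GRI)
  fix R :: real assume "R > 0"
  let ?F = "\<lambda>z. indicator {z. \<not> P z} z :: ennreal"
  have F [measurable]: "?F \<in> borel_measurable (prodM M n)" by measurable
  have "orb n ?F z = 0" if "z \<in> tup n" for z
  proof -
    have "orb n ?F z = (\<integral>\<^sup>+y. 0 \<partial>M)"
      unfolding orb_def by (rule nn_integral_cong_AE) (use ae[OF that] in eventually_elim, auto)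
    then show ?thesis by simp
  qed
  then have "emeasure M (cball 0 1) * (\<integral>\<^sup>+z. indicator (GR n R) z * ?F z \<partial>prodM M n) = (\<integral>\<^sup>+z. 0 \<partial>prodM M n)"
    unfolding nn_integral_orb[OF F, symmetric] by (intro nn_integral_cong) auto
  then have "(\<integral>\<^sup>+z. indicator (GR n R) z * ?F z \<partial>prodM M n) = 0"
    using emeasure_cball_pos[of 1 0] by (auto simp: zero_less_iff_neq_zero)
  then have "AE z in prodM M n. indicator (GR n R) z * ?F z = 0"
    by (subst (asm) nn_integral_0_iff_AE) auto
  then show "AE z in prodM M n. z \<in> GR n R \<longrightarrow> P z"
    by eventually_elim (auto simp: indicator_def split: if_splits)
qed

text \<open>A relation, since \<open>f\<close> determines \<open>\<alpha>\<close> only up to null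
  sets (\<open>ver_eq_AE\<close>). The exceptional set of \<open>y\<close> may depend on
  \<open>x\<close>, but no \<open>x\<close> is excluded.\<close>

definition ver :: "nat \<Rightarrow> ((nat \<Rightarrow> 'g) \<Rightarrow> 'g \<Rightarrow> complex) \<Rightarrow> ((nat \<Rightarrow> 'g) \<Rightarrow> complex) \<Rightarrow> bool" where
  "ver n f \<alpha> \<longleftrightarrow> \<alpha> \<in> borel_measurable (prodM M n) \<and> (\<forall>x. x \<notin> tup n \<longrightarrow> \<alpha> x = 0) \<and>
     (\<forall>x\<in>tup n. AE y in M. f x y = \<alpha> (act n (- y) x))"

lemma verD:
  assumes "ver n f \<alpha>"
  shows "\<alpha> \<in> borel_measurable (prodM M n)" "x \<notin> tup n \<Longrightarrow> \<alpha> x = 0"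
    "x \<in> tup n \<Longrightarrow> AE y in M. f x y = \<alpha> (act n (- y) x)"
  using assms by (auto simp: ver_def)

text \<open>Makes open sets of the function space, in which continuity of cochains is stated,
  measurable for the product measure; entries beyond \<open>n\<close> are constant on
  tuples.\<close>

lemma id_measurable_prodM [measurable]: "(\<lambda>x. x) \<in> borel_measurable (prodM M n)"
proof (rule measurable_coordinatewise_then_product)
  fix i :: nat
  show "(\<lambda>x. x i) \<in> borel_measurable (prodM M n)"
  proof (cases "i \<le> n")
    case False
    then have "(\<lambda>x. x i) \<in> borel_measurable (prodM M n) \<longleftrightarrow> (\<lambda>x. undefined :: 'g) \<in> borel_measurable (prodM M n)"
      by (intro measurable_cong) (auto simp: tup_undefined)
    then show ?thesis by simp
  qed simp
qed

text \<open>Second countability gives a countable cover by sets on which \<open>f\<close> varies by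
  less than \<open>e\<close>. \<open>F\<close> takes at \<open>x\<close> the value of
  \<open>f\<close> at the centre of the first set that contains \<open>x\<close>, so it is constant
  in \<open>x\<close> on countably many measurable pieces.\<close>

lemma approx_measurable:
  assumes f: "f \<in> ccochains M n" and e: "e > 0"
  shows "\<exists>F. (\<lambda>p. F (fst p) (snd p)) \<in> borel_measurable (prodM M n \<Otimes>\<^sub>M M) \<and>
    (\<forall>x\<in>tup n. N2 (\<lambda>y. F x y - f x y) \<le> ennreal e)"
proof -
  note [measurable] = ccochainsD(2)[OF f]
  have "\<exists>U. open U \<and> x \<in> U \<and> (\<forall>w\<in>U \<inter> tup n. N2 (\<lambda>y. f w y - f x y) < ennreal e)" if "x \<in> tup n" for x :: "nat \<Rightarrow> 'g"
    using f that e unfolding ccochains_iff by blast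
  then obtain U where U: "\<And>x. x \<in> tup n \<Longrightarrow> open (U x)" "\<And>x. x \<in> tup n \<Longrightarrow> x \<in> U x"
    "\<And>x w. x \<in> tup n \<Longrightarrow> w \<in> U x \<Longrightarrow> w \<in> tup n \<Longrightarrow> N2 (\<lambda>y. f w y - f x y) < ennreal e"
    by (metis IntI)
  obtain \<U> where \<U>: "\<U> \<subseteq> U ` tup n" "countable \<U>" "\<Union>\<U> = \<Union>(U ` tup n)"
    using Lindelof[of "U ` tup n"] U(1) by auto
  obtain D where D: "countable D" "D \<subseteq> tup n" "\<U> = U ` D"
    using countable_subset_image[of \<U> U "tup n"] \<U> by blast
  have "D \<noteq> {}"
  proof
    assume "D = {}"
    then have "\<Union>(U ` tup n) = {}" using \<U> D by simp
    moreover have "act n 0 (\<lambda>_. 0) \<in> tup n" by simp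
    ultimately show False using U(2) by blast
  qed
  define c where "c = from_nat_into D"
  have c: "c j \<in> tup n" for j using from_nat_into[OF \<open>D \<noteq> {}\<close>] D by (auto simp: c_def)
  define J where "J x = (LEAST j. x \<in> U (c j))" for x
  have J: "x \<in> U (c (J x))" if "x \<in> tup n" for x
  proof -
    have "x \<in> \<Union>\<U>" using U(2)[OF that] that \<U> by blast
    then obtain d where "d \<in> D" "x \<in> U d" using D by auto
    then have "\<exists>j. x \<in> U (c j)" using from_nat_into_surj[OF D(1)] by (metis c_def)
    then show ?thesis unfolding J_def by (rule LeastI_ex)
  qed
  have [measurable]: "U (c j) \<in> sets borel" for j using U(1)[OF c] by simp
  have [measurable]: "J \<in> measurable (prodM M n) (count_space UNIV)"
    unfolding J_def by measurable
  show ?thesis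
  proof (rule exI[of _ "\<lambda>x. f (c (J x))"], intro conjI ballI)
    show "(\<lambda>p. f (c (J (fst p))) (snd p)) \<in> borel_measurable (prodM M n \<Otimes>\<^sub>M M)"
      by (rule measurable_compose_countable[where f="\<lambda>j p. f (c j) (snd p)" and g="\<lambda>p. J (fst p)"]) measurable
    fix x :: "nat \<Rightarrow> 'g" assume x: "x \<in> tup n"
    show "N2 (\<lambda>y. f (c (J x)) y - f x y) \<le> ennreal e"
      using U(3)[OF c J[OF x] x] by (simp add: N2_minus_commute less_imp_le)
  qed
qed

text \<open>Squared errors with finite sum force pointwise convergence for almost every
  \<open>y\<close>, at each \<open>x\<close>, without passing to a subsequence; the limit inherits
  joint measurability.\<close>

lemma joint_version:
  assumes f: "f \<in> ccochains M n"
  obtains F where "(\<lambda>p. F (fst p) (snd p)) \<in> borel_measurable (prodM M n \<Otimes>\<^sub>M M)"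
    "\<And>x. x \<in> tup n \<Longrightarrow> AE y in M. F x y = f x y"
proof -
  note [measurable] = ccochainsD(2)[OF f]
  have "\<forall>k. \<exists>F. (\<lambda>p. F (fst p) (snd p)) \<in> borel_measurable (prodM M n \<Otimes>\<^sub>M M) \<and>
      (\<forall>x\<in>tup n. N2 (\<lambda>y. F x y - f x y) \<le> ennreal ((1/2)^k))"
  proof
    fix k :: nat
    have "0 < (1/2 :: real) ^ k" by simp
    from approx_measurable[OF f this] show "\<exists>F. (\<lambda>p. F (fst p) (snd p)) \<in> borel_measurable (prodM M n \<Otimes>\<^sub>M M) \<and>
      (\<forall>x\<in>tup n. N2 (\<lambda>y. F x y - f x y) \<le> ennreal ((1/2)^k))" .
  qed
  from choice[OF this] obtain F where F': "\<forall>k. (\<lambda>p. F k (fst p) (snd p)) \<in> borel_measurable (prodM M n \<Otimes>\<^sub>M M) \<and>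
      (\<forall>x\<in>tup n. N2 (\<lambda>y. F k x y - f x y) \<le> ennreal ((1/2)^k))" ..
  have F [measurable]: "(\<lambda>p. F k (fst p) (snd p)) \<in> borel_measurable (prodM M n \<Otimes>\<^sub>M M)" for k
    using F' by fast
  have FN: "N2 (\<lambda>y. F k x y - f x y) \<le> ennreal ((1/2)^k)" if "x \<in> tup n" for k x
    using F' that by fast
  have ae: "AE y in M. (\<lambda>k. F k x y) \<longlonglongrightarrow> f x y" if x: "x \<in> tup n" for x
  proof -
    have [measurable]: "F k x \<in> borel_measurable M" for k
      using measurable_compose[OF measurable_Pair1'[of x "prodM M n" M] F[of k]] x by simp
    have "(\<integral>\<^sup>+y. (\<Sum>k. ennreal ((cmod (F k x y - f x y))\<^sup>2)) \<partial>M) = (\<Sum>k. N2 (\<lambda>y. F k x y - f x y))"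
      unfolding N2_def by (rule nn_integral_suminf) measurable
    also have "\<dots> \<le> (\<Sum>k. ennreal ((1/2)^k))"
      by (intro suminf_le FN x) auto
    also have "\<dots> = ennreal (\<Sum>k. (1/2)^k)"
      by (rule suminf_ennreal2) (auto intro!: summable_geometric)
    finally have "(\<integral>\<^sup>+y. (\<Sum>k. ennreal ((cmod (F k x y - f x y))\<^sup>2)) \<partial>M) \<noteq> \<infinity>"
      by (auto simp: top_unique)
    then have "AE y in M. (\<Sum>k. ennreal ((cmod (F k x y - f x y))\<^sup>2)) \<noteq> \<infinity>"
      by (intro nn_integral_PInf_AE) measurable
    then show ?thesis
    proof eventually_elim
      fix y assume "(\<Sum>k. ennreal ((cmod (F k x y - f x y))\<^sup>2)) \<noteq> \<infinity>"
      then have "summable (\<lambda>k. (cmod (F k x y - f x y))\<^sup>2)"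
        by (intro summable_suminf_not_top) auto
      then have "(\<lambda>k. (cmod (F k x y - f x y))\<^sup>2) \<longlonglongrightarrow> 0" by (rule summable_LIMSEQ_zero)
      from tendsto_real_sqrt[OF this] have "(\<lambda>k. cmod (F k x y - f x y)) \<longlonglongrightarrow> 0" by simp
      then show "(\<lambda>k. F k x y) \<longlonglongrightarrow> f x y"
        using tendsto_norm_zero_iff Lim_null by blast
    qed
  qed
  show ?thesis
  \<comment> \<open>Where the sequence diverges, \<open>lim\<close> has some default value; for each
    tuple \<open>x\<close> this concerns only a null set of \<open>y\<close>.\<close>
  proof (rule that[of "\<lambda>x y. lim (\<lambda>k. F k x y)"])
    show "(\<lambda>p. lim (\<lambda>k. F k (fst p) (snd p))) \<in> borel_measurable (prodM M n \<Otimes>\<^sub>M M)"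
      by measurable
    fix x :: "nat \<Rightarrow> 'g" assume "x \<in> tup n"
    from ae[OF this] show "AE y in M. lim (\<lambda>k. F k x y) = f x y" by eventually_elim (rule limI)
  qed
qed

text \<open>Invariance allows evaluating at \<open>x 0 = 0\<close> only, which turns the version that is exact
  for each \<open>x\<close> almost everywhere into a function of the orbit.\<close>
lemma ver_exists:
  assumes f: "f \<in> ccochains M n"
  obtains \<alpha> where "ver n f \<alpha>"
proof -
  obtain F where F [measurable]: "(\<lambda>p. F (fst p) (snd p)) \<in> borel_measurable (prodM M n \<Otimes>\<^sub>M M)"
    and Fae: "\<And>x. x \<in> tup n \<Longrightarrow> AE y in M. F x y = f x y"
    using joint_version[OF f] by blast
  \<comment> \<open>Along the orbit \<open>act n (- y) x\<close> the first argument of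
    \<open>F\<close> stays at \<open>act n (- x 0) x\<close> while the second becomes
    \<open>- x 0 + y\<close>, so one almost-everywhere equality covers the whole orbit.\<close>
  define \<alpha> where "\<alpha> z = (if z \<in> tup n then F (act n (- z 0) z) (- z 0) else 0)" for z
  have "(\<lambda>z. F (act n (- z 0) z) (- z 0)) \<in> borel_measurable (prodM M n)"
  proof -
    have "(\<lambda>z. (act n (- z 0) z, - z 0)) \<in> measurable (prodM M n) (prodM M n \<Otimes>\<^sub>M M)" by measurable
    from measurable_compose[OF this F] show ?thesis by simp
  qed
  then have "\<alpha> \<in> borel_measurable (prodM M n)"
    by (subst measurable_cong[of _ _ "\<lambda>z. F (act n (- z 0) z) (- z 0)"]) (auto simp: \<alpha>_def)
  moreover have "AE y in M. f x y = \<alpha> (act n (- y) x)" if x: "x \<in> tup n" for x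
  proof -
    let ?x = "act n (- x 0) x"
    have "AE y in M. F ?x (- x 0 + y) = f ?x (- x 0 + y)" by (intro AE_left Fae) auto
    moreover have "AE y in M. f (act n (x 0) ?x) y = f ?x (- x 0 + y)" by (rule ccochainsD(4)[OF f]) auto
    ultimately show ?thesis
      by eventually_elim (use x in \<open>simp add: \<alpha>_def act_apply minus_add\<close>)
  qed
  ultimately show ?thesis using that[of \<alpha>] by (auto simp: ver_def \<alpha>_def)
qed

lemma ver_N2:
  assumes "ver n f \<alpha>" "x \<in> tup n"
  shows "N2 (f x) = orb n (\<lambda>z. ennreal ((cmod (\<alpha> z))\<^sup>2)) x"
  using N2_cong_AE[OF verD(3)[OF assms]] by (simp add: N2_def orb_def)

text \<open>The bridge between the two topologies: uniform control of \<open>f\<close> on the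
  compact slice controls the seminorm of \<open>\<alpha>\<close> with the same
  \<open>R\<close>.\<close>

lemma ver_xnorm2:
  assumes v: "ver n f \<alpha>"
  shows "emeasure M (cball 0 \<rho>) * xnorm2 M n R \<alpha> = (\<integral>\<^sup>+z. indicator (DD n \<rho> R) z * N2 (f z) \<partial>prodM M n)"
proof -
  note [measurable] = verD(1)[OF v]
  have "emeasure M (cball 0 \<rho>) * xnorm2 M n R \<alpha> = (\<integral>\<^sup>+z. indicator (DD n \<rho> R) z * orb n (\<lambda>z. ennreal ((cmod (\<alpha> z))\<^sup>2)) z \<partial>prodM M n)"
    unfolding xnorm2_def by (rule nn_integral_orb[symmetric]) measurable
  also have "\<dots> = (\<integral>\<^sup>+z. indicator (DD n \<rho> R) z * N2 (f z) \<partial>prodM M n)"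
    by (intro nn_integral_cong) (simp add: ver_N2[OF v])
  finally show ?thesis .
qed

lemma emeasure_DD_finite: "emeasure (prodM M n) (DD n \<rho> R) < \<infinity>"
  using emeasure_mono[OF DD_subset_box[of n \<rho> R], of "prodM M n"] emeasure_box_finite by (auto intro: le_less_trans)

lemma ver_xnorm2_le:
  assumes v: "ver n f \<alpha>" and B: "\<And>x. x \<in> DD n 1 R \<Longrightarrow> N2 (f x) \<le> B"
  shows "xnorm2 M n R \<alpha> \<le> inverse (emeasure M (cball 0 1)) * (emeasure (prodM M n) (DD n 1 R) * B)"
proof (rule ennreal_le_divide_cball)
  have "emeasure M (cball 0 1) * xnorm2 M n R \<alpha> \<le> (\<integral>\<^sup>+z. B * indicator (DD n 1 R) z \<partial>prodM M n)"
    unfolding ver_xnorm2[OF v] using B by (intro nn_integral_mono) (auto simp: indicator_def)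
  also have "\<dots> = emeasure (prodM M n) (DD n 1 R) * B"
    by (subst nn_integral_cmult_indicator) (auto simp: mult.commute)
  finally show "emeasure M (cball 0 1) * xnorm2 M n R \<alpha> \<le> emeasure (prodM M n) (DD n 1 R) * B" .
qed

lemma ver_xcochains:
  assumes f: "f \<in> ccochains M n" and v: "ver n f \<alpha>"
  shows "\<alpha> \<in> xcochains M n"
proof -
  have "xnorm2 M n R \<alpha> < \<infinity>" if "R > 0" for R
  proof -
    have "DD n 1 R \<subseteq> tup n" by (auto simp: DD_def GR_def)
    from N2_bounded[OF f compact_DD this] obtain B where B: "\<And>x. x \<in> DD n 1 R \<Longrightarrow> N2 (f x) \<le> ennreal B" by metis
    from ver_xnorm2_le[OF v B]
    have "xnorm2 M n R \<alpha> \<le> inverse (emeasure M (cball 0 1)) * (emeasure (prodM M n) (DD n 1 R) * ennreal B)" .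
    also have "\<dots> < \<infinity>"
      using inverse_cball_finite emeasure_DD_finite by (simp add: ennreal_mult_less_top)
    finally show ?thesis .
  qed
  then show ?thesis using verD[OF v] by (auto simp: xcochains_def)
qed

lemma ver_diff:
  assumes f: "ver n f \<alpha>" and h: "ver n h \<beta>"
  shows "ver n (f - h) (\<alpha> - \<beta>)"
proof -
  note [measurable] = verD(1)[OF f] verD(1)[OF h]
  have "AE y in M. (f - h) x y = (\<alpha> - \<beta>) (act n (- y) x)" if "x \<in> tup n" for x
    using verD(3)[OF f that] verD(3)[OF h that] by eventually_elim simp
  moreover have "\<alpha> - \<beta> \<in> borel_measurable (prodM M n)" by (simp add: fun_diff_def)
  ultimately show ?thesis using f h by (auto simp: ver_def)
qed

lemma ver_cd:
  assumes f: "ver n f \<alpha>"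
  shows "ver (Suc n) (cd n f) (xd n \<alpha>)"
proof -
  note [measurable] = verD(1)[OF f]
  have "AE y in M. cd n f x y = xd n \<alpha> (act (Suc n) (- y) x)" if x: "x \<in> tup (Suc n)" for x
  proof -
    have "AE y in M. \<forall>i\<in>{..Suc n}. f (face (Suc n) i x) y = \<alpha> (act n (- y) (face (Suc n) i x))"
      using verD(3)[OF f] by (intro AE_finite_allI) auto
    then show ?thesis
      by eventually_elim (use x in \<open>auto simp: cd_def xd_def simp del: sum.atMost_Suc intro!: sum.cong\<close>)
  qed
  moreover have "xd n \<alpha> \<in> borel_measurable (prodM M (Suc n))" by measurable
  ultimately show ?thesis by (auto simp: ver_def xd_def)
qed

lemma ver_eq_AE:
  assumes f: "ver n f \<alpha>" and h: "ver n h \<beta>" and eq: "\<And>x. x \<in> tup n \<Longrightarrow> AE y in M. f x y = h x y"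
  shows "AE z in prodM M n. \<alpha> z = \<beta> z"
proof (rule AE_orbI)
  note [measurable] = verD(1)[OF f] verD(1)[OF h]
  show "Measurable.pred (prodM M n) (\<lambda>z. \<alpha> z = \<beta> z)"
  proof -
    have "Measurable.pred (prodM M n) (\<lambda>z. \<alpha> z - \<beta> z \<in> {0})" by measurable
    then show ?thesis by simp
  qed
  fix x :: "nat \<Rightarrow> 'g" assume "x \<in> tup n"
  from verD(3)[OF f this] verD(3)[OF h this] eq[OF this]
  show "AE y in M. \<alpha> (act n (- y) x) = \<beta> (act n (- y) x)" by eventually_elim simp
qed

subsection \<open>Smoothing\<close>

definition smooth :: "nat \<Rightarrow> ((nat \<Rightarrow> 'g) \<Rightarrow> complex) \<Rightarrow> (nat \<Rightarrow> 'g) \<Rightarrow> complex" where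
  "smooth n \<alpha> x = (if x \<in> tup n then \<integral>z. \<alpha> z \<partial>KK n x else 0)"

text \<open>A function \<open>\<beta>\<close> on tuples corresponds to the invariant map \<open>x \<mapsto> (y \<mapsto> \<beta> (y\<^sup>-\<^sup>1 x))\<close>; smoothing
  makes this map well defined on classes and continuous.\<close>
definition Psi :: "nat \<Rightarrow> ((nat \<Rightarrow> 'g) \<Rightarrow> complex) \<Rightarrow> (nat \<Rightarrow> 'g) \<Rightarrow> 'g \<Rightarrow> complex" where
  "Psi n \<alpha> x = (if x \<in> tup n then (\<lambda>y. smooth n \<alpha> (act n (- y) x)) else 0)"

lemma KK_integrableI:
  fixes u :: "(nat \<Rightarrow> 'g) \<Rightarrow> complex"
  assumes [measurable]: "u \<in> borel_measurable (prodM M n)"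
    and fin: "(\<integral>\<^sup>+z. ennreal ((cmod (u z))\<^sup>2) \<partial>KK n x) < \<infinity>"
  shows "integrable (KK n x) u"
proof (rule integrableI_bounded)
  have "(\<integral>\<^sup>+z. ennreal (norm (u z)) \<partial>KK n x) \<le> (\<integral>\<^sup>+z. 1 + ennreal ((cmod (u z))\<^sup>2) \<partial>KK n x)"
  proof (rule nn_integral_mono)
    fix z
    have "0 \<le> (cmod (u z) - 1)\<^sup>2" by simp
    then have "cmod (u z) \<le> 1 + (cmod (u z))\<^sup>2" by (simp add: power2_diff) (smt (verit) norm_ge_zero)
    then have "ennreal (cmod (u z)) \<le> ennreal (1 + (cmod (u z))\<^sup>2)" by (rule ennreal_leI)
    then show "ennreal (norm (u z)) \<le> 1 + ennreal ((cmod (u z))\<^sup>2)" by (simp add: ennreal_plus)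
  qed
  also have "\<dots> = 1 + (\<integral>\<^sup>+z. ennreal ((cmod (u z))\<^sup>2) \<partial>KK n x)"
    by (subst nn_integral_add) (auto simp: KK.emeasure_space_1[simplified])
  also have "\<dots> < \<infinity>" using fin by simp
  finally show "(\<integral>\<^sup>+z. ennreal (norm (u z)) \<partial>KK n x) < \<infinity>" .
qed simp

lemma tup_in_box:
  assumes "x \<in> tup n"
  obtains r where "r > 0" "x \<in> box n r"
proof (rule that[of "1 + (\<Sum>i\<le>n. dist 0 (x i))"])
  show "1 + (\<Sum>i\<le>n. dist 0 (x i)) > 0" by (intro add_pos_nonneg sum_nonneg) auto
  have "dist 0 (x i) \<le> 1 + (\<Sum>i\<le>n. dist 0 (x i))" if "i \<le> n" for i
    using member_le_sum[of i "{..n}" "\<lambda>i. dist 0 (x i)"] that by auto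
  then show "x \<in> box n (1 + (\<Sum>i\<le>n. dist 0 (x i)))" using assms by (auto simp: mem_box_iff)
qed

text \<open>Holds at every tuple: the kernel at \<open>x\<close> is bounded and supported in a box,
  and a box lies in some \<open>GR n R\<close>. Hence smoothed functions are defined by genuine
  integrals everywhere.\<close>

lemma xcochains_square_KK:
  assumes a: "\<alpha> \<in> xcochains M n" and x: "x \<in> tup n"
  shows "(\<integral>\<^sup>+z. ennreal ((cmod (\<alpha> z))\<^sup>2) \<partial>KK n x) < \<infinity>"
proof -
  note [measurable] = xcochainsD(2)[OF a]
  obtain r where r: "r > 0" "x \<in> box n r" using tup_in_box[OF x] by blast
  have "(\<integral>\<^sup>+z. ennreal ((cmod (\<alpha> z))\<^sup>2) \<partial>KK n x) = (\<integral>\<^sup>+z. ennreal (kk n x z) * ennreal ((cmod (\<alpha> z))\<^sup>2) \<partial>prodM M n)"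
    by (rule nn_integral_KK) (use x in auto)
  also have "\<dots> \<le> (\<integral>\<^sup>+z. ennreal (ker_height ^ Suc n) * (indicator (GR n (2 * (r + 1))) z * ennreal ((cmod (\<alpha> z))\<^sup>2)) \<partial>prodM M n)"
  proof (rule nn_integral_mono)
    fix z assume "z \<in> space (prodM M n)"
    then have z: "z \<in> tup n" by simp
    have "ennreal (kk n x z) \<le> ennreal (ker_height ^ Suc n) * indicator (GR n (2 * (r + 1))) z"
    proof (cases "z \<in> box n (r + 1)")
      case True
      then have "z \<in> GR n (2 * (r + 1))" using box_subset_DD[of n "r + 1"] unfolding DD_def by blast
      then show ?thesis using ennreal_leI[OF kk_le] by simp
    next
      case False
      then have "kk n x z \<le> 0" using KK_close[OF r(2) z] by simp
      then show ?thesis by (simp add: ennreal_neg)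
    qed
    from mult_right_mono[OF this, of "ennreal ((cmod (\<alpha> z))\<^sup>2)"]
    show "ennreal (kk n x z) * ennreal ((cmod (\<alpha> z))\<^sup>2) \<le> ennreal (ker_height ^ Suc n) * (indicator (GR n (2 * (r + 1))) z * ennreal ((cmod (\<alpha> z))\<^sup>2))"
      by (simp add: mult.assoc)
  qed
  also have "\<dots> = ennreal (ker_height ^ Suc n) * xnorm2 M n (2 * (r + 1)) \<alpha>"
    unfolding xnorm2_def by (rule nn_integral_cmult) measurable
  also have "\<dots> < \<infinity>"
    using xcochainsD(3)[OF a, of "2 * (r + 1)"] r by (auto simp: ennreal_mult_less_top)
  finally show ?thesis .
qed

lemma xcochains_integrable_KK:
  assumes "\<alpha> \<in> xcochains M n" "x \<in> tup n"
  shows "integrable (KK n x) \<alpha>"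
  by (rule KK_integrableI[OF xcochainsD(2)[OF assms(1)] xcochains_square_KK[OF assms]])

lemma integral_KK:
  fixes u :: "(nat \<Rightarrow> 'g) \<Rightarrow> complex"
  assumes [measurable]: "u \<in> borel_measurable (prodM M n)" and x: "x \<in> tup n"
  shows "(\<integral>z. u z \<partial>KK n x) = (\<integral>z. kk n x z *\<^sub>R u z \<partial>prodM M n)"
  unfolding KK_density using x by (intro integral_density) auto

lemma integrable_KK:
  fixes u :: "(nat \<Rightarrow> 'g) \<Rightarrow> complex"
  assumes [measurable]: "u \<in> borel_measurable (prodM M n)" and x: "x \<in> tup n"
  shows "integrable (KK n x) u \<longleftrightarrow> integrable (prodM M n) (\<lambda>z. kk n x z *\<^sub>R u z)"
  unfolding KK_density using x by (intro integrable_density) auto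

lemma integral_KK_act:
  fixes u :: "(nat \<Rightarrow> 'g) \<Rightarrow> complex"
  assumes [measurable]: "u \<in> borel_measurable (prodM M n)"
  shows "(\<integral>z. u z \<partial>KK n (act n g x)) = (\<integral>z. u (act n g z) \<partial>KK n x)"
  by (subst distr_KK_act[symmetric], rule integral_distr) measurable

lemma integrable_KK_act:
  fixes u :: "(nat \<Rightarrow> 'g) \<Rightarrow> complex"
  assumes [measurable]: "u \<in> borel_measurable (prodM M n)"
  shows "integrable (KK n (act n g x)) u \<longleftrightarrow> integrable (KK n x) (\<lambda>z. u (act n g z))"
  by (subst distr_KK_act[symmetric], rule integrable_distr_eq) measurable

lemma integral_KK_face:
  fixes u :: "(nat \<Rightarrow> 'g) \<Rightarrow> complex"
  assumes [measurable]: "u \<in> borel_measurable (prodM M n)"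
  shows "(\<integral>z. u (face (Suc n) i z) \<partial>KK (Suc n) x) = (\<integral>z. u z \<partial>KK n (face (Suc n) i x))"
  by (subst distr_KK_face[symmetric], rule integral_distr[symmetric]) measurable

lemma integrable_KK_face:
  fixes u :: "(nat \<Rightarrow> 'g) \<Rightarrow> complex"
  assumes [measurable]: "u \<in> borel_measurable (prodM M n)"
  shows "integrable (KK (Suc n) x) (\<lambda>z. u (face (Suc n) i z)) \<longleftrightarrow> integrable (KK n (face (Suc n) i x)) u"
  by (subst distr_KK_face[symmetric], rule integrable_distr_eq[symmetric]) measurable

lemma integral_KK_measurable [measurable (raw)]:
  fixes F :: "'a \<Rightarrow> (nat \<Rightarrow> 'g) \<Rightarrow> complex"
  assumes [measurable]: "(\<lambda>(w, z). F w z) \<in> borel_measurable (N \<Otimes>\<^sub>M prodM M n)" "x \<in> measurable N (prodM M n)"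
  shows "(\<lambda>w. \<integral>z. F w z \<partial>KK n (x w)) \<in> borel_measurable N"
proof -
  have "(\<lambda>w. \<integral>z. kk n (x w) z *\<^sub>R F w z \<partial>prodM M n) \<in> borel_measurable N"
    by measurable
  moreover have "(\<integral>z. F w z \<partial>KK n (x w)) = (\<integral>z. kk n (x w) z *\<^sub>R F w z \<partial>prodM M n)" if "w \<in> space N" for w
  proof (rule integral_KK)
    show "x w \<in> tup n" using measurable_space[OF assms(2) that] by simp
    show "F w \<in> borel_measurable (prodM M n)"
      using measurable_compose[OF measurable_Pair1'[OF that] assms(1)] by simp
  qed
  ultimately show ?thesis by (subst measurable_cong) auto
qed

lemma smooth_measurable [measurable (raw)]:
  assumes [measurable]: "\<alpha> \<in> borel_measurable (prodM M n)" "x \<in> measurable N (prodM M n)"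
  shows "(\<lambda>w. smooth n \<alpha> (x w)) \<in> borel_measurable N"
proof -
  have "(\<lambda>w. \<integral>z. \<alpha> z \<partial>KK n (x w)) \<in> borel_measurable N" by measurable
  moreover have "x w \<in> tup n" if "w \<in> space N" for w
    using measurable_space[OF assms(2) that] by simp
  ultimately show ?thesis by (subst measurable_cong) (auto simp: smooth_def)
qed

lemma smooth_act:
  assumes "\<alpha> \<in> borel_measurable (prodM M n)"
  shows "smooth n \<alpha> (act n g x) = (\<integral>z. \<alpha> (act n g z) \<partial>KK n x)"
  using integral_KK_act[OF assms] by (simp add: smooth_def)

text \<open>Equivariance of averaging puts the translation on \<open>\<alpha>\<close>, so
  \<open>x\<close> enters only through the Lipschitz density.\<close>

lemma Psi_eq:
  assumes "\<alpha> \<in> borel_measurable (prodM M n)" "x \<in> tup n"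
  shows "Psi n \<alpha> x y = (\<integral>z. kk n x z *\<^sub>R \<alpha> (act n (- y) z) \<partial>prodM M n)"
  using assms by (simp add: Psi_def smooth_act integral_KK)

text \<open>Cauchy-Schwarz in \<open>z\<close>, Tonelli, and then the orbit estimate on the box. The
  weight \<open>q\<close> is general because one kernel gives boundedness of
  \<open>Psi n \<alpha>\<close> and a difference of two kernels gives its continuity.\<close>

lemma orbit_average_le:
  assumes [measurable]: "\<alpha> \<in> borel_measurable (prodM M n)" "q \<in> borel_measurable (prodM M n)"
    and q: "\<And>z. z \<in> tup n \<Longrightarrow> \<bar>q z\<bar> \<le> \<epsilon> * indicator (box n r) z" and \<epsilon>: "\<epsilon> \<ge> 0"
  shows "N2 (\<lambda>y. \<integral>z. q z *\<^sub>R \<alpha> (act n (- y) z) \<partial>prodM M n)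
     \<le> ennreal (\<epsilon>\<^sup>2) * (emeasure (prodM M n) (box n r) * emeasure M (cball 0 r) * xnorm2 M n (2 * r) \<alpha>)"
proof -
  let ?F = "\<lambda>z. ennreal ((cmod (\<alpha> z))\<^sup>2)"
  have pointwise: "ennreal ((cmod (\<integral>z. q z *\<^sub>R \<alpha> (act n (- y) z) \<partial>prodM M n))\<^sup>2)
     \<le> ennreal (\<epsilon>\<^sup>2) * emeasure (prodM M n) (box n r) * (\<integral>\<^sup>+z. indicator (box n r) z * ?F (act n (- y) z) \<partial>prodM M n)" for y
  proof -
    let ?u = "\<lambda>z. q z *\<^sub>R \<alpha> (act n (- y) z)"
    have "ennreal (cmod (\<integral>z. ?u z \<partial>prodM M n)) \<le> (\<integral>\<^sup>+z. ennreal (cmod (?u z)) \<partial>prodM M n)"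
    proof (cases "integrable (prodM M n) ?u")
      case True
      then show ?thesis by (rule integral_norm_bound_ennreal)
    qed (simp add: not_integrable_integral_eq)
    \<comment> \<open>Writing the indicator twice lets Cauchy-Schwarz produce the volume of the box
      in one factor and the restricted square of \<open>\<alpha>\<close> in the other.\<close>
    also have "\<dots> \<le> (\<integral>\<^sup>+z. (ennreal \<epsilon> * indicator (box n r) z) * (indicator (box n r) z * ennreal (cmod (\<alpha> (act n (- y) z)))) \<partial>prodM M n)"
    proof (rule nn_integral_mono)
      fix z assume "z \<in> space (prodM M n)"
      then have *: "\<bar>q z\<bar> \<le> \<epsilon> * indicator (box n r) z" using q by simp
      show "ennreal (cmod (?u z)) \<le> (ennreal \<epsilon> * indicator (box n r) z) * (indicator (box n r) z * ennreal (cmod (\<alpha> (act n (- y) z))))"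
      proof (cases "z \<in> box n r")
        case True
        then have "\<bar>q z\<bar> * cmod (\<alpha> (act n (- y) z)) \<le> \<epsilon> * cmod (\<alpha> (act n (- y) z))"
          using * by (intro mult_right_mono) auto
        then have "ennreal (\<bar>q z\<bar> * cmod (\<alpha> (act n (- y) z))) \<le> ennreal (\<epsilon> * cmod (\<alpha> (act n (- y) z)))"
          by (rule ennreal_leI)
        then show ?thesis using True \<epsilon> by (simp add: ennreal_mult)
      qed (use * in auto)
    qed
    finally have "(ennreal (cmod (\<integral>z. ?u z \<partial>prodM M n)))\<^sup>2 \<le> (\<integral>\<^sup>+z. (ennreal \<epsilon> * indicator (box n r) z) * (indicator (box n r) z * ennreal (cmod (\<alpha> (act n (- y) z)))) \<partial>prodM M n)\<^sup>2"
      by (rule power_mono) simp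
    also have "\<dots> \<le> (\<integral>\<^sup>+z. (ennreal \<epsilon> * indicator (box n r) z)\<^sup>2 \<partial>prodM M n) * (\<integral>\<^sup>+z. (indicator (box n r) z * ennreal (cmod (\<alpha> (act n (- y) z))))\<^sup>2 \<partial>prodM M n)"
      by (rule Cauchy_Schwarz_nn_integral) measurable
    also have "(\<integral>\<^sup>+z. (ennreal \<epsilon> * indicator (box n r) z)\<^sup>2 \<partial>prodM M n) = (\<integral>\<^sup>+z. ennreal (\<epsilon>\<^sup>2) * indicator (box n r) z \<partial>prodM M n)"
      using \<epsilon> by (intro nn_integral_cong) (auto simp: indicator_def ennreal_power)
    also have "\<dots> = ennreal (\<epsilon>\<^sup>2) * emeasure (prodM M n) (box n r)"
      by (rule nn_integral_cmult_indicator) measurable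
    also have "(\<integral>\<^sup>+z. (indicator (box n r) z * ennreal (cmod (\<alpha> (act n (- y) z))))\<^sup>2 \<partial>prodM M n) = (\<integral>\<^sup>+z. indicator (box n r) z * ?F (act n (- y) z) \<partial>prodM M n)"
      by (intro nn_integral_cong) (auto simp: indicator_def ennreal_power)
    finally show ?thesis by (simp add: ennreal_power)
  qed
  have "N2 (\<lambda>y. \<integral>z. q z *\<^sub>R \<alpha> (act n (- y) z) \<partial>prodM M n)
     \<le> (\<integral>\<^sup>+y. ennreal (\<epsilon>\<^sup>2) * emeasure (prodM M n) (box n r) * (\<integral>\<^sup>+z. indicator (box n r) z * ?F (act n (- y) z) \<partial>prodM M n) \<partial>M)"
    unfolding N2_def by (intro nn_integral_mono pointwise)
  also have "\<dots> = ennreal (\<epsilon>\<^sup>2) * emeasure (prodM M n) (box n r) * (\<integral>\<^sup>+y. \<integral>\<^sup>+z. indicator (box n r) z * ?F (act n (- y) z) \<partial>prodM M n \<partial>M)"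
    by (rule nn_integral_cmult) measurable
  also have "(\<integral>\<^sup>+y. \<integral>\<^sup>+z. indicator (box n r) z * ?F (act n (- y) z) \<partial>prodM M n \<partial>M) = (\<integral>\<^sup>+z. \<integral>\<^sup>+y. indicator (box n r) z * ?F (act n (- y) z) \<partial>M \<partial>prodM M n)"
    by (rule pMM.Fubini') measurable
  also have "\<dots> = (\<integral>\<^sup>+z. indicator (box n r) z * orb n ?F z \<partial>prodM M n)"
    unfolding orb_def by (intro nn_integral_cong nn_integral_cmult) measurable
  also have "\<dots> \<le> emeasure M (cball 0 r) * xnorm2 M n (2 * r) \<alpha>"
    unfolding xnorm2_def by (rule nn_integral_box_orb_le) measurable
  finally show ?thesis by (simp add: mult.assoc mult_left_mono)
qed

lemma N2_Psi_le:
  assumes [measurable]: "\<alpha> \<in> borel_measurable (prodM M n)" and x: "x \<in> box n r"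
  shows "N2 (Psi n \<alpha> x) \<le> ennreal ((ker_height ^ Suc n)\<^sup>2) *
     (emeasure (prodM M n) (box n (r + 1)) * emeasure M (cball 0 (r + 1)) * xnorm2 M n (2 * (r + 1)) \<alpha>)"
proof -
  have xt [simp]: "x \<in> tup n" using x by (rule box_tup)
  have "N2 (Psi n \<alpha> x) = N2 (\<lambda>y. \<integral>z. kk n x z *\<^sub>R \<alpha> (act n (- y) z) \<partial>prodM M n)"
    by (rule arg_cong[of _ _ N2]) (auto simp: Psi_eq)
  also have "\<dots> \<le> ennreal ((ker_height ^ Suc n)\<^sup>2) *
     (emeasure (prodM M n) (box n (r + 1)) * emeasure M (cball 0 (r + 1)) * xnorm2 M n (2 * (r + 1)) \<alpha>)"
    by (rule orbit_average_le) (use KK_close[OF x] ker_height_pos in auto)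
  finally show ?thesis .
qed

text \<open>Instance of \<open>orbit_average_le\<close> with the bound from \<open>kk_diff\<close>.
  The condition \<open>\<delta> \<le> 1\<close> keeps \<open>w\<close> in the box of radius r + 1,
  so both kernels are supported in the box of radius r + 2.\<close>

lemma N2_Psi_diff_le:
  assumes a: "\<alpha> \<in> xcochains M n" and x: "x \<in> box n r" and w: "w \<in> tup n"
    and d: "\<And>i. i \<le> n \<Longrightarrow> dist (w i) (x i) < \<delta>" and \<delta>: "\<delta> \<le> 1"
  shows "N2 (\<lambda>y. Psi n \<alpha> w y - Psi n \<alpha> x y) \<le> ennreal ((ker_height ^ Suc n * (real (Suc n) * \<delta>))\<^sup>2) *
     (emeasure (prodM M n) (box n (r + 2)) * emeasure M (cball 0 (r + 2)) * xnorm2 M n (2 * (r + 2)) \<alpha>)"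
proof -
  note [measurable] = xcochainsD(2)[OF a]
  have xt [simp]: "x \<in> tup n" using x by (rule box_tup)
  note w [simp]
  have wb: "w \<in> box n (r + 1)"
  proof -
    have "dist 0 (w i) \<le> r + 1" if "i \<le> n" for i
      using d[OF that] \<delta> dist_triangle[of 0 "w i" "x i"] x that by (force simp: mem_box_iff dist_commute)
    then show ?thesis by (simp add: mem_box_iff)
  qed
  have \<delta>0: "\<delta> \<ge> 0" using d[of 0] by (smt (verit) zero_le_dist le0)
  have int: "integrable (prodM M n) (\<lambda>z. kk n v z *\<^sub>R \<alpha> (act n (- y) z))" if [simp]: "v \<in> tup n" for v y
  proof -
    have "integrable (KK n (act n (- y) v)) \<alpha>" by (rule xcochains_integrable_KK[OF a]) simp
    then have "integrable (KK n v) (\<lambda>z. \<alpha> (act n (- y) z))" by (subst (asm) integrable_KK_act) auto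
    then show ?thesis by (subst (asm) integrable_KK) auto
  qed
  have "N2 (\<lambda>y. Psi n \<alpha> w y - Psi n \<alpha> x y) = N2 (\<lambda>y. \<integral>z. (kk n w z - kk n x z) *\<^sub>R \<alpha> (act n (- y) z) \<partial>prodM M n)"
    by (rule arg_cong[of _ _ N2]) (auto simp: Psi_eq int scaleR_diff_left)
  also have "\<dots> \<le> ennreal ((ker_height ^ Suc n * (real (Suc n) * \<delta>))\<^sup>2) *
     (emeasure (prodM M n) (box n (r + 2)) * emeasure M (cball 0 (r + 2)) * xnorm2 M n (2 * (r + 2)) \<alpha>)"
  proof (rule orbit_average_le)
    show "0 \<le> ker_height ^ Suc n * (real (Suc n) * \<delta>)" using ker_height_pos \<delta>0 by simp
    fix z :: "nat \<Rightarrow> 'g" assume z: "z \<in> tup n"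
    show "\<bar>kk n w z - kk n x z\<bar> \<le> ker_height ^ Suc n * (real (Suc n) * \<delta>) * indicator (box n (r + 2)) z"
    proof (cases "z \<in> box n (r + 2)")
      case True
      have "(\<Sum>i\<le>n. dist (w i) (x i)) \<le> (\<Sum>i\<le>n. \<delta>)"
        using d by (intro sum_mono) (auto intro: less_imp_le)
      also have "\<dots> = real (Suc n) * \<delta>" by simp
      finally have "ker_height ^ Suc n * (\<Sum>i\<le>n. dist (w i) (x i)) \<le> ker_height ^ Suc n * (real (Suc n) * \<delta>)"
        using ker_height_pos by (intro mult_left_mono) auto
      then show ?thesis using kk_diff[of n w z x] True by simp
    next
      case False
      have "z \<notin> box n (r + 1)" "z \<notin> box n (r + 1 + 1)"
        using False subsetD[OF box_mono, of "r + 1" "r + 2" z n] subsetD[OF box_mono, of "r + 1 + 1" "r + 2" z n] by auto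
      then have "kk n x z \<le> 0" "kk n w z \<le> 0" using KK_close[OF x z] KK_close[OF wb z] by auto
      then have "kk n x z = 0" "kk n w z = 0" using kk_nonneg[of n x z] kk_nonneg[of n w z] by linarith+
      then show ?thesis using False by simp
    qed
  qed measurable
  finally show ?thesis .
qed

lemma open_coordinate_ball: "open {w :: nat \<Rightarrow> 'g. \<forall>i\<le>n. dist (w i) (x i) < \<delta>}"
proof -
  have "open (\<Inter>i\<in>{..n}. {w :: nat \<Rightarrow> 'g. dist (w i) (x i) < \<delta>})"
    by (intro open_INT ballI open_Collect_less continuous_intros continuous_on_product_coordinates) auto
  moreover have "(\<Inter>i\<in>{..n}. {w. dist (w i) (x i) < \<delta>}) = {w. \<forall>i\<le>n. dist (w i) (x i) < \<delta>}" by auto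
  ultimately show ?thesis by simp
qed

lemma Psi_ccochains:
  assumes a: "\<alpha> \<in> xcochains M n"
  shows "Psi n \<alpha> \<in> ccochains M n"
  unfolding ccochains_iff
proof (intro conjI ballI allI impI)
  note [measurable] = xcochainsD(2)[OF a]
  fix x :: "nat \<Rightarrow> 'g"
  show "x \<notin> tup n \<Longrightarrow> Psi n \<alpha> x = 0" by (simp add: Psi_def)
  assume x: "x \<in> tup n"
  have xm: "x \<in> space (prodM M n)" using x by simp
  show "Psi n \<alpha> x \<in> borel_measurable borel"
    using x xm by (simp add: Psi_def)
  obtain r where r: "r > 0" "x \<in> box n r" using tup_in_box[OF x] by blast
  show "N2 (Psi n \<alpha> x) < \<infinity>"
  proof (rule le_less_trans[OF N2_Psi_le[OF _ r(2)]])
    show "ennreal ((ker_height ^ Suc n)\<^sup>2) * (emeasure (prodM M n) (box n (r + 1)) * emeasure M (cball 0 (r + 1)) * xnorm2 M n (2 * (r + 1)) \<alpha>) < \<infinity>"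
      using emeasure_box_finite[of n "r + 1"] emeasure_cball_finite[of 0 "r + 1"] xcochainsD(3)[OF a, of "2 * (r + 1)"] r
      by (auto simp: ennreal_mult_less_top)
  qed simp
  show "AE y in M. Psi n \<alpha> (act n g x) y = Psi n \<alpha> x (- g + y)" for g
    using x by (simp add: Psi_def minus_add)
  fix e :: real assume e: "e > 0"
  let ?B = "emeasure (prodM M n) (box n (r + 2)) * emeasure M (cball 0 (r + 2)) * xnorm2 M n (2 * (r + 2)) \<alpha>"
  have "?B < \<infinity>"
    using emeasure_box_finite[of n "r + 2"] emeasure_cball_finite[of 0 "r + 2"] xcochainsD(3)[OF a, of "2 * (r + 2)"] r
    by (auto simp: ennreal_mult_less_top)
  then obtain B where B: "?B = ennreal B" "B \<ge> 0" by (cases ?B) auto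
  define k where "k = ker_height ^ Suc n * real (Suc n)"
  \<comment> \<open>The estimate is quadratic in \<open>\<delta>\<close>, hence at most linear once
    \<open>\<delta> \<le> 1\<close>; the summand 1 prevents division by zero.\<close>
  define \<delta> where "\<delta> = min 1 (e / (k\<^sup>2 * B + 1))"
  have p: "k\<^sup>2 * B + 1 > 0" using B by (simp add: add_nonneg_pos)
  then have \<delta>: "0 < \<delta>" "\<delta> \<le> 1" "\<delta> \<le> e / (k\<^sup>2 * B + 1)" using e by (auto simp: \<delta>_def)
  have small: "(k * \<delta>)\<^sup>2 * B < e"
  proof -
    have "(k * \<delta>)\<^sup>2 * B = (k\<^sup>2 * B) * (\<delta> * \<delta>)" by (simp add: power2_eq_square)
    also have "\<dots> \<le> (k\<^sup>2 * B) * (\<delta> * 1)" using \<delta> B by (intro mult_left_mono) auto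
    also have "\<dots> < (k\<^sup>2 * B + 1) * \<delta>" using \<delta> by (simp add: distrib_right)
    also have "\<dots> \<le> (k\<^sup>2 * B + 1) * (e / (k\<^sup>2 * B + 1))" using \<delta> p by (intro mult_left_mono) auto
    also have "\<dots> = e" using p by simp
    finally show ?thesis .
  qed
  show "\<exists>U. open U \<and> x \<in> U \<and> (\<forall>w\<in>U \<inter> tup n. N2 (\<lambda>y. Psi n \<alpha> w y - Psi n \<alpha> x y) < ennreal e)"
  proof (intro exI conjI ballI)
    show "open {w. \<forall>i\<le>n. dist (w i) (x i) < \<delta>}" by (rule open_coordinate_ball)
    show "x \<in> {w. \<forall>i\<le>n. dist (w i) (x i) < \<delta>}" using \<delta> by simp
    fix w assume w: "w \<in> {w. \<forall>i\<le>n. dist (w i) (x i) < \<delta>} \<inter> tup n"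
    have "N2 (\<lambda>y. Psi n \<alpha> w y - Psi n \<alpha> x y) \<le> ennreal ((ker_height ^ Suc n * (real (Suc n) * \<delta>))\<^sup>2) * ?B"
      by (rule N2_Psi_diff_le[OF a r(2)]) (use w \<delta> in auto)
    also have "\<dots> = ennreal ((k * \<delta>)\<^sup>2 * B)" using B by (simp add: k_def ennreal_mult mult.assoc del: power_Suc of_nat_Suc)
    also have "\<dots> < ennreal e" using small e by (simp add: ennreal_less_iff B)
    finally show "N2 (\<lambda>y. Psi n \<alpha> w y - Psi n \<alpha> x y) < ennreal e" .
  qed
qed

section \<open>Smoothing as a map of complexes\<close>

lemma ver_Psi:
  assumes a: "\<alpha> \<in> xcochains M n"
  shows "ver n (Psi n \<alpha>) (smooth n \<alpha>)"
proof -
  note [measurable] = xcochainsD(2)[OF a]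
  have "smooth n \<alpha> \<in> borel_measurable (prodM M n)" by measurable
  then show ?thesis by (auto simp: ver_def Psi_def smooth_def)
qed

lemma smooth_xcochains: "\<alpha> \<in> xcochains M n \<Longrightarrow> smooth n \<alpha> \<in> xcochains M n"
  using ver_xcochains[OF Psi_ccochains ver_Psi] .

lemma smooth_add:
  assumes "\<alpha> \<in> xcochains M n" "\<beta> \<in> xcochains M n"
  shows "smooth n (\<alpha> + \<beta>) x = smooth n \<alpha> x + smooth n \<beta> x"
  using assms by (simp add: smooth_def xcochains_integrable_KK)

lemma smooth_diff:
  assumes "\<alpha> \<in> xcochains M n" "\<beta> \<in> xcochains M n"
  shows "smooth n (\<alpha> - \<beta>) x = smooth n \<alpha> x - smooth n \<beta> x"
  using assms by (simp add: smooth_def xcochains_integrable_KK)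

lemma Psi_add:
  assumes "\<alpha> \<in> xcochains M n" "\<beta> \<in> xcochains M n"
  shows "Psi n (\<alpha> + \<beta>) = Psi n \<alpha> + Psi n \<beta>"
  using smooth_add[OF assms] by (auto simp: Psi_def fun_eq_iff)

lemma Psi_diff:
  assumes "\<alpha> \<in> xcochains M n" "\<beta> \<in> xcochains M n"
  shows "Psi n (\<alpha> - \<beta>) = Psi n \<alpha> - Psi n \<beta>"
  using smooth_diff[OF assms] by (auto simp: Psi_def fun_eq_iff)

lemma smooth_cong_AE:
  assumes [measurable]: "\<alpha> \<in> borel_measurable (prodM M n)" "\<beta> \<in> borel_measurable (prodM M n)"
    and "AE z in prodM M n. \<alpha> z = \<beta> z"
  shows "smooth n \<alpha> x = smooth n \<beta> x"
proof (cases "x \<in> tup n")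
  case True
  from AE_KK[OF this assms(3)] show ?thesis
    using True by (auto simp: smooth_def intro!: integral_cong_AE)
qed (simp add: smooth_def)

lemma smooth_zero_AE:
  assumes [measurable]: "\<alpha> \<in> borel_measurable (prodM M n)" and "AE z in prodM M n. \<alpha> z = 0"
  shows "smooth n \<alpha> x = 0"
proof -
  have "smooth n \<alpha> x = smooth n (\<lambda>_. 0) x" using assms by (intro smooth_cong_AE) auto
  then show ?thesis by (simp add: smooth_def)
qed

lemma smooth_xd:
  assumes a: "\<alpha> \<in> xcochains M n"
  shows "smooth (Suc n) (xd n \<alpha>) x = xd n (smooth n \<alpha>) x"
proof (cases "x \<in> tup (Suc n)")
  case True
  note [measurable] = xcochainsD(2)[OF a]
  have int: "integrable (KK (Suc n) x) (\<lambda>z. (-1)^i * \<alpha> (face (Suc n) i z))" for i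
    using xcochains_integrable_KK[OF a, of "face (Suc n) i x"] by (simp add: integrable_KK_face)
  have "smooth (Suc n) (xd n \<alpha>) x = (\<integral>z. (\<Sum>i\<le>Suc n. (-1)^i * \<alpha> (face (Suc n) i z)) \<partial>KK (Suc n) x)"
    using True unfolding smooth_def by (auto simp: xd_def simp del: sum.atMost_Suc intro!: Bochner_Integration.integral_cong)
  also have "\<dots> = (\<Sum>i\<le>Suc n. \<integral>z. (-1)^i * \<alpha> (face (Suc n) i z) \<partial>KK (Suc n) x)"
    by (rule Bochner_Integration.integral_sum[OF int])
  also have "\<dots> = xd n (smooth n \<alpha>) x"
    using True by (simp add: xd_def smooth_def integral_KK_face del: sum.atMost_Suc)
  finally show ?thesis .
qed (simp add: smooth_def xd_def)

lemma Psi_xd: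
  assumes a: "\<alpha> \<in> xcochains M n" and x: "x \<in> tup (Suc n)"
  shows "Psi (Suc n) (xd n \<alpha>) x y = cd n (Psi n \<alpha>) x y"
proof -
  have "Psi (Suc n) (xd n \<alpha>) x y = xd n (smooth n \<alpha>) (act (Suc n) (- y) x)"
    using x by (simp add: Psi_def smooth_xd[OF a])
  also have "\<dots> = cd n (Psi n \<alpha>) x y"
    using x by (simp add: cd_def xd_def Psi_def del: sum.atMost_Suc)
  finally show ?thesis .
qed

lemma Psi_cZ:
  assumes a: "\<alpha> \<in> xZ M n"
  shows "Psi n \<alpha> \<in> cZ M n"
proof -
  have ac: "\<alpha> \<in> xcochains M n" and z: "AE x in prodM M (Suc n). xd n \<alpha> x = 0" using a by (auto simp: xZ_def)
  note [measurable] = xcochainsD(2)[OF ac]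
  have "cd n (Psi n \<alpha>) x y = 0" if x: "x \<in> tup (Suc n)" for x y
  proof -
    have "smooth (Suc n) (xd n \<alpha>) w = 0" for w by (rule smooth_zero_AE[OF _ z]) measurable
    then show ?thesis unfolding Psi_xd[OF ac x, symmetric] using x by (simp add: Psi_def)
  qed
  then show ?thesis using Psi_ccochains[OF ac] by (auto simp: cZ_def)
qed

lemma Psi_cB:
  assumes a: "\<alpha> \<in> xB M n"
  shows "Psi n \<alpha> \<in> cB M n"
proof (cases n)
  case 0
  have ac: "\<alpha> \<in> xcochains M n" and z: "AE x in prodM M n. \<alpha> x = 0" using a 0 by (auto simp: xB_iff)
  have "smooth n \<alpha> w = 0" for w by (rule smooth_zero_AE[OF xcochainsD(2)[OF ac] z])
  then have "Psi n \<alpha> x y = 0" for x y by (simp add: Psi_def)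
  then show ?thesis using Psi_ccochains[OF ac] 0 by (auto simp: cB_def)
next
  case (Suc m)
  then obtain b where ac: "\<alpha> \<in> xcochains M n" and b: "b \<in> xcochains M m" and ae: "AE x in prodM M n. \<alpha> x = xd m b x"
    using a by (auto simp: xB_iff)
  note [measurable] = xcochainsD(2)[OF b]
  have "xd m b \<in> borel_measurable (prodM M n)" unfolding Suc by measurable
  from smooth_cong_AE[OF xcochainsD(2)[OF ac] this ae]
  have "Psi n \<alpha> x y = Psi n (xd m b) x y" for x y by (simp add: Psi_def)
  then have "Psi n \<alpha> x y = cd m (Psi m b) x y" if "x \<in> tup n" for x y
    using Psi_xd[OF b, of x y] that Suc by simp
  then show ?thesis using Psi_ccochains[OF ac] Psi_ccochains[OF b] Suc by (auto simp: cB_def)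
qed

lemma compact_subset_box:
  assumes K: "compact K" "K \<subseteq> tup n"
  obtains r where "r > 0" "K \<subseteq> box n r"
proof -
  have "bounded ((\<lambda>x. x i) ` K)" for i
    by (intro compact_imp_bounded compact_continuous_image K
      continuous_on_subset[OF continuous_on_product_coordinates subset_UNIV])
  then have "\<forall>i. \<exists>b. \<forall>x\<in>K. dist 0 (x i) \<le> b" by (auto simp: bounded_any_center[where a=0])
  from choice[OF this] obtain b where b: "\<And>i x. x \<in> K \<Longrightarrow> dist 0 (x i) \<le> b i" by blast
  show ?thesis
  proof (rule that[of "1 + (\<Sum>i\<le>n. \<bar>b i\<bar>)"])
    show "1 + (\<Sum>i\<le>n. \<bar>b i\<bar>) > 0" by (intro add_pos_nonneg sum_nonneg) auto
    show "K \<subseteq> box n (1 + (\<Sum>i\<le>n. \<bar>b i\<bar>))"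
    proof
      fix x assume x: "x \<in> K"
      have "dist 0 (x i) \<le> 1 + (\<Sum>i\<le>n. \<bar>b i\<bar>)" if "i \<le> n" for i
        using member_le_sum[of i "{..n}" "\<lambda>i. \<bar>b i\<bar>"] that b[OF x, of i] by auto
      then show "x \<in> box n (1 + (\<Sum>i\<le>n. \<bar>b i\<bar>))" using x K by (auto simp: mem_box_iff)
    qed
  qed
qed

text \<open>On a compact set, which lies in a box, \<open>N2_Psi_le\<close> bounds all values of
  \<open>Psi n \<alpha>\<close> by one seminorm of \<open>\<alpha>\<close>; so approximating
  coboundaries are carried to approximating coboundaries.\<close>

lemma Psi_cBcl:
  assumes a: "\<alpha> \<in> xBcl M n"
  shows "Psi n \<alpha> \<in> cBcl M n"
proof -
  have ac: "\<alpha> \<in> xcochains M n" using a by (auto simp: xBcl_def)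
  have "\<exists>b\<in>cB M n. \<forall>x\<in>K. N2 (\<lambda>y. Psi n \<alpha> x y - b x y) < ennreal e"
    if K: "compact K" "K \<subseteq> tup n" and e: "e > 0" for K e
  proof -
    obtain r where r: "r > 0" "K \<subseteq> box n r" using compact_subset_box[OF K] by blast
    let ?C = "ennreal ((ker_height ^ Suc n)\<^sup>2) * (emeasure (prodM M n) (box n (r + 1)) * emeasure M (cball 0 (r + 1)))"
    have "?C < \<infinity>"
      using emeasure_box_finite[of n "r + 1"] emeasure_cball_finite[of 0 "r + 1"] by (auto simp: ennreal_mult_less_top)
    then obtain C where C: "?C = ennreal C" "C \<ge> 0" by (cases ?C) auto
    obtain b where b: "b \<in> xB M n" "xnorm2 M n (2 * (r + 1)) (\<alpha> - b) < ennreal (e / (C + 1))"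
      using xBclD[OF a, of "2 * (r + 1)" "e / (C + 1)"] r e C by auto
    have bc: "b \<in> xcochains M n" using b by (auto simp: xB_iff)
    have d: "\<alpha> - b \<in> xcochains M n" by (rule add_closedD(4)[OF xcochains_add_closed ac bc])
    show ?thesis
    proof (intro bexI ballI)
      show "Psi n b \<in> cB M n" by (rule Psi_cB[OF b(1)])
      fix x assume "x \<in> K"
      then have "x \<in> box n r" using r by blast
      from N2_Psi_le[OF xcochainsD(2)[OF d] this]
      have "N2 (Psi n (\<alpha> - b) x) \<le> ?C * xnorm2 M n (2 * (r + 1)) (\<alpha> - b)" by (simp only: mult.assoc)
      also have "\<dots> \<le> ennreal C * ennreal (e / (C + 1))"
        unfolding C(1) using b by (intro mult_left_mono) auto
      also have "\<dots> = ennreal (C * (e / (C + 1)))" using C e by (simp add: ennreal_mult[symmetric])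
      also have "\<dots> < ennreal e" using C e by (intro ennreal_lessI) (auto simp: field_simps)
      finally show "N2 (\<lambda>y. Psi n \<alpha> x y - Psi n b x y) < ennreal e"
        unfolding Psi_diff[OF ac bc] by (simp only: fun_diff_def)
    qed
  qed
  then show ?thesis using Psi_ccochains[OF ac] unfolding cBcl_iff by blast
qed

subsection \<open>The homotopy\<close>

text \<open>For coarse \<open>\<alpha>\<close> the integrals are only known to exist for almost
  every \<open>x\<close> (\<open>AE_mix_integrable\<close>); where they do not, the default value 0
  is taken.\<close>

definition hmt :: "nat \<Rightarrow> ((nat \<Rightarrow> 'g) \<Rightarrow> complex) \<Rightarrow> (nat \<Rightarrow> 'g) \<Rightarrow> complex" where
  "hmt m \<alpha> x = (if x \<in> tup m then \<Sum>i\<le>m. (-1) ^ i * (\<integral>z. \<alpha> (mix m i x z) \<partial>KK m x) else 0)"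

lemma mix_measurable_right [measurable]:
  assumes "x \<in> tup m" "i \<le> m"
  shows "mix m i x \<in> measurable (prodM M m) (prodM M (Suc m))"
  by (rule mix_measurable[of "\<lambda>_. x" "prodM M m" m "\<lambda>z. z" i]) (use assms in \<open>simp_all add: measurable_ident_sets\<close>)

lemma hmt_measurable [measurable (raw)]:
  assumes [measurable]: "\<alpha> \<in> borel_measurable (prodM M (Suc m))" "x \<in> measurable N (prodM M m)"
  shows "(\<lambda>w. hmt m \<alpha> (x w)) \<in> borel_measurable N"
proof -
  have "(\<lambda>w. \<integral>z. \<alpha> (mix m i (x w) z) \<partial>KK m (x w)) \<in> borel_measurable N" if [measurable]: "i \<le> m" for i
    by measurable
  then have "(\<lambda>w. \<Sum>i\<le>m. (-1) ^ i * (\<integral>z. \<alpha> (mix m i (x w) z) \<partial>KK m (x w))) \<in> borel_measurable N"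
    by (intro borel_measurable_sum borel_measurable_times) auto
  moreover have "x w \<in> tup m" if "w \<in> space N" for w
    using measurable_space[OF assms(2) that] by simp
  ultimately show ?thesis by (subst measurable_cong) (auto simp: hmt_def)
qed

text \<open>Degree 0 has no homotopy term: the cocycle condition says that \<open>\<alpha>\<close>
  is constant, equal to \<open>\<alpha> x\<close>, almost everywhere for the averaging
  measure.\<close>

lemma smooth_eq_0:
  assumes [measurable]: "\<alpha> \<in> borel_measurable (prodM M 0)" and x [simp]: "x \<in> tup 0"
    and int: "integrable (KK 0 x) \<alpha>"
    and cocycle: "AE z in KK 0 x. xd 0 \<alpha> (mix 0 0 x z) = 0"
  shows "smooth 0 \<alpha> x = \<alpha> x"
proof -
  have "AE z in KK 0 x. \<alpha> z = \<alpha> x"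
    using cocycle AE_space[of "KK 0 x"]
  proof eventually_elim
    fix z assume c: "xd 0 \<alpha> (mix 0 0 x z) = 0" and "z \<in> space (KK 0 x)"
    then have "\<alpha> z - \<alpha> x = xd 0 \<alpha> (mix 0 0 x z)" using prism_identity[of x 0 z \<alpha>] by simp
    then show "\<alpha> z = \<alpha> x" using c by simp
  qed
  then have "(\<integral>z. \<alpha> z \<partial>KK 0 x) = (\<integral>z. \<alpha> x \<partial>KK 0 x)" by (intro integral_cong_AE) auto
  then show ?thesis using KK.prob_space[of 0 x] by (simp add: smooth_def)
qed

text \<open>Integrating \<open>prism_identity\<close> over \<open>z\<close> removes the differential
  terms, and the marginals turn the remaining ones into \<open>hmt\<close> at the faces of
  \<open>x\<close>. It is stated at a single \<open>x\<close>, with integrability as hypotheses,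
  because these are supplied for almost every tuple in the coarse case and for almost every point of
  each orbit in the continuous case.\<close>

lemma smooth_homotopy:
  assumes [measurable]: "\<alpha> \<in> borel_measurable (prodM M (Suc m))" and x [simp]: "x \<in> tup (Suc m)"
    and int: "integrable (KK (Suc m) x) \<alpha>"
    and cocycle: "\<And>i. i \<le> Suc m \<Longrightarrow> AE z in KK (Suc m) x. xd (Suc m) \<alpha> (mix (Suc m) i x z) = 0"
    and intm: "\<And>i j. i \<le> m \<Longrightarrow> j \<le> Suc m \<Longrightarrow> integrable (KK m (face (Suc m) j x)) (\<lambda>z. \<alpha> (mix m i (face (Suc m) j x) z))"
  shows "smooth (Suc m) \<alpha> x - \<alpha> x = xd m (hmt m \<alpha>) x"
proof -
  let ?f = "\<lambda>j. face (Suc m) j :: (nat \<Rightarrow> 'g) \<Rightarrow> _"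
  have ms: "(\<lambda>z. \<alpha> (mix m i (?f j x) z)) \<in> borel_measurable (prodM M m)" if "i \<le> m" for i j
    using that by measurable
  have int': "integrable (KK (Suc m) x) (\<lambda>z. \<alpha> (mix m i (?f j x) (?f j z)))" if "i \<le> m" "j \<le> Suc m" for i j
    using integrable_KK_face[where x=x and i=j, OF ms[OF that(1), of j]] intm[OF that] by simp
  have ii: "integrable (KK (Suc m) x) (\<lambda>z. (-1) ^ j * (\<Sum>i\<le>m. (-1) ^ i * \<alpha> (mix m i (?f j x) (?f j z))))"
    if "j \<in> {..Suc m}" for j
    using that by (intro integrable_mult_right Bochner_Integration.integrable_sum int') auto
  have "AE z in KK (Suc m) x. \<forall>i\<in>{..Suc m}. xd (Suc m) \<alpha> (mix (Suc m) i x z) = 0"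
    using cocycle by (intro AE_finite_allI) auto
  with AE_space[of "KK (Suc m) x"]
  have ae: "AE z in KK (Suc m) x. \<alpha> z - \<alpha> x = (\<Sum>j\<le>Suc m. (-1) ^ j * (\<Sum>i\<le>m. (-1) ^ i * \<alpha> (mix m i (?f j x) (?f j z))))"
    by eventually_elim
      (use prism_identity[of x "Suc m" _ \<alpha>] in \<open>simp add: lessThan_Suc_atMost del: sum.atMost_Suc\<close>)
  have "smooth (Suc m) \<alpha> x - \<alpha> x = (\<integral>z. \<alpha> z - \<alpha> x \<partial>KK (Suc m) x)"
    using int KK.prob_space[of "Suc m" x] by (simp add: smooth_def)
  also have "\<dots> = (\<integral>z. (\<Sum>j\<le>Suc m. (-1) ^ j * (\<Sum>i\<le>m. (-1) ^ i * \<alpha> (mix m i (?f j x) (?f j z)))) \<partial>KK (Suc m) x)"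
  proof (rule integral_cong_AE[OF _ _ ae])
    show "(\<lambda>z. \<Sum>j\<le>Suc m. (-1) ^ j * (\<Sum>i\<le>m. (-1) ^ i * \<alpha> (mix m i (?f j x) (?f j z)))) \<in> borel_measurable (KK (Suc m) x)"
      using ii by (intro borel_measurable_sum borel_measurable_integrable)
  qed measurable
  also have "\<dots> = (\<Sum>j\<le>Suc m. \<integral>z. (-1) ^ j * (\<Sum>i\<le>m. (-1) ^ i * \<alpha> (mix m i (?f j x) (?f j z))) \<partial>KK (Suc m) x)"
    by (rule Bochner_Integration.integral_sum[OF ii])
  also have "\<dots> = (\<Sum>j\<le>Suc m. (-1) ^ j * (\<Sum>i\<le>m. (-1) ^ i * (\<integral>z. \<alpha> (mix m i (?f j x) z) \<partial>KK m (?f j x))))"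
  proof (rule sum.cong[OF refl])
    fix j assume j: "j \<in> {..Suc m}"
    have "(\<integral>z. (\<Sum>i\<le>m. (-1) ^ i * \<alpha> (mix m i (?f j x) (?f j z))) \<partial>KK (Suc m) x)
        = (\<Sum>i\<le>m. \<integral>z. (-1) ^ i * \<alpha> (mix m i (?f j x) (?f j z)) \<partial>KK (Suc m) x)"
      using j by (intro Bochner_Integration.integral_sum integrable_mult_right int') auto
    also have "\<dots> = (\<Sum>i\<le>m. (-1) ^ i * (\<integral>z. \<alpha> (mix m i (?f j x) z) \<partial>KK m (?f j x)))"
      using integral_KK_face[where x=x and i=j, OF ms] by (intro sum.cong) auto
    finally show "(\<integral>z. (-1) ^ j * (\<Sum>i\<le>m. (-1) ^ i * \<alpha> (mix m i (?f j x) (?f j z))) \<partial>KK (Suc m) x)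
      = (-1) ^ j * (\<Sum>i\<le>m. (-1) ^ i * (\<integral>z. \<alpha> (mix m i (?f j x) z) \<partial>KK m (?f j x)))"
      by simp
  qed
  also have "\<dots> = xd m (hmt m \<alpha>) x"
    by (simp add: xd_def hmt_def del: sum.atMost_Suc)
  finally show ?thesis .
qed

subsubsection \<open>Coarse cochains\<close>

lemma xcochains_mix_finite:
  assumes a: "\<alpha> \<in> xcochains M (Suc m)" and i: "i \<le> m" and R: "R > 0"
  shows "(\<integral>\<^sup>+x. indicator (GR m R) x * (\<integral>\<^sup>+z. ennreal ((cmod (\<alpha> (mix m i x z)))\<^sup>2) \<partial>KK m x) \<partial>prodM M m) < \<infinity>"
proof -
  note [measurable] = xcochainsD(2)[OF a]
  obtain C where "C < \<infinity>" and C: "\<forall>F\<in>borel_measurable (prodM M (Suc m)).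
     (\<integral>\<^sup>+x. indicator (GR m R) x * (\<integral>\<^sup>+z. F (mix m i x z) \<partial>KK m x) \<partial>prodM M m)
       \<le> C * (\<integral>\<^sup>+z. indicator (GR (Suc m) (2 * (2 + R))) z * F z \<partial>prodM M (Suc m))"
    using nn_integral_GR_mix[OF R i] by auto
  have "(\<lambda>w. ennreal ((cmod (\<alpha> w))\<^sup>2)) \<in> borel_measurable (prodM M (Suc m))" by measurable
  from C[rule_format, OF this] have "(\<integral>\<^sup>+x. indicator (GR m R) x * (\<integral>\<^sup>+z. ennreal ((cmod (\<alpha> (mix m i x z)))\<^sup>2) \<partial>KK m x) \<partial>prodM M m)
      \<le> C * xnorm2 M (Suc m) (2 * (2 + R)) \<alpha>" by (simp add: xnorm2_def)
  also have "\<dots> < \<infinity>"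
    using \<open>C < \<infinity>\<close> xcochainsD(3)[OF a, of "2 * (2 + R)"] R by (auto simp: ennreal_mult_less_top)
  finally show ?thesis .
qed

lemma hmt_xcochains:
  assumes a: "\<alpha> \<in> xcochains M (Suc m)"
  shows "hmt m \<alpha> \<in> xcochains M m"
proof -
  note [measurable] = xcochainsD(2)[OF a]
  have "xnorm2 M m R (hmt m \<alpha>) < \<infinity>" if R: "R > 0" for R
  proof -
    let ?Q = "\<lambda>i x. \<integral>\<^sup>+z. ennreal ((cmod (\<alpha> (mix m i x z)))\<^sup>2) \<partial>KK m x"
    have Qm: "(\<lambda>x. indicator (GR m R) x * ?Q i x) \<in> borel_measurable (prodM M m)" if [measurable]: "i \<le> m" for i
      by measurable
    have "xnorm2 M m R (hmt m \<alpha>) \<le> (\<integral>\<^sup>+x. of_nat (Suc m) * (\<Sum>i\<le>m. indicator (GR m R) x * ?Q i x) \<partial>prodM M m)"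
      unfolding xnorm2_def
    proof (rule nn_integral_mono)
      fix x assume "x \<in> space (prodM M m)"
      then have x: "x \<in> tup m" by simp
      have "(cmod (hmt m \<alpha> x))\<^sup>2 \<le> real (Suc m) * (\<Sum>i\<le>m. (cmod (\<integral>z. \<alpha> (mix m i x z) \<partial>KK m x))\<^sup>2)"
        using cmod_sum_square_le[of "{..m}" "\<lambda>i. (-1) ^ i * (\<integral>z. \<alpha> (mix m i x z) \<partial>KK m x)"] x
        by (simp add: hmt_def norm_mult norm_power)
      then have "ennreal ((cmod (hmt m \<alpha> x))\<^sup>2) \<le> ennreal (real (Suc m) * (\<Sum>i\<le>m. (cmod (\<integral>z. \<alpha> (mix m i x z) \<partial>KK m x))\<^sup>2))"
        by (rule ennreal_leI)
      also have "\<dots> = of_nat (Suc m) * (\<Sum>i\<le>m. ennreal ((cmod (\<integral>z. \<alpha> (mix m i x z) \<partial>KK m x))\<^sup>2))"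
        by (simp add: ennreal_mult sum_nonneg sum_ennreal ennreal_of_nat_eq_real_of_nat del: of_nat_Suc)
      also have "\<dots> \<le> of_nat (Suc m) * (\<Sum>i\<le>m. ?Q i x)"
      proof (intro mult_left_mono sum_mono norm_integral_square_le KK.prob_space_axioms)
        fix i assume "i \<in> {..m}"
        then show "(\<lambda>z. \<alpha> (mix m i x z)) \<in> borel_measurable (KK m x)" using x by simp
      qed simp
      finally show "indicator (GR m R) x * ennreal ((cmod (hmt m \<alpha> x))\<^sup>2) \<le> of_nat (Suc m) * (\<Sum>i\<le>m. indicator (GR m R) x * ?Q i x)"
        by (auto simp: indicator_def simp del: of_nat_Suc)
    qed
    also have "\<dots> = of_nat (Suc m) * (\<Sum>i\<le>m. \<integral>\<^sup>+x. indicator (GR m R) x * ?Q i x \<partial>prodM M m)"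
    proof (subst nn_integral_cmult)
      show "(\<lambda>x. \<Sum>i\<le>m. indicator (GR m R) x * ?Q i x) \<in> borel_measurable (prodM M m)"
        using Qm by (intro borel_measurable_sum) auto
      show "of_nat (Suc m) * (\<integral>\<^sup>+x. (\<Sum>i\<le>m. indicator (GR m R) x * ?Q i x) \<partial>prodM M m)
        = of_nat (Suc m) * (\<Sum>i\<le>m. \<integral>\<^sup>+x. indicator (GR m R) x * ?Q i x \<partial>prodM M m)"
        using Qm by (subst nn_integral_sum) auto
    qed
    also have "\<dots> < \<infinity>"
    proof -
      have "(\<Sum>i\<le>m. \<integral>\<^sup>+x. indicator (GR m R) x * ?Q i x \<partial>prodM M m) < \<infinity>"
        unfolding infinity_ennreal_def
        by (subst ennreal_sum_less_top) (use xcochains_mix_finite[OF a _ R] in auto)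
      then show ?thesis by (simp add: ennreal_mult_less_top of_nat_less_top del: of_nat_Suc)
    qed
    finally show ?thesis .
  qed
  then show ?thesis by (auto simp: xcochains_def hmt_def)
qed

lemma AE_mix_integrable:
  assumes a: "\<alpha> \<in> xcochains M (Suc m)" and i: "i \<le> m"
  shows "AE x in prodM M m. integrable (KK m x) (\<lambda>z. \<alpha> (mix m i x z))"
proof -
  note [measurable] = xcochainsD(2)[OF a] i
  let ?Q = "\<lambda>x. \<integral>\<^sup>+z. ennreal ((cmod (\<alpha> (mix m i x z)))\<^sup>2) \<partial>KK m x"
  have "AE x in prodM M m. ?Q x < \<infinity>"
  proof (rule AE_GRI)
    fix R :: real assume R: "R > 0"
    have "AE x in prodM M m. indicator (GR m R) x * ?Q x \<noteq> \<infinity>"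
      by (rule nn_integral_PInf_AE) (use xcochains_mix_finite[OF a i R] in auto)
    then show "AE x in prodM M m. x \<in> GR m R \<longrightarrow> ?Q x < \<infinity>"
      by eventually_elim (auto simp: less_top)
  qed
  with AE_space show ?thesis
    by eventually_elim (use i in \<open>auto intro!: KK_integrableI\<close>)
qed

lemma smooth_minus_xB:
  assumes a: "\<alpha> \<in> xZ M n"
  shows "smooth n \<alpha> - \<alpha> \<in> xB M n"
proof -
  have ac: "\<alpha> \<in> xcochains M n" and z: "AE x in prodM M (Suc n). xd n \<alpha> x = 0" using a by (auto simp: xZ_def)
  note [measurable] = xcochainsD(2)[OF ac]
  have dc: "smooth n \<alpha> - \<alpha> \<in> xcochains M n"
    by (rule add_closedD(4)[OF xcochains_add_closed smooth_xcochains[OF ac] ac])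
  \<comment> \<open>The cocycle condition, known almost everywhere on tuples of the next degree, is
    pulled back to prisms and then passed on to the absolutely continuous averaging measure.\<close>
  have "AE x in prodM M n. \<forall>i\<in>{..n}. AE z in prodM M n. xd n \<alpha> (mix n i x z) = 0"
    using AE_mix[OF z] by (intro AE_finite_allI) auto
  with AE_space have cocycle: "AE x in prodM M n. \<forall>i\<in>{..n}. AE z in KK n x. xd n \<alpha> (mix n i x z) = 0"
    by eventually_elim (auto intro: AE_KK)
  show ?thesis
  proof (cases n)
    case 0
    from AE_space cocycle have "AE x in prodM M n. (smooth n \<alpha> - \<alpha>) x = 0"
      by eventually_elim (use ac 0 in \<open>auto intro!: smooth_eq_0 xcochainsD xcochains_integrable_KK\<close>)
    then show ?thesis using 0 dc by (auto simp: xB_iff)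
  next
    case (Suc m)
    have ac': "\<alpha> \<in> xcochains M (Suc m)" using ac Suc by simp
    have "AE x in prodM M m. \<forall>i\<in>{..m}. integrable (KK m x) (\<lambda>z. \<alpha> (mix m i x z))"
      using AE_mix_integrable[OF ac'] by (intro AE_finite_allI) auto
    \<comment> \<open>Integrability at almost every tuple of degree \<open>m\<close> has to hold at
      all faces of almost every tuple of degree \<open>n\<close>.\<close>
    from AE_face[OF this] have ae: "AE x in prodM M n. \<forall>i\<in>{..m}. integrable (KK m (face (Suc m) j x)) (\<lambda>z. \<alpha> (mix m i (face (Suc m) j x) z))" for j
      unfolding Suc .
    have "AE x in prodM M n. \<forall>j\<in>{..Suc m}. \<forall>i\<in>{..m}. integrable (KK m (face (Suc m) j x)) (\<lambda>z. \<alpha> (mix m i (face (Suc m) j x) z))"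
      by (rule AE_finite_allI, rule finite_atMost, rule ae)
    with AE_space cocycle have "AE x in prodM M n. (smooth n \<alpha> - \<alpha>) x = xd m (hmt m \<alpha>) x"
    proof eventually_elim
      fix x assume "x \<in> space (prodM M n)" "\<forall>i\<in>{..n}. AE z in KK n x. xd n \<alpha> (mix n i x z) = 0"
        "\<forall>j\<in>{..Suc m}. \<forall>i\<in>{..m}. integrable (KK m (face (Suc m) j x)) (\<lambda>z. \<alpha> (mix m i (face (Suc m) j x) z))"
      then have "smooth (Suc m) \<alpha> x - \<alpha> x = xd m (hmt m \<alpha>) x"
        using Suc by (intro smooth_homotopy[OF xcochainsD(2)[OF ac']] xcochains_integrable_KK[OF ac']) auto
      then show "(smooth n \<alpha> - \<alpha>) x = xd m (hmt m \<alpha>) x" using Suc by simp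
    qed
    then show ?thesis using Suc dc hmt_xcochains[OF ac'] by (auto simp: xB_iff)
  qed
qed

subsubsection \<open>Continuous cochains\<close>

definition orig :: "nat \<Rightarrow> nat \<Rightarrow> 'g" where
  "orig m = restrict (\<lambda>_. 0) {..m}"

lemma orig_tup [simp]: "orig m \<in> tup m"
  by (simp add: orig_def)

lemma tmul_orig: "x \<in> tup m \<Longrightarrow> tmul m x (orig m) = x"
  by (rule tup_eqI[of _ m]) (auto simp: tmul_apply orig_def)

lemma KK_orig: "x \<in> tup m \<Longrightarrow> KK m x = distr (KK m (orig m)) (prodM M m) (tmul m x)"
  by (simp add: distr_KK_tmul tmul_orig)

text \<open>Writing \<open>z = x u\<close> in \<open>mix m i x z\<close> turns the averages over the varying measures \<open>KK m x\<close> into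
  averages over a single measure, so that continuity of \<open>f\<close> is all that is needed.\<close>
definition mixt :: "nat \<Rightarrow> nat \<Rightarrow> (nat \<Rightarrow> 'g) \<Rightarrow> (nat \<Rightarrow> 'g) \<Rightarrow> (nat \<Rightarrow> 'g)" where
  "mixt m i x u = mix m i x (tmul m x u)"

lemma mixt_tup [simp, intro]: "mixt m i x u \<in> tup (Suc m)"
  by (simp add: mixt_def)

lemma mixt_act: "i \<le> m \<Longrightarrow> mixt m i (act m g x) u = act (Suc m) g (mixt m i x u)"
proof -
  have "tmul m (act m g x) u = act m g (tmul m x u)"
    by (rule tup_eqI[of _ m]) (auto simp: tmul_apply act_apply add.assoc)
  then show "i \<le> m \<Longrightarrow> ?thesis" by (simp add: mixt_def mix_act)
qed

lemma mixt_measurable [measurable (raw)]: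
  assumes "x \<in> tup m" "i \<le> m" "u \<in> measurable N (prodM M m)"
  shows "(\<lambda>w. mixt m i x (u w)) \<in> measurable N (prodM M (Suc m))"
proof -
  note [measurable] = assms(2,3)
  have [measurable]: "x \<in> space (prodM M m)" using assms by simp
  show ?thesis unfolding mixt_def by measurable
qed

lemma mixt_continuous: "i \<le> m \<Longrightarrow> continuous_on UNIV (\<lambda>p. mixt m i (fst p) (snd p))"
proof (rule continuous_on_coordinatewise_then_product)
  fix j assume i: "i \<le> m"
  have c: "continuous_on UNIV (\<lambda>p::(nat \<Rightarrow> 'g) \<times> (nat \<Rightarrow> 'g). fst p k)" "continuous_on UNIV (\<lambda>p::(nat \<Rightarrow> 'g) \<times> (nat \<Rightarrow> 'g). snd p k)" for k
    by (rule continuous_on_compose2[OF continuous_on_product_coordinates _ subset_UNIV], intro continuous_intros)+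
  have s: "continuous_on UNIV (\<lambda>p::(nat \<Rightarrow> 'g) \<times> (nat \<Rightarrow> 'g). fst p k + snd p k)" for k
    using continuous_on_compose2[OF mult_cont continuous_on_Pair[OF c(1)[of k] c(2)[of k]]] by simp
  consider "j \<le> i" | "i < j" "j \<le> Suc m" | "Suc m < j" by linarith
  then show "continuous_on UNIV (\<lambda>p. mixt m i (fst p) (snd p) j)"
  proof cases
    case 1
    then show ?thesis using i c(1)[of j] by (simp add: mixt_def mix_def)
  next
    case 2
    then have "j - 1 \<le> m" by simp
    then show ?thesis using 2 s[of "j - 1"] by (simp add: mixt_def mix_def tmul_def)
  next
    case 3
    then show ?thesis by (simp add: mixt_def mix_def)
  qed
qed

text \<open>Each point (x, u) with \<open>u\<close> in \<open>D\<close> is interior to the set where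
  the estimate holds, since nearby values are compared with the one at (x, u). The tube lemma then
  gives a neighbourhood of \<open>x\<close> valid for all of \<open>D\<close>.\<close>

lemma ccochains_uniform:
  assumes f: "f \<in> ccochains M n" and \<phi>: "continuous_on UNIV (\<lambda>p. \<phi> (fst p) (snd p))"
    and tup: "\<And>w u. \<phi> w u \<in> tup n" and D: "compact D" and e: "e > 0"
  obtains U where "open U" "x \<in> U" "\<And>w u. w \<in> U \<Longrightarrow> u \<in> D \<Longrightarrow> N2 (\<lambda>y. f (\<phi> w u) y - f (\<phi> x u) y) < ennreal e"
proof -
  note [measurable] = ccochainsD(2)[OF f]
  let ?W = "{p. N2 (\<lambda>y. f (\<phi> (fst p) (snd p)) y - f (\<phi> x (snd p)) y) < ennreal e}"
  have "(x, u) \<in> interior ?W" if "u \<in> D" for u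
  proof -
    obtain V where V: "open V" "\<phi> x u \<in> V" "\<And>v. v \<in> V \<Longrightarrow> v \<in> tup n \<Longrightarrow> N2 (\<lambda>y. f v y - f (\<phi> x u) y) < ennreal (e/4)"
      using ccochains_cont[OF f tup, of "e/4" x u] e by auto
    have \<phi>x: "continuous_on UNIV (\<lambda>p. \<phi> x (snd p))"
      using continuous_on_compose2[OF \<phi>, of UNIV "\<lambda>p. (x, snd p)"] by (simp add: continuous_intros)
    let ?O = "(\<lambda>p. \<phi> (fst p) (snd p)) -` V \<inter> (\<lambda>p. \<phi> x (snd p)) -` V"
    have "open ?O"
      using \<phi> \<phi>x V(1) by (intro open_Int) (auto simp: continuous_on_open_vimage)
    moreover have "(x, u) \<in> ?O" using V by simp
    moreover have "?O \<subseteq> ?W"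
    proof
      fix p assume p: "p \<in> ?O"
      have "N2 (\<lambda>y. f (\<phi> (fst p) (snd p)) y - f (\<phi> x (snd p)) y)
         \<le> 2 * N2 (\<lambda>y. f (\<phi> (fst p) (snd p)) y - f (\<phi> x u) y) + 2 * N2 (\<lambda>y. f (\<phi> x (snd p)) y - f (\<phi> x u) y)"
        by (rule N2_triangle) measurable
      also have "\<dots> < ennreal e"
        using p V(3) tup by (intro ennreal_quarter_less) auto
      finally show "p \<in> ?W" by simp
    qed
    ultimately show ?thesis by (metis (no_types, lifting) interiorI)
  qed
  then have "{x} \<times> D \<subseteq> interior ?W" by auto
  from Elementary_Topology.tube_lemma[OF D open_interior this] obtain U where U: "x \<in> U" "open U" "U \<times> D \<subseteq> interior ?W" by auto
  show ?thesis
  proof (rule that[OF U(2,1)])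
    fix w u assume "w \<in> U" "u \<in> D"
    then have "(w, u) \<in> ?W" using U(3) interior_subset by blast
    then show "N2 (\<lambda>y. f (\<phi> w u) y - f (\<phi> x u) y) < ennreal e" by simp
  qed
qed

text \<open>Jensen for each \<open>y\<close>, then Tonelli: an average has small norm as soon as the
  averaged functions do.\<close>

lemma N2_integral_KK_le:
  assumes [measurable]: "(\<lambda>(y, u). G y u) \<in> borel_measurable (M \<Otimes>\<^sub>M prodM M m)"
  shows "N2 (\<lambda>y. \<integral>u. G y u \<partial>KK m x) \<le> (\<integral>\<^sup>+u. N2 (\<lambda>y. G y u) \<partial>KK m x)"
proof -
  interpret pair_sigma_finite "KK m x" M ..
  have "N2 (\<lambda>y. \<integral>u. G y u \<partial>KK m x) \<le> (\<integral>\<^sup>+y. \<integral>\<^sup>+u. ennreal ((cmod (G y u))\<^sup>2) \<partial>KK m x \<partial>M)"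
    unfolding N2_def
  proof (intro nn_integral_mono norm_integral_square_le KK.prob_space_axioms)
    fix y assume "y \<in> space M"
    from measurable_compose[OF measurable_Pair1'[OF this] assms]
    show "G y \<in> borel_measurable (KK m x)" by simp
  qed
  also have "\<dots> = (\<integral>\<^sup>+u. \<integral>\<^sup>+y. ennreal ((cmod (G y u))\<^sup>2) \<partial>M \<partial>KK m x)"
    by (rule Fubini') measurable
  finally show ?thesis by (simp add: N2_def)
qed

lemma AE_KK_orig_box: "AE u in KK m (orig m). u \<in> box m 1"
proof -
  from AE_space AE_KK_close[OF orig_tup] show ?thesis
    by eventually_elim (auto simp: mem_box_iff orig_def less_imp_le)
qed

lemma nn_integral_KK_orig_le:
  assumes "\<And>u. u \<in> box m 1 \<Longrightarrow> F u \<le> B"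
  shows "(\<integral>\<^sup>+u. F u \<partial>KK m (orig m)) \<le> B"
proof -
  have "(\<integral>\<^sup>+u. F u \<partial>KK m (orig m)) \<le> (\<integral>\<^sup>+u. B \<partial>KK m (orig m))"
    by (rule nn_integral_mono_AE) (use AE_KK_orig_box[of m] in eventually_elim, use assms in auto)
  then show ?thesis using KK.emeasure_space_1[of m "orig m"] by simp
qed

lemma mixt_N2_bounded:
  assumes f: "f \<in> ccochains M (Suc m)" and i: "i \<le> m"
  obtains B where "\<And>u. u \<in> box m 1 \<Longrightarrow> N2 (f (mixt m i x u)) \<le> ennreal B"
proof -
  have "continuous_on UNIV (mixt m i x)"
    using continuous_on_compose2[OF mixt_continuous[OF i], of UNIV "\<lambda>u. (x, u)"] by (simp add: continuous_intros)
  then have "compact (mixt m i x ` box m 1)"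
    using compact_box continuous_on_subset by (blast intro: compact_continuous_image)
  from N2_bounded[OF f this] that show ?thesis by (metis image_eqI image_subsetI mixt_tup)
qed

text \<open>The square integral over \<open>y\<close> and \<open>u\<close> together is an average of
  \<open>N2 (f (mixt m i x u))\<close> over a compact set, hence finite. So integrability holds at
  every \<open>x\<close>, for almost every \<open>y\<close>.\<close>

lemma ver_mixt_integrable:
  assumes f: "f \<in> ccochains M (Suc m)" and v: "ver (Suc m) f \<alpha>" and i: "i \<le> m" and x: "x \<in> tup m"
  shows "AE y in M. integrable (KK m (orig m)) (\<lambda>u. \<alpha> (act (Suc m) (- y) (mixt m i x u)))"
proof -
  note [measurable] = verD(1)[OF v] i x
  interpret pair_sigma_finite "KK m (orig m)" M ..
  let ?F = "\<lambda>y u. ennreal ((cmod (\<alpha> (act (Suc m) (- y) (mixt m i x u))))\<^sup>2)"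
  obtain B where B: "\<And>u. u \<in> box m 1 \<Longrightarrow> N2 (f (mixt m i x u)) \<le> ennreal B"
    using mixt_N2_bounded[OF f i] by metis
  have "(\<integral>\<^sup>+y. \<integral>\<^sup>+u. ?F y u \<partial>KK m (orig m) \<partial>M) = (\<integral>\<^sup>+u. \<integral>\<^sup>+y. ?F y u \<partial>M \<partial>KK m (orig m))"
    by (rule Fubini') measurable
  also have "\<dots> = (\<integral>\<^sup>+u. N2 (f (mixt m i x u)) \<partial>KK m (orig m))"
    by (simp add: ver_N2[OF v] orb_def)
  also have "\<dots> \<le> ennreal B" by (rule nn_integral_KK_orig_le[OF B])
  finally have "(\<integral>\<^sup>+y. \<integral>\<^sup>+u. ?F y u \<partial>KK m (orig m) \<partial>M) \<noteq> \<infinity>" by (auto simp: top_unique)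
  then have "AE y in M. (\<integral>\<^sup>+u. ?F y u \<partial>KK m (orig m)) \<noteq> \<infinity>"
    by (intro nn_integral_PInf_AE) measurable
  then show ?thesis
  proof eventually_elim
    fix y assume fin: "(\<integral>\<^sup>+u. ?F y u \<partial>KK m (orig m)) \<noteq> \<infinity>"
    show "integrable (KK m (orig m)) (\<lambda>u. \<alpha> (act (Suc m) (- y) (mixt m i x u)))"
      by (rule KK_integrableI) (use fin in \<open>auto simp: less_top\<close>)
  qed
qed

text \<open>The invariant map belonging to \<open>hmt m \<alpha>\<close>, as
  \<open>Psi n \<alpha>\<close> belongs to \<open>smooth n \<alpha>\<close>. Its continuity comes
  from that of \<open>f\<close>, not from a Lipschitz kernel.\<close>

definition hmtC :: "nat \<Rightarrow> ((nat \<Rightarrow> 'g) \<Rightarrow> complex) \<Rightarrow> (nat \<Rightarrow> 'g) \<Rightarrow> 'g \<Rightarrow> complex" where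
  "hmtC m \<alpha> x = (if x \<in> tup m then (\<lambda>y. hmt m \<alpha> (act m (- y) x)) else 0)"

lemma mix_integral_eq:
  fixes \<alpha> :: "(nat \<Rightarrow> 'g) \<Rightarrow> complex"
  assumes [measurable]: "\<alpha> \<in> borel_measurable (prodM M (Suc m))" and i: "i \<le> m"
  shows "(\<integral>z. \<alpha> (mix m i (act m g x) z) \<partial>KK m (act m g x)) = (\<integral>u. \<alpha> (act (Suc m) g (mixt m i x u)) \<partial>KK m (orig m))"
    "integrable (KK m (act m g x)) (\<lambda>z. \<alpha> (mix m i (act m g x) z)) \<longleftrightarrow> integrable (KK m (orig m)) (\<lambda>u. \<alpha> (act (Suc m) g (mixt m i x u)))"
proof -
  note [measurable] = i
  have [measurable]: "tmul m (act m g x) \<in> measurable (KK m (orig m)) (prodM M m)"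
    by (rule tmul_measurable[of "\<lambda>_. act m g x" "KK m (orig m)" m "\<lambda>u. u"]) (simp_all add: measurable_ident_sets)
  have [measurable]: "(\<lambda>z. \<alpha> (mix m i (act m g x) z)) \<in> borel_measurable (prodM M m)" using i by measurable
  have *: "mix m i (act m g x) (tmul m (act m g x) u) = act (Suc m) g (mixt m i x u)" for u
    using mixt_act[OF i] by (simp add: mixt_def)
  show "(\<integral>z. \<alpha> (mix m i (act m g x) z) \<partial>KK m (act m g x)) = (\<integral>u. \<alpha> (act (Suc m) g (mixt m i x u)) \<partial>KK m (orig m))"
    by (subst KK_orig[OF act_tup], subst integral_distr) (simp_all add: *)
  show "integrable (KK m (act m g x)) (\<lambda>z. \<alpha> (mix m i (act m g x) z)) \<longleftrightarrow> integrable (KK m (orig m)) (\<lambda>u. \<alpha> (act (Suc m) g (mixt m i x u)))"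
    by (subst KK_orig[OF act_tup], subst integrable_distr_eq) (simp_all add: *)
qed

lemma hmtC_eq:
  assumes "\<alpha> \<in> borel_measurable (prodM M (Suc m))" "x \<in> tup m"
  shows "hmtC m \<alpha> x y = (\<Sum>i\<le>m. (-1) ^ i * (\<integral>u. \<alpha> (act (Suc m) (- y) (mixt m i x u)) \<partial>KK m (orig m)))"
  using assms by (auto simp: hmtC_def hmt_def mix_integral_eq intro!: sum.cong)

lemma hmtC_ccochains:
  assumes f: "f \<in> ccochains M (Suc m)" and v: "ver (Suc m) f \<alpha>"
  shows "hmtC m \<alpha> \<in> ccochains M m"
  unfolding ccochains_iff
proof (intro conjI ballI allI impI)
  note [measurable] = verD(1)[OF v] ccochainsD(2)[OF f]
  fix x :: "nat \<Rightarrow> 'g"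
  show "x \<notin> tup m \<Longrightarrow> hmtC m \<alpha> x = 0" by (simp add: hmtC_def)
  assume x [measurable, simp]: "x \<in> tup m"
  have xs [measurable]: "x \<in> space (prodM M m)" by simp
  show "hmtC m \<alpha> x \<in> borel_measurable borel" by (simp add: hmtC_def)
  show "AE y in M. hmtC m \<alpha> (act m g x) y = hmtC m \<alpha> x (- g + y)" for g
    by (simp add: hmtC_def minus_add)
  let ?T = "\<lambda>i x y. \<integral>u. \<alpha> (act (Suc m) (- y) (mixt m i x u)) \<partial>KK m (orig m)"
  have Tm: "?T i w \<in> borel_measurable borel" if [measurable]: "i \<le> m" "w \<in> tup m" for i w
    by measurable
  have sum_le: "N2 (\<lambda>y. \<Sum>i\<le>m. (-1) ^ i * S i y) \<le> of_nat (Suc m) * (\<Sum>i\<le>m. N2 (S i))"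
    if "\<And>i. i \<le> m \<Longrightarrow> S i \<in> borel_measurable borel" for S
  proof -
    have "N2 (\<lambda>y. \<Sum>i\<le>m. (-1) ^ i * S i y) \<le> of_nat (card {..m}) * (\<Sum>i\<le>m. N2 (\<lambda>y. (-1) ^ i * S i y))"
      using that by (intro N2_sum_le) auto
    also have "\<dots> = of_nat (Suc m) * (\<Sum>i\<le>m. N2 (S i))" by (simp add: N2_def norm_mult norm_power)
    finally show ?thesis .
  qed
  have "N2 (hmtC m \<alpha> x) = N2 (\<lambda>y. \<Sum>i\<le>m. (-1) ^ i * ?T i x y)"
    by (rule arg_cong[of _ _ N2]) (auto simp: hmtC_eq)
  also have "\<dots> \<le> of_nat (Suc m) * (\<Sum>i\<le>m. N2 (?T i x))" by (intro sum_le Tm) auto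
  also have "\<dots> < \<infinity>"
  proof -
    have "N2 (?T i x) < \<infinity>" if i [measurable]: "i \<le> m" for i
    proof -
      obtain B where B: "\<And>u. u \<in> box m 1 \<Longrightarrow> N2 (f (mixt m i x u)) \<le> ennreal B"
        using mixt_N2_bounded[OF f i] by metis
      have "N2 (?T i x) \<le> (\<integral>\<^sup>+u. N2 (\<lambda>y. \<alpha> (act (Suc m) (- y) (mixt m i x u))) \<partial>KK m (orig m))"
        by (rule N2_integral_KK_le) measurable
      also have "\<dots> = (\<integral>\<^sup>+u. N2 (f (mixt m i x u)) \<partial>KK m (orig m))"
        by (simp add: ver_N2[OF v] orb_def N2_def[of "\<lambda>y. \<alpha> (_ y)"])
      also have "\<dots> \<le> ennreal B" by (rule nn_integral_KK_orig_le[OF B])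
      finally show ?thesis by (rule le_less_trans) simp
    qed
    then have "(\<Sum>i\<le>m. N2 (?T i x)) < \<infinity>"
      unfolding infinity_ennreal_def by (subst ennreal_sum_less_top) auto
    then show ?thesis by (simp add: ennreal_mult_less_top of_nat_less_top del: of_nat_Suc)
  qed
  finally show "N2 (hmtC m \<alpha> x) < \<infinity>" .
  fix e :: real assume e: "e > 0"
  \<comment> \<open>With m + 1 terms, Cauchy-Schwarz and the summation each cost a factor m + 1; the
    2 makes the final inequality strict.\<close>
  define e' where "e' = e / (2 * (real (Suc m) * real (Suc m)))"
  have e': "e' > 0" using e by (simp add: e'_def)
  have "\<exists>U. open U \<and> x \<in> U \<and> (\<forall>w\<in>U. \<forall>u\<in>box m 1. N2 (\<lambda>y. f (mixt m i w u) y - f (mixt m i x u) y) < ennreal e')"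
    if i: "i \<le> m" for i
    using ccochains_uniform[OF f mixt_continuous[OF i] mixt_tup compact_box e', of x m 1] by metis
  then have "\<forall>i\<in>{..m}. \<exists>U. open U \<and> x \<in> U \<and> (\<forall>w\<in>U. \<forall>u\<in>box m 1. N2 (\<lambda>y. f (mixt m i w u) y - f (mixt m i x u) y) < ennreal e')"
    by auto
  from bchoice[OF this] obtain U where U: "\<And>i. i \<le> m \<Longrightarrow> open (U i)" "\<And>i. i \<le> m \<Longrightarrow> x \<in> U i"
    "\<And>i w u. i \<le> m \<Longrightarrow> w \<in> U i \<Longrightarrow> u \<in> box m 1 \<Longrightarrow> N2 (\<lambda>y. f (mixt m i w u) y - f (mixt m i x u) y) < ennreal e'"
    by (auto simp del: ball_simps)
  show "\<exists>U. open U \<and> x \<in> U \<and> (\<forall>w\<in>U \<inter> tup m. N2 (\<lambda>y. hmtC m \<alpha> w y - hmtC m \<alpha> x y) < ennreal e)"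
  proof (intro exI conjI ballI)
    show "open (\<Inter>i\<in>{..m}. U i)" using U(1) by (intro open_INT) auto
    show "x \<in> (\<Inter>i\<in>{..m}. U i)" using U(2) by auto
    fix w assume w: "w \<in> (\<Inter>i\<in>{..m}. U i) \<inter> tup m"
    then have wt [measurable, simp]: "w \<in> tup m" by simp
    have "N2 (\<lambda>y. hmtC m \<alpha> w y - hmtC m \<alpha> x y) = N2 (\<lambda>y. \<Sum>i\<le>m. (-1) ^ i * (?T i w y - ?T i x y))"
      by (rule arg_cong[of _ _ N2]) (auto simp: hmtC_eq right_diff_distrib sum_subtractf)
    also have "\<dots> \<le> of_nat (Suc m) * (\<Sum>i\<le>m. N2 (\<lambda>y. ?T i w y - ?T i x y))"
      by (intro sum_le borel_measurable_diff Tm) auto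
    also have "\<dots> \<le> of_nat (Suc m) * (\<Sum>i\<le>m. ennreal e')"
    proof (intro mult_left_mono sum_mono)
      fix i assume "i \<in> {..m}"
      then have i [measurable]: "i \<le> m" by simp
      let ?G = "\<lambda>y u. \<alpha> (act (Suc m) (- y) (mixt m i w u)) - \<alpha> (act (Suc m) (- y) (mixt m i x u))"
      \<comment> \<open>The difference of averages is the average of the differences only where both
        integrals exist, which is the case for almost every \<open>y\<close>.\<close>
      have "AE y in M. ?T i w y - ?T i x y = (\<integral>u. ?G y u \<partial>KK m (orig m))"
        using ver_mixt_integrable[OF f v i wt] ver_mixt_integrable[OF f v i x] by eventually_elim simp
      then have "N2 (\<lambda>y. ?T i w y - ?T i x y) = N2 (\<lambda>y. \<integral>u. ?G y u \<partial>KK m (orig m))"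
        by (rule N2_cong_AE)
      also have "\<dots> \<le> (\<integral>\<^sup>+u. N2 (\<lambda>y. ?G y u) \<partial>KK m (orig m))"
        by (rule N2_integral_KK_le) measurable
      also have "\<dots> \<le> ennreal e'"
      proof (rule nn_integral_KK_orig_le)
        fix u assume u: "u \<in> box m 1"
        have "AE y in M. ?G y u = f (mixt m i w u) y - f (mixt m i x u) y"
          using verD(3)[OF v mixt_tup[of m i w u]] verD(3)[OF v mixt_tup[of m i x u]] by eventually_elim simp
        then have "N2 (\<lambda>y. ?G y u) = N2 (\<lambda>y. f (mixt m i w u) y - f (mixt m i x u) y)" by (rule N2_cong_AE)
        then show "N2 (\<lambda>y. ?G y u) \<le> ennreal e'" using U(3)[OF i _ u, of w] w i by auto
      qed
      finally show "N2 (\<lambda>y. ?T i w y - ?T i x y) \<le> ennreal e'" .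
    qed simp
    also have "\<dots> = ennreal (real (Suc m) * (real (Suc m) * e'))"
      using e' by (simp add: ennreal_mult ennreal_of_nat_eq_real_of_nat del: of_nat_Suc)
    also have "real (Suc m) * (real (Suc m) * e') = e / 2"
      by (simp add: e'_def field_simps del: of_nat_Suc)
    also have "ennreal (e / 2) < ennreal e" using e by (intro ennreal_lessI) auto
    finally show "N2 (\<lambda>y. hmtC m \<alpha> w y - hmtC m \<alpha> x y) < ennreal e" .
  qed
qed

section \<open>Comparing cocycles and coboundaries of the two complexes\<close>

lemma ver_xZ:
  assumes f: "f \<in> cZ M n" and v: "ver n f \<alpha>"
  shows "\<alpha> \<in> xZ M n"
proof -
  have "ver (Suc n) 0 0" by (auto simp: ver_def zero_fun_def)
  from ver_eq_AE[OF ver_cd[OF v] this] have "AE z in prodM M (Suc n). xd n \<alpha> z = 0"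
    using f by (auto simp: cZ_def)
  then show ?thesis using ver_xcochains[OF _ v] f by (auto simp: xZ_def cZ_def)
qed

lemma ver_xB:
  assumes f: "f \<in> cB M n" and v: "ver n f \<alpha>"
  shows "\<alpha> \<in> xB M n"
proof -
  have \<alpha>: "\<alpha> \<in> xcochains M n" using ver_xcochains[OF _ v] f by (auto simp: cB_def)
  show ?thesis
  proof (cases n)
    case 0
    have "ver n 0 0" by (auto simp: ver_def zero_fun_def)
    from ver_eq_AE[OF v this] show ?thesis using f \<alpha> 0 by (auto simp: cB_def xB_iff)
  next
    case (Suc m)
    then obtain h where h: "h \<in> ccochains M m" "\<And>x. x \<in> tup n \<Longrightarrow> AE y in M. f x y = cd m h x y"
      using f by (auto simp: cB_def)
    obtain \<gamma> where \<gamma>: "ver m h \<gamma>" using ver_exists[OF h(1)] by blast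
    have "ver n (cd m h) (xd m \<gamma>)" using ver_cd[OF \<gamma>] Suc by simp
    from ver_eq_AE[OF v this h(2)] show ?thesis
      using \<alpha> ver_xcochains[OF h(1) \<gamma>] Suc by (auto simp: xB_iff)
  qed
qed

text \<open>The cocycle condition of \<open>f\<close> holds at each prism simplex for almost every
  \<open>y\<close>. Exchanging the quantifiers over \<open>y\<close> and \<open>z\<close> gives, for
  almost every \<open>y\<close>, the hypothesis of \<open>smooth_homotopy\<close> at the translated
  tuple.\<close>

lemma ver_cocycle_AE:
  assumes f: "f \<in> cZ M n" and v: "ver n f \<alpha>" and x: "x \<in> tup n" and i: "i \<le> n"
  shows "AE y in M. AE z in KK n (act n (- y) x). xd n \<alpha> (mix n i (act n (- y) x) z) = 0"
proof -
  note [measurable] = verD(1)[OF v] i x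
  have [measurable]: "x \<in> space (prodM M n)" using x by simp
  interpret pair_sigma_finite "KK n x" M ..
  let ?P = "\<lambda>z y. xd n \<alpha> (act (Suc n) (- y) (mix n i x z)) = 0"
  have "AE y in M. ?P z y" for z
  proof -
    have w: "mix n i x z \<in> tup (Suc n)" by simp
    have "AE y in M. cd n f (mix n i x z) y = 0" using f w by (auto simp: cZ_def)
    with verD(3)[OF ver_cd[OF v] w] show ?thesis by eventually_elim simp
  qed
  then have "AE z in KK n x. AE y in M. ?P z y" by simp
  moreover have "{p \<in> space (KK n x \<Otimes>\<^sub>M M). ?P (fst p) (snd p)} \<in> sets (KK n x \<Otimes>\<^sub>M M)"
    by measurable
  ultimately have "AE y in M. AE z in KK n x. ?P z y"
    by (subst (asm) AE_commute) auto
  then show ?thesis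
  proof eventually_elim
    fix y assume *: "AE z in KK n x. ?P z y"
    have [measurable]: "act n (- y) \<in> measurable (KK n x) (prodM M n)" by measurable
    have "Measurable.pred (prodM M n) (\<lambda>z. xd n \<alpha> (mix n i (act n (- y) x) z) = 0)" by measurable
    then have s: "{z \<in> space (prodM M n). xd n \<alpha> (mix n i (act n (- y) x) z) = 0} \<in> sets (prodM M n)" by (simp only: pred_def)
    show "AE z in KK n (act n (- y) x). xd n \<alpha> (mix n i (act n (- y) x) z) = 0"
      by (subst distr_KK_act[symmetric], subst AE_distr_iff[OF _ s]) (use * i in \<open>auto simp: mix_act\<close>)
  qed
qed

text \<open>The homotopy formula is applied at \<open>act n (- y) x\<close> for almost every
  \<open>y\<close> and read as an equality of functions of \<open>y\<close>; so \<open>ver\<close>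
  inverts \<open>Psi\<close> up to coboundaries.\<close>

lemma Psi_ver_cB:
  assumes f: "f \<in> cZ M n" and v: "ver n f \<alpha>"
  shows "Psi n \<alpha> - f \<in> cB M n"
proof -
  have fc: "f \<in> ccochains M n" using f by (auto simp: cZ_def)
  have \<alpha>: "\<alpha> \<in> xcochains M n" by (rule ver_xcochains[OF fc v])
  have dc: "Psi n \<alpha> - f \<in> ccochains M n"
    by (rule add_closedD(4)[OF ccochains_add_closed Psi_ccochains[OF \<alpha>] fc])
  note [measurable] = verD(1)[OF v]
  have cocycle: "AE y in M. \<forall>i\<in>{..n}. AE z in KK n (act n (- y) x). xd n \<alpha> (mix n i (act n (- y) x) z) = 0"
    if "x \<in> tup n" for x
    using ver_cocycle_AE[OF f v that] by (intro AE_finite_allI) auto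
  show ?thesis
  proof (cases n)
    case 0
    have "AE y in M. (Psi n \<alpha> - f) x y = 0" if x: "x \<in> tup n" for x
      using cocycle[OF x] verD(3)[OF v x]
    proof eventually_elim
      fix y assume "\<forall>i\<in>{..n}. AE z in KK n (act n (- y) x). xd n \<alpha> (mix n i (act n (- y) x) z) = 0"
        and e: "f x y = \<alpha> (act n (- y) x)"
      then have "smooth n \<alpha> (act n (- y) x) = \<alpha> (act n (- y) x)"
        using \<alpha> 0 by (auto intro!: smooth_eq_0 xcochainsD xcochains_integrable_KK)
      then show "(Psi n \<alpha> - f) x y = 0" using e x by (simp add: Psi_def)
    qed
    then show ?thesis using dc 0 by (auto simp: cB_def)
  next
    case (Suc m)
    have fc': "f \<in> ccochains M (Suc m)" and v': "ver (Suc m) f \<alpha>" and \<alpha>': "\<alpha> \<in> xcochains M (Suc m)"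
      using fc v \<alpha> Suc by auto
    have "AE y in M. (Psi n \<alpha> - f) x y = cd m (hmtC m \<alpha>) x y" if x: "x \<in> tup n" for x
    proof -
      have "AE y in M. \<forall>j\<in>{..Suc m}. \<forall>i\<in>{..m}. integrable (KK m (act m (- y) (face (Suc m) j x)))
         (\<lambda>z. \<alpha> (mix m i (act m (- y) (face (Suc m) j x)) z))"
        using ver_mixt_integrable[OF fc' v'] mix_integral_eq(2)[OF verD(1)[OF v']]
        by (intro AE_finite_allI) auto
      with cocycle[OF x] verD(3)[OF v x] show ?thesis
      proof eventually_elim
        fix y assume c: "\<forall>i\<in>{..n}. AE z in KK n (act n (- y) x). xd n \<alpha> (mix n i (act n (- y) x) z) = 0"
          and e: "f x y = \<alpha> (act n (- y) x)"
          and int: "\<forall>j\<in>{..Suc m}. \<forall>i\<in>{..m}. integrable (KK m (act m (- y) (face (Suc m) j x)))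
             (\<lambda>z. \<alpha> (mix m i (act m (- y) (face (Suc m) j x)) z))"
        have "smooth (Suc m) \<alpha> (act (Suc m) (- y) x) - \<alpha> (act (Suc m) (- y) x) = xd m (hmt m \<alpha>) (act (Suc m) (- y) x)"
          using c int Suc by (intro smooth_homotopy[OF verD(1)[OF v']] xcochains_integrable_KK[OF \<alpha>']) auto
        moreover have "xd m (hmt m \<alpha>) (act (Suc m) (- y) x) = cd m (hmtC m \<alpha>) x y"
          using x Suc by (simp add: cd_def xd_def hmtC_def del: sum.atMost_Suc)
        ultimately show "(Psi n \<alpha> - f) x y = cd m (hmtC m \<alpha>) x y"
          using e x Suc by (simp add: Psi_def)
      qed
    qed
    then show ?thesis using dc hmtC_ccochains[OF fc' v'] Suc by (auto simp: cB_def)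
  qed
qed

text \<open>Injectivity: \<open>smooth n \<alpha>\<close> is a version of
  \<open>Psi n \<alpha>\<close>, hence a coboundary along with it, and it is cohomologous to
  \<open>\<alpha>\<close>.\<close>

lemma Psi_cB_iff:
  assumes a: "\<alpha> \<in> xZ M n"
  shows "Psi n \<alpha> \<in> cB M n \<longleftrightarrow> \<alpha> \<in> xB M n"
proof
  assume b: "Psi n \<alpha> \<in> cB M n"
  have "\<alpha> \<in> xcochains M n" using a by (auto simp: xZ_def)
  from ver_xB[OF b ver_Psi[OF this]] have "smooth n \<alpha> \<in> xB M n" .
  from add_closedD(4)[OF xB_add_closed this smooth_minus_xB[OF a]] show "\<alpha> \<in> xB M n" by simp
qed (rule Psi_cB)

text \<open>For a given radius \<open>R\<close>, approximation of \<open>Psi n \<alpha>\<close> on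
  the compact slice \<open>DD n 1 R\<close> becomes approximation of
  \<open>smooth n \<alpha>\<close> in the seminorm of radius \<open>R\<close>.\<close>

lemma Psi_cBcl_iff:
  assumes a: "\<alpha> \<in> xZ M n"
  shows "Psi n \<alpha> \<in> cBcl M n \<longleftrightarrow> \<alpha> \<in> xBcl M n"
proof
  assume cl: "Psi n \<alpha> \<in> cBcl M n"
  have ac: "\<alpha> \<in> xcochains M n" using a by (auto simp: xZ_def)
  have "\<exists>\<beta>\<in>xB M n. xnorm2 M n R (\<alpha> - \<beta>) < ennreal e" if R: "R > 0" and e: "e > 0" for R e
  proof -
    let ?C = "inverse (emeasure M (cball 0 1)) * emeasure (prodM M n) (DD n 1 R)"
    have "?C < \<infinity>" using inverse_cball_finite emeasure_DD_finite by (simp add: ennreal_mult_less_top)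
    then obtain C where C: "?C = ennreal C" "C \<ge> 0" by (cases ?C) auto
    have "DD n 1 R \<subseteq> tup n" by (auto simp: DD_def GR_def)
    from cBclD[OF cl compact_DD this, of "e / (C + 1)"] C e
    obtain b where b: "b \<in> cB M n" "\<forall>x\<in>DD n 1 R. N2 (\<lambda>y. Psi n \<alpha> x y - b x y) < ennreal (e / (C + 1))" by auto
    have "b \<in> ccochains M n" using b by (auto simp: cB_def)
    then obtain \<gamma> where \<gamma>: "ver n b \<gamma>" using ver_exists by blast
    \<comment> \<open>The coboundary \<open>smooth n \<alpha> - \<alpha>\<close> is subtracted so
      that \<open>\<alpha> - \<beta>\<close> equals \<open>smooth n \<alpha> - \<gamma>\<close>,
      which has the version estimate.\<close>
    define \<beta> where "\<beta> = \<gamma> - (smooth n \<alpha> - \<alpha>)"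
    have "\<beta> \<in> xB M n"
      unfolding \<beta>_def by (rule add_closedD(4)[OF xB_add_closed ver_xB[OF b(1) \<gamma>] smooth_minus_xB[OF a]])
    moreover have "xnorm2 M n R (\<alpha> - \<beta>) < ennreal e"
    proof -
      have "xnorm2 M n R (smooth n \<alpha> - \<gamma>) \<le> inverse (emeasure M (cball 0 1)) * (emeasure (prodM M n) (DD n 1 R) * ennreal (e / (C + 1)))"
        by (rule ver_xnorm2_le[OF ver_diff[OF ver_Psi[OF ac] \<gamma>]])
          (use b(2) in \<open>auto simp: fun_diff_def intro: less_imp_le\<close>)
      also have "\<dots> = ennreal (C * (e / (C + 1)))"
        using C e by (simp add: mult.assoc[symmetric] ennreal_mult[symmetric])
      also have "\<dots> < ennreal e" using C e by (intro ennreal_lessI) (auto simp: field_simps)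
      finally show ?thesis by (simp add: \<beta>_def)
    qed
    ultimately show ?thesis by blast
  qed
  then show "\<alpha> \<in> xBcl M n" using ac by (auto simp: xBcl_def)
qed (rule Psi_cBcl)

lemma Psi_surj:
  assumes f: "f \<in> cZ M n"
  shows "\<exists>\<alpha>\<in>xZ M n. f - Psi n \<alpha> \<in> cB M n"
proof -
  have "f \<in> ccochains M n" using f by (auto simp: cZ_def)
  then obtain \<alpha> where v: "ver n f \<alpha>" using ver_exists by blast
  from add_closedD(3)[OF cB_add_closed Psi_ver_cB[OF f v]] have "f - Psi n \<alpha> \<in> cB M n" by simp
  then show ?thesis using ver_xZ[OF f v] by blast
qed

lemma Psi_add_xZ: "\<alpha> \<in> xZ M n \<Longrightarrow> \<beta> \<in> xZ M n \<Longrightarrow> Psi n (\<alpha> + \<beta>) = Psi n \<alpha> + Psi n \<beta>"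
  by (rule Psi_add) (auto simp: xZ_def)

theorem cohomology_iso: "(add_monoid (cZ M n) Mod cB M n) \<cong> (add_monoid (xZ M n) Mod xB M n)"
  by (rule FactGroup_iso_add_monoid[of _ _ _ _ "Psi n"])
    (use xZ_add_closed xB_add_closed xB_subset_xZ cZ_add_closed cB_add_closed cB_subset_cZ
      Psi_cZ Psi_add_xZ Psi_cB_iff Psi_surj in auto)

theorem reduced_cohomology_iso: "(add_monoid (cZ M n) Mod cBcl M n) \<cong> (add_monoid (xZ M n) Mod xBcl M n)"
proof (rule FactGroup_iso_add_monoid[of _ _ _ _ "Psi n"])
  fix f assume "f \<in> cZ M n"
  from Psi_surj[OF this] show "\<exists>\<alpha>\<in>xZ M n. f - Psi n \<alpha> \<in> cBcl M n" using cB_subset_cBcl by blast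
qed (use xZ_add_closed xBcl_add_closed xBcl_subset_xZ cZ_add_closed cBcl_add_closed cBcl_subset_cZ
      Psi_cZ Psi_add_xZ Psi_cBcl_iff in auto)

end

theorem theorem3p3:
  fixes M :: "'g::{group_add, metric_space, second_countable_topology} measure"
    and n :: nat
  assumes mult_cont: "continuous_on UNIV (\<lambda>p::'g \<times> 'g. fst p + snd p)"
    and inv_cont: "continuous_on UNIV (uminus :: 'g \<Rightarrow> 'g)"
    and left_inv_metric: "\<forall>g x y :: 'g. dist (g + x) (g + y) = dist x y"
    and proper_metric: "\<forall>(x::'g) r. compact (cball x r)"
    and borel_M: "sets M = sets borel"
    and haar_left: "\<forall>(g::'g). \<forall>A\<in>sets borel. emeasure M ((\<lambda>x. g + x) ` A) = emeasure M A"
    and haar_compact: "\<forall>K::'g set. compact K \<longrightarrow> emeasure M K < \<infinity>"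
    and haar_open: "\<forall>U::'g set. open U \<and> U \<noteq> {} \<longrightarrow> emeasure M U > 0"
    and unimodular: "\<forall>(g::'g). \<forall>A\<in>sets borel. emeasure M ((\<lambda>x. x + g) ` A) = emeasure M A"
  shows "(add_monoid (cZ M n) Mod cB M n) \<cong> (add_monoid (xZ M n) Mod xB M n)
       \<and> (add_monoid (cZ M n) Mod cBcl M n) \<cong> (add_monoid (xZ M n) Mod xBcl M n)"
  proof -
  interpret unimodular_group M
    by (rule unimodular_group.intro) fact+
  show ?thesis
    using cohomology_iso reduced_cohomology_iso by blast
qed

end
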